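(* Let $\Omega\subset\mathbb{R}^n$ ($n=2$ or $3$) be a bounded, open, connected domain with Lipschitz boundary and outward unit normal $\bm{n}$. Let $\kappa:\Omega\to\mathbb{R}$ be the (isotropic) hydraulic conductivity and $\lambda=1/\kappa$ the hydraulic resistivity, with $\lambda\in C^1(\Omega)$ and constants $0<\kappa_{\min}\le\kappa_{\max}$, $0<\lambda_{\min}\le\lambda_{\max}$ such that $\kappa_{\min}\le\kappa(\bm{x})\le\kappa_{\max}$ and $\lambda_{\min}\le\lambda(\bm{x})\le\lambda_{\max}$ for all $\bm{x}\in\Omega$. Let $f\in L^2(\Omega)$ with $\int_\Omega f\,d\Omega=0$. Let $$\mathcal{U}=\{\bm{v}\in[L^2(\Omega)]^n:\ \operatorname{div}\bm{v}\in L^2(\Omega),\ \operatorname{curl}(\lambda\bm{v})\in[L^2(\Omega)]^{2n-3},\ \bm{v}\cdot\bm{n}=0\text{ on }\partial\Omega\},\qquad \mathcal{P}=\{q\in H^1(\Omega):\ (q,1)=0\},$$ and define, for $\{\bm{u},p\},\{\bm{v},q\}\in\mathcal{U}\times\mathcal{P}$, $$B_{\mathrm{CGLS}}(\{\bm{u},p\};\{\bm{v},q\})=(\lambda\bm{u},\bm{v})-(\operatorname{div}\bm{v},p)-(\operatorname{div}\bm{u},q)-\tfrac12\big(\kappa(\lambda\bm{u}+\nabla p),\lambda\bm{v}+\nabla q\big)+\tfrac12(\lambda\operatorname{div}\bm{u},\operatorname{div}\bm{v})+\tfrac12\big(\kappa\operatorname{curl}(\lambda\bm{u}),\operatorname{curl}(\lambda\bm{v})\big),$$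 $$F_{\mathrm{CGLS}}(\{\bm{v},q\})=-(f,q)+\tfrac12(\lambda f,\operatorname{div}\bm{v}).$$ Then there exists a unique $\{\bm{u},p\}\in\mathcal{U}\times\mathcal{P}$ such that $B_{\mathrm{CGLS}}(\{\bm{u},p\};\{\bm{v},q\})=F_{\mathrm{CGLS}}(\{\bm{v},q\})$ for all $\{\bm{v},q\}\in\mathcal{U}\times\mathcal{P}$ (Problem CGLS).
   Context: $(\cdot,\cdot)$ denotes the $L^2(\Omega)$ inner product and $\|\cdot\|$ the $L^2(\Omega)$ norm. For $n=3$, $\operatorname{curl}$ is the usual curl; for $n=2$, $\mathbb{R}^2$ is identified with the $(x_1,x_2)$-plane in $\mathbb{R}^3$, so that $\operatorname{curl}\bm{w}=\partial w_2/\partial x_1-\partial w_1/\partial x_2$ is scalar. $\mathcal{U}\times\mathcal{P}$ carries the norm $\|\{\bm{u},p\}\|_{\mathcal{U}\times\mathcal{P}}^2=\|\bm{u}\|^2+\|\operatorname{div}\bm{u}\|^2+\|\operatorname{curl}(\lambda\bm{u})\|^2+\|\nabla p\|^2$. *)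

theory Defs
  imports "HOL-Analysis.Analysis"
begin

definition oint :: "(real^'n) set \<Rightarrow> (real^'n \<Rightarrow> real) \<Rightarrow> real" where
  "oint \<Omega> f = integral\<^sup>L (lebesgue_on \<Omega>) f"

definition L2 :: "(real^'n) set \<Rightarrow> (real^'n \<Rightarrow> real) \<Rightarrow> bool" where
  "L2 \<Omega> f \<longleftrightarrow> f \<in> borel_measurable (lebesgue_on \<Omega>) \<and>
                 integrable (lebesgue_on \<Omega>) (\<lambda>x. (f x)\<^sup>2)"

definition L2v :: "(real^'n) set \<Rightarrow> (real^'n \<Rightarrow> real^'n) \<Rightarrow> bool" where
  "L2v \<Omega> v \<longleftrightarrow> (\<forall>i. L2 \<Omega> (\<lambda>x. v x $ i))"

definition pd :: "'n::finite \<Rightarrow> (real^'n \<Rightarrow> real) \<Rightarrow> real^'n \<Rightarrow> real" where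
  "pd i \<phi> x = frechet_derivative \<phi> (at x) (axis i 1)"

definition grad :: "(real^'n \<Rightarrow> real) \<Rightarrow> real^'n \<Rightarrow> real^'n" where
  "grad \<phi> x = (\<chi> i. pd i \<phi> x)"

coinductive smooth_fun :: "(real^'n \<Rightarrow> real) \<Rightarrow> bool" where
  "(\<forall>x. \<phi> differentiable (at x)) \<Longrightarrow> (\<forall>i. smooth_fun (pd i \<phi>)) \<Longrightarrow> smooth_fun \<phi>"

definition test_fun :: "(real^'n) set \<Rightarrow> (real^'n \<Rightarrow> real) \<Rightarrow> bool" where
  "test_fun \<Omega> \<phi> \<longleftrightarrow> smooth_fun \<phi> \<and> compact (closure {x. \<phi> x \<noteq> 0})
                       \<and> closure {x. \<phi> x \<noteq> 0} \<subseteq> \<Omega>"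

definition has_weak_grad :: "(real^'n) set \<Rightarrow> (real^'n \<Rightarrow> real) \<Rightarrow> (real^'n \<Rightarrow> real^'n) \<Rightarrow> bool" where
  "has_weak_grad \<Omega> q G \<longleftrightarrow> (\<forall>\<phi>. test_fun \<Omega> \<phi> \<longrightarrow>
     (\<forall>i. oint \<Omega> (\<lambda>x. q x * pd i \<phi> x) = - oint \<Omega> (\<lambda>x. G x $ i * \<phi> x)))"

definition has_weak_div :: "(real^'n) set \<Rightarrow> (real^'n \<Rightarrow> real^'n) \<Rightarrow> (real^'n \<Rightarrow> real) \<Rightarrow> bool" where
  "has_weak_div \<Omega> v g \<longleftrightarrow> (\<forall>\<phi>. test_fun \<Omega> \<phi> \<longrightarrow>
     oint \<Omega> (\<lambda>x. v x \<bullet> grad \<phi> x) = - oint \<Omega> (\<lambda>x. g x * \<phi> x))"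

text \<open>Weak curl in dimension-independent form: the antisymmetric part of the
  gradient, W i j = d_i w_j - d_j w_i.  For n = 3 its entries with i < j are
  (up to sign) the three components of the usual curl; for n = 2 the entry
  W 1 2 is the scalar curl d_1 w_2 - d_2 w_1.\<close>
definition has_weak_curl :: "(real^'n) set \<Rightarrow> (real^'n \<Rightarrow> real^'n) \<Rightarrow> (real^'n \<Rightarrow> 'n \<Rightarrow> 'n \<Rightarrow> real) \<Rightarrow> bool" where
  "has_weak_curl \<Omega> w W \<longleftrightarrow> (\<forall>\<phi>. test_fun \<Omega> \<phi> \<longrightarrow> (\<forall>i j.
     oint \<Omega> (\<lambda>x. W x i j * \<phi> x) = - oint \<Omega> (\<lambda>x. w x $ j * pd i \<phi> x - w x $ i * pd j \<phi> x)))"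

definition wgrad :: "(real^'n) set \<Rightarrow> (real^'n \<Rightarrow> real) \<Rightarrow> real^'n \<Rightarrow> real^'n" where
  "wgrad \<Omega> q = (SOME G. L2v \<Omega> G \<and> has_weak_grad \<Omega> q G)"

definition wdiv :: "(real^'n) set \<Rightarrow> (real^'n \<Rightarrow> real^'n) \<Rightarrow> real^'n \<Rightarrow> real" where
  "wdiv \<Omega> v = (SOME g. L2 \<Omega> g \<and> has_weak_div \<Omega> v g)"

definition wcurl :: "(real^'n) set \<Rightarrow> (real^'n \<Rightarrow> real^'n) \<Rightarrow> real^'n \<Rightarrow> 'n \<Rightarrow> 'n \<Rightarrow> real" where
  "wcurl \<Omega> w = (SOME W. (\<forall>i j. L2 \<Omega> (\<lambda>x. W x i j)) \<and> has_weak_curl \<Omega> w W)"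

text \<open>Weighted L2 inner product of curls: (k curl w, curl z) = sum over i<j of
  the integrals of k W_ij Z_ij = 1/2 times the sum over all pairs (i,j).\<close>
definition curl_ip :: "(real^'n) set \<Rightarrow> (real^'n \<Rightarrow> real) \<Rightarrow> (real^'n \<Rightarrow> real^'n) \<Rightarrow> (real^'n \<Rightarrow> real^'n) \<Rightarrow> real" where
  "curl_ip \<Omega> k w z = (1/2) * (\<Sum>i\<in>UNIV. \<Sum>j\<in>UNIV.
       oint \<Omega> (\<lambda>x. k x * wcurl \<Omega> w x i j * wcurl \<Omega> z x i j))"

definition lipschitz_boundary :: "(real^'n) set \<Rightarrow> bool" where
  "lipschitz_boundary \<Omega> \<longleftrightarrow> (\<forall>x\<in>frontier \<Omega>. \<exists>r>0. \<exists>e g L. norm e = 1 \<and>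
      (\<forall>a b. \<bar>g a - g b\<bar> \<le> L * norm (a - b)) \<and>
      \<Omega> \<inter> ball x r = {y \<in> ball x r. y \<bullet> e < g (y - (y \<bullet> e) *\<^sub>R e)})"

definition C1_on :: "(real^'n) set \<Rightarrow> (real^'n \<Rightarrow> real) \<Rightarrow> bool" where
  "C1_on \<Omega> f \<longleftrightarrow> (\<exists>D::(real^'n) \<Rightarrow> ((real^'n) \<Rightarrow>\<^sub>L real). continuous_on \<Omega> D \<and>
       (\<forall>x\<in>\<Omega>. (f has_derivative blinfun_apply (D x)) (at x)))"

text \<open>Zero normal trace of v in H(div): Green's formula with arbitrary smooth phi.\<close>
definition zero_normal_trace :: "(real^'n) set \<Rightarrow> (real^'n \<Rightarrow> real^'n) \<Rightarrow> bool" where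
  "zero_normal_trace \<Omega> v \<longleftrightarrow> (\<forall>\<phi>. smooth_fun \<phi> \<longrightarrow>
     oint \<Omega> (\<lambda>x. v x \<bullet> grad \<phi> x) + oint \<Omega> (\<lambda>x. wdiv \<Omega> v x * \<phi> x) = 0)"

definition inU :: "(real^'n) set \<Rightarrow> (real^'n \<Rightarrow> real) \<Rightarrow> (real^'n \<Rightarrow> real^'n) \<Rightarrow> bool" where
  "inU \<Omega> lam v \<longleftrightarrow> L2v \<Omega> v \<and>
     (\<exists>g. L2 \<Omega> g \<and> has_weak_div \<Omega> v g) \<and>
     (\<exists>W. (\<forall>i j. L2 \<Omega> (\<lambda>x. W x i j)) \<and> has_weak_curl \<Omega> (\<lambda>x. lam x *\<^sub>R v x) W) \<and>
     zero_normal_trace \<Omega> v"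

definition inP :: "(real^'n) set \<Rightarrow> (real^'n \<Rightarrow> real) \<Rightarrow> bool" where
  "inP \<Omega> q \<longleftrightarrow> L2 \<Omega> q \<and> (\<exists>G. L2v \<Omega> G \<and> has_weak_grad \<Omega> q G) \<and> oint \<Omega> q = 0"

definition B_CGLS :: "(real^'n) set \<Rightarrow> (real^'n \<Rightarrow> real) \<Rightarrow> (real^'n \<Rightarrow> real)
   \<Rightarrow> (real^'n \<Rightarrow> real^'n) \<Rightarrow> (real^'n \<Rightarrow> real) \<Rightarrow> (real^'n \<Rightarrow> real^'n) \<Rightarrow> (real^'n \<Rightarrow> real) \<Rightarrow> real" where
  "B_CGLS \<Omega> kap lam u p v q =
     oint \<Omega> (\<lambda>x. lam x * (u x \<bullet> v x))
   - oint \<Omega> (\<lambda>x. wdiv \<Omega> v x * p x)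
   - oint \<Omega> (\<lambda>x. wdiv \<Omega> u x * q x)
   - (1/2) * oint \<Omega> (\<lambda>x. kap x * ((lam x *\<^sub>R u x + wgrad \<Omega> p x) \<bullet> (lam x *\<^sub>R v x + wgrad \<Omega> q x)))
   + (1/2) * oint \<Omega> (\<lambda>x. lam x * wdiv \<Omega> u x * wdiv \<Omega> v x)
   + (1/2) * curl_ip \<Omega> kap (\<lambda>x. lam x *\<^sub>R u x) (\<lambda>x. lam x *\<^sub>R v x)"

definition F_CGLS :: "(real^'n) set \<Rightarrow> (real^'n \<Rightarrow> real) \<Rightarrow> (real^'n \<Rightarrow> real)
   \<Rightarrow> (real^'n \<Rightarrow> real^'n) \<Rightarrow> (real^'n \<Rightarrow> real) \<Rightarrow> real" where
  "F_CGLS \<Omega> lam f v q = - oint \<Omega> (\<lambda>x. f x * q x) + (1/2) * oint \<Omega> (\<lambda>x. lam x * f x * wdiv \<Omega> v x)"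

end

theory Submission
  imports Defs
begin

text \<open>
  The solution is the Darcy flow: if \<open>p\<close> solves the Neumann problem
  \<open>(\<kappa> \<nabla>p, \<nabla>\<phi>) = (f, \<phi>)\<close> and \<open>u = - \<kappa> \<nabla>p\<close>, then \<open>div u = f\<close>, \<open>\<lambda>u = - \<nabla>p\<close> is curl free,
  and the least-squares terms of the form reproduce the right-hand side. The pressure is obtained as the
  limit of a minimizing sequence of \<^emph>\<open>smooth\<close> functions, so Green's formula for \<open>v \<in> U\<close> and this \<open>p\<close>
  follows from the definition of the zero normal trace without any density theorem for \<open>H\<^sup>1\<close>,
  and the Poincare inequality is needed for smooth functions only. The latter holds on convex sets by averaging
  over translations, is carried to boundary patches by pushing them into the domain, and
  spreads over a finite cover because the domain is connected.

  Uniqueness: testing the homogeneous equation with \<open>(w, - r)\<close>, where \<open>(w, r)\<close> is the difference of two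
  solutions, cancels the divergence terms and leaves
  \<open>1/2 (\<lambda>w, w) + 1/2 (\<kappa> \<nabla>r, \<nabla>r) + \<dots> = 0\<close> with nonnegative remainder, so \<open>w = 0\<close> and
  \<open>r\<close> is constant with mean zero.
\<close>

section \<open>Square-integrable functions\<close>

text \<open>\<open>wgrad\<close>, \<open>wdiv\<close> and \<open>wcurl\<close> are Hilbert choices,
  hence determined only almost everywhere and not literally linear; identities for them must pass
  through uniqueness of weak derivatives, that is, through testing with smooth bumps and
  differentiating integrals over small cubes. Integration by parts comes from one device: the
  fundamental theorem of calculus on the segment from x to x + h, integrated over x and exchanged by
  Fubini. The same device gives the translation estimate behind the Poincare inequality and the
  constancy of functions with zero weak gradient. Zero trace is defined by pairing with smooth
  functions on the whole space, without a condition at the boundary, and such pairings survive L2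
  limits of a function and its gradient; this dictates how the pressure is approximated. The factor
  1/2 of the residual is what makes uniqueness work: since \<kappa>\<lambda> = 1, the residual pairs
  to (\<lambda>w, w) - (\<kappa> \<nabla>r, \<nabla>r), so half of the positive term (\<lambda>w, w)
  is lost and half of the gradient term is gained.\<close>

lemma L2_measurable: "L2 \<Omega> f \<Longrightarrow> f \<in> borel_measurable (lebesgue_on \<Omega>)"
  by (simp add: L2_def)

lemma L2_square_integrable: "L2 \<Omega> f \<Longrightarrow> integrable (lebesgue_on \<Omega>) (\<lambda>x. (f x)\<^sup>2)"
  by (simp add: L2_def)

lemma L2_bound:
  assumes "f \<in> borel_measurable (lebesgue_on \<Omega>)" "integrable (lebesgue_on \<Omega>) g"
    and "\<And>x. x \<in> \<Omega> \<Longrightarrow> (f x)\<^sup>2 \<le> g x"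
  shows "L2 \<Omega> f"
  unfolding L2_def
proof (intro conjI assms)
  show "integrable (lebesgue_on \<Omega>) (\<lambda>x. (f x)\<^sup>2)"
    by (rule Bochner_Integration.integrable_bound[OF assms(2)])
       (use assms in \<open>auto simp: space_restrict_space intro!: AE_I2 order_trans[OF assms(3)]\<close>)
qed

lemma L2_add:
  assumes "L2 \<Omega> f" "L2 \<Omega> g" shows "L2 \<Omega> (\<lambda>x. f x + g x)"
proof (rule L2_bound)
  show "integrable (lebesgue_on \<Omega>) (\<lambda>x. 2 * (f x)\<^sup>2 + 2 * (g x)\<^sup>2)"
    using assms by (auto simp: L2_def)
  show "(f x + g x)\<^sup>2 \<le> 2 * (f x)\<^sup>2 + 2 * (g x)\<^sup>2" for x
    using zero_le_power2[of "f x - g x"] by (simp add: power2_eq_square algebra_simps)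
qed (use assms in \<open>auto simp: L2_def\<close>)

lemma L2_bounded_mult:
  assumes "h \<in> borel_measurable (lebesgue_on \<Omega>)" "\<And>x. x \<in> \<Omega> \<Longrightarrow> \<bar>h x\<bar> \<le> C" "L2 \<Omega> f"
  shows "L2 \<Omega> (\<lambda>x. h x * f x)"
proof (rule L2_bound)
  show "integrable (lebesgue_on \<Omega>) (\<lambda>x. C\<^sup>2 * (f x)\<^sup>2)"
    using assms by (auto simp: L2_def)
  show "(h x * f x)\<^sup>2 \<le> C\<^sup>2 * (f x)\<^sup>2" if "x \<in> \<Omega>" for x
  proof -
    have "(h x)\<^sup>2 \<le> C\<^sup>2"
      using assms(2)[OF that] by (intro abs_le_square_iff[THEN iffD1]) linarith
    then show ?thesis by (simp add: power_mult_distrib mult_right_mono)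
  qed
qed (use assms in \<open>auto simp: L2_def\<close>)

lemma L2_cmult: "L2 \<Omega> f \<Longrightarrow> L2 \<Omega> (\<lambda>x. c * f x)"
  by (rule L2_bounded_mult[where C="\<bar>c\<bar>"]) auto

lemma L2_uminus: "L2 \<Omega> f \<Longrightarrow> L2 \<Omega> (\<lambda>x. - f x)"
  using L2_cmult[of \<Omega> f "-1"] by simp

lemma L2_diff: "L2 \<Omega> f \<Longrightarrow> L2 \<Omega> g \<Longrightarrow> L2 \<Omega> (\<lambda>x. f x - g x)"
  using L2_add[of \<Omega> f "\<lambda>x. - g x"] L2_uminus[of \<Omega> g] by simp

lemma L2_zero: "L2 \<Omega> (\<lambda>x. 0)"
  by (simp add: L2_def)

lemma L2_mult_integrable:
  assumes "L2 \<Omega> f" "L2 \<Omega> g" shows "integrable (lebesgue_on \<Omega>) (\<lambda>x. f x * g x)"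
proof (rule Bochner_Integration.integrable_bound)
  show "integrable (lebesgue_on \<Omega>) (\<lambda>x. (f x)\<^sup>2 + (g x)\<^sup>2)"
    using assms by (auto simp: L2_def)
  have "\<bar>f x * g x\<bar> \<le> (f x)\<^sup>2 + (g x)\<^sup>2" for x
    using zero_le_power2[of "\<bar>f x\<bar> - \<bar>g x\<bar>"] mult_nonneg_nonneg[of "\<bar>f x\<bar>" "\<bar>g x\<bar>"]
    unfolding abs_mult power2_diff power2_abs by linarith
  then show "AE x in lebesgue_on \<Omega>. norm (f x * g x) \<le> norm ((f x)\<^sup>2 + (g x)\<^sup>2)"
    by auto
qed (use assms in \<open>auto simp: L2_def\<close>)

lemma L2_const:
  fixes \<Omega> :: "(real^'n) set"
  assumes "bounded \<Omega>" "open \<Omega>" shows "L2 \<Omega> (\<lambda>x. c)"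
proof -
  have "finite_measure (lebesgue_on \<Omega>)"
    using assms by (intro finite_measure_lebesgue_on lmeasurable_open)
  then show ?thesis
    by (simp add: L2_def finite_measure.integrable_const)
qed

lemma L2_integrable:
  fixes \<Omega> :: "(real^'n) set"
  assumes "bounded \<Omega>" "open \<Omega>" "L2 \<Omega> f" shows "integrable (lebesgue_on \<Omega>) f"
  using L2_mult_integrable[OF assms(3) L2_const[OF assms(1,2), of 1]] by simp

text \<open>At t = -B/C the quadratic takes its minimum A - B^2/C. Besides Cauchy-Schwarz, this
  turns near-minimality of an energy into a bound on the residual in
  \<open>minimizing_sequence\<close>.\<close>

lemma discriminant_le:
  fixes A B C :: real
  assumes "C \<ge> 0" "\<And>t. 0 \<le> A + 2 * t * B + t\<^sup>2 * C"
  shows "B\<^sup>2 \<le> A * C"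
proof (cases "C = 0")
  case True
  have "B = 0"
  proof (rule ccontr)
    assume "B \<noteq> 0"
    \<comment> \<open>With C = 0 the expression is affine in t, and this t gives it the value
      -1.\<close>
    then show False
      using assms(2)[of "- (A + 1) / (2 * B)"] True by (simp add: field_simps)
  qed
  then show ?thesis using True by simp
next
  case False
  then have "C > 0" using \<open>C \<ge> 0\<close> by simp
  then show ?thesis
    using assms(2)[of "- B / C"] by (simp add: field_simps power2_eq_square)
qed

lemma L2_Cauchy_Schwarz:
  assumes "L2 \<Omega> f" "L2 \<Omega> g"
  shows "(oint \<Omega> (\<lambda>x. f x * g x))\<^sup>2 \<le> oint \<Omega> (\<lambda>x. (f x)\<^sup>2) * oint \<Omega> (\<lambda>x. (g x)\<^sup>2)"
proof (rule discriminant_le)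
  show "0 \<le> oint \<Omega> (\<lambda>x. (g x)\<^sup>2)" by (simp add: oint_def)
next
  fix t
  have [simp]: "integrable (lebesgue_on \<Omega>) (\<lambda>x. (f x)\<^sup>2)" "integrable (lebesgue_on \<Omega>) (\<lambda>x. (g x)\<^sup>2)"
    "integrable (lebesgue_on \<Omega>) (\<lambda>x. f x * g x)"
    using assms by (auto simp: L2_def L2_mult_integrable)
  have "0 \<le> oint \<Omega> (\<lambda>x. (f x + t * g x)\<^sup>2)"
    by (simp add: oint_def)
  also have "(\<lambda>x. (f x + t * g x)\<^sup>2) = (\<lambda>x. (f x)\<^sup>2 + 2 * t * (f x * g x) + t\<^sup>2 * (g x)\<^sup>2)"
    by (simp add: fun_eq_iff power2_eq_square algebra_simps)
  also have "oint \<Omega> \<dots> = oint \<Omega> (\<lambda>x. (f x)\<^sup>2) + 2 * t * oint \<Omega> (\<lambda>x. f x * g x) + t\<^sup>2 * oint \<Omega> (\<lambda>x. (g x)\<^sup>2)"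
    by (simp add: oint_def)
  finally show "0 \<le> oint \<Omega> (\<lambda>x. (f x)\<^sup>2) + 2 * t * oint \<Omega> (\<lambda>x. f x * g x) + t\<^sup>2 * oint \<Omega> (\<lambda>x. (g x)\<^sup>2)" .
qed

text \<open>The error is the pairing of \<open>s n - f\<close> with g, which Cauchy-Schwarz bounds
  by the product of the norms. The limit passages in the Neumann problem reduce to this
  form.\<close>

lemma L2_tendsto_oint_mult:
  assumes "\<And>n. L2 \<Omega> (s n)" "L2 \<Omega> f" "L2 \<Omega> g" "(\<lambda>n. oint \<Omega> (\<lambda>x. (s n x - f x)\<^sup>2)) \<longlonglongrightarrow> 0"
  shows "(\<lambda>n. oint \<Omega> (\<lambda>x. s n x * g x)) \<longlonglongrightarrow> oint \<Omega> (\<lambda>x. f x * g x)"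
proof -
  have "(\<lambda>n. sqrt (oint \<Omega> (\<lambda>x. (s n x - f x)\<^sup>2) * oint \<Omega> (\<lambda>x. (g x)\<^sup>2))) \<longlonglongrightarrow> sqrt (0 * oint \<Omega> (\<lambda>x. (g x)\<^sup>2))"
    by (intro tendsto_intros assms)
  then have "(\<lambda>n. sqrt (oint \<Omega> (\<lambda>x. (s n x - f x)\<^sup>2) * oint \<Omega> (\<lambda>x. (g x)\<^sup>2))) \<longlonglongrightarrow> 0"
    by simp
  moreover have "norm (oint \<Omega> (\<lambda>x. s n x * g x) - oint \<Omega> (\<lambda>x. f x * g x))
      \<le> sqrt (oint \<Omega> (\<lambda>x. (s n x - f x)\<^sup>2) * oint \<Omega> (\<lambda>x. (g x)\<^sup>2))" for n
  proof -
    have "oint \<Omega> (\<lambda>x. s n x * g x) - oint \<Omega> (\<lambda>x. f x * g x) = oint \<Omega> (\<lambda>x. (s n x - f x) * g x)"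
      unfolding oint_def by (simp add: left_diff_distrib L2_mult_integrable assms)
    then show ?thesis
      using L2_Cauchy_Schwarz[OF L2_diff[OF assms(1)[of n] assms(2)] assms(3)]
      by (auto intro!: real_le_rsqrt)
  qed
  then have "\<forall>\<^sub>F n in sequentially. norm (oint \<Omega> (\<lambda>x. s n x * g x) - oint \<Omega> (\<lambda>x. f x * g x))
      \<le> sqrt (oint \<Omega> (\<lambda>x. (s n x - f x)\<^sup>2) * oint \<Omega> (\<lambda>x. (g x)\<^sup>2))"
    by simp
  ultimately have "(\<lambda>n. oint \<Omega> (\<lambda>x. s n x * g x) - oint \<Omega> (\<lambda>x. f x * g x)) \<longlonglongrightarrow> 0"
    by (rule Lim_null_comparison[rotated])
  then show ?thesis by (simp add: LIM_zero_iff)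
qed

text \<open>Riesz-Fischer on a set of finite measure: L2-Cauchy implies L1-Cauchy, so a subsequence
  converges almost everywhere, and Fatou's lemma shows that its limit is the L2 limit of the whole
  sequence.\<close>

lemma L2_complete:
  fixes \<Omega> :: "(real^'n) set"
  assumes \<Omega>: "bounded \<Omega>" "open \<Omega>" and s: "\<And>n. L2 \<Omega> (s n)"
    and cau: "\<And>e. e > 0 \<Longrightarrow> \<exists>N. \<forall>i\<ge>N. \<forall>j\<ge>N. oint \<Omega> (\<lambda>x. (s i x - s j x)\<^sup>2) < e"
  obtains f where "L2 \<Omega> f" "(\<lambda>n. oint \<Omega> (\<lambda>x. (s n x - f x)\<^sup>2)) \<longlonglongrightarrow> 0"
proof -
  let ?M = "lebesgue_on \<Omega>"
  have [measurable]: "s n \<in> borel_measurable ?M" for n using s by (simp add: L2_def)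
  have one: "L2 \<Omega> (\<lambda>x. 1)" by (rule L2_const[OF \<Omega>])
  define m where "m = oint \<Omega> (\<lambda>x. 1\<^sup>2)"
  have m: "m \<ge> 0" by (simp add: m_def oint_def)
  have d2: "L2 \<Omega> (\<lambda>x. s i x - s j x)" for i j by (rule L2_diff[OF s s])
  have da: "L2 \<Omega> (\<lambda>x. \<bar>s i x - s j x\<bar>)" for i j
    using d2[of i j] by (auto simp: L2_def)
  have L1: "\<exists>N. \<forall>i\<ge>N. \<forall>j\<ge>N. (LINT x|?M. norm (s i x - s j x)) < e" if "e > 0" for e
  proof -
    \<comment> \<open>\<open>m\<close> is the measure of \<Omega>; \<open>m + 1\<close> keeps the
      denominator positive even when \<open>m\<close> is 0.\<close>
    obtain N where N: "\<forall>i\<ge>N. \<forall>j\<ge>N. oint \<Omega> (\<lambda>x. (s i x - s j x)\<^sup>2) < e\<^sup>2 / (m + 1)"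
      using cau[of "e\<^sup>2 / (m + 1)"] \<open>e > 0\<close> m by auto
    have "(LINT x|?M. norm (s i x - s j x)) < e" if "i \<ge> N" "j \<ge> N" for i j
    proof -
      have "(oint \<Omega> (\<lambda>x. \<bar>s i x - s j x\<bar>))\<^sup>2 \<le> oint \<Omega> (\<lambda>x. (s i x - s j x)\<^sup>2) * m"
        using L2_Cauchy_Schwarz[OF da[of i j] one] by (simp add: m_def)
      also have "\<dots> \<le> oint \<Omega> (\<lambda>x. (s i x - s j x)\<^sup>2) * (m + 1)"
        by (intro mult_left_mono) (auto simp: oint_def)
      also have "\<dots> < e\<^sup>2"
        using N that m by (simp add: field_simps)
      finally show ?thesis
        using \<open>e > 0\<close> by (simp add: oint_def power2_less_imp_less)
    qed
    then show ?thesis by blast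
  qed
  have int: "integrable ?M (s n)" for n by (rule L2_integrable[OF \<Omega> s])
  obtain r where r: "strict_mono r" "AE x in ?M. Cauchy (\<lambda>i. s (r i) x)"
    using cauchy_L1_AE_cauchy_subseq[OF int L1] by blast
  define f where "f x = lim (\<lambda>i. s (r i) x)" for x
  have [measurable]: "f \<in> borel_measurable ?M"
    unfolding f_def by measurable
  have lim: "AE x in ?M. (\<lambda>i. s (r i) x) \<longlonglongrightarrow> f x"
    using r(2) by eventually_elim (simp add: f_def Cauchy_convergent convergent_LIMSEQ_iff[symmetric])
  \<comment> \<open>The index n stays fixed while the subsequence index i tends to infinity.
    Nonnegative extended integrals avoid presupposing that \<open>s n - f\<close> is square
    integrable.\<close>
  have key: "\<exists>N. \<forall>n\<ge>N. (\<integral>\<^sup>+x. ennreal ((s n x - f x)\<^sup>2) \<partial>?M) \<le> ennreal e" if "0 < e" for e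
  proof -
    obtain N where N: "\<forall>i\<ge>N. \<forall>j\<ge>N. oint \<Omega> (\<lambda>x. (s i x - s j x)\<^sup>2) < e"
      using cau[OF \<open>0 < e\<close>] by blast
    have "(\<integral>\<^sup>+x. ennreal ((s n x - f x)\<^sup>2) \<partial>?M) \<le> ennreal e" if n: "n \<ge> N" for n
    proof -
      have "(\<integral>\<^sup>+x. ennreal ((s n x - f x)\<^sup>2) \<partial>?M)
          = (\<integral>\<^sup>+x. liminf (\<lambda>i. ennreal ((s n x - s (r i) x)\<^sup>2)) \<partial>?M)"
      proof (rule nn_integral_cong_AE, use lim in eventually_elim)
        fix x assume "(\<lambda>i. s (r i) x) \<longlonglongrightarrow> f x"
        then have "(\<lambda>i. ennreal ((s n x - s (r i) x)\<^sup>2)) \<longlonglongrightarrow> ennreal ((s n x - f x)\<^sup>2)"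
          by (intro tendsto_intros)
        then show "ennreal ((s n x - f x)\<^sup>2) = liminf (\<lambda>i. ennreal ((s n x - s (r i) x)\<^sup>2))"
          using lim_imp_Liminf[OF trivial_limit_sequentially] by metis
      qed
      also have "\<dots> \<le> liminf (\<lambda>i. \<integral>\<^sup>+x. ennreal ((s n x - s (r i) x)\<^sup>2) \<partial>?M)"
        by (rule nn_integral_liminf) measurable
      also have "\<dots> \<le> limsup (\<lambda>i. \<integral>\<^sup>+x. ennreal ((s n x - s (r i) x)\<^sup>2) \<partial>?M)"
        by (rule Liminf_le_Limsup) simp
      also have "\<dots> \<le> ennreal e"
      proof (rule Limsup_bounded)
        have "(\<integral>\<^sup>+x. ennreal ((s n x - s (r i) x)\<^sup>2) \<partial>?M) \<le> ennreal e" if "i \<ge> N" for i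
        proof -
          have "r i \<ge> N" using that seq_suble[OF r(1), of i] by linarith
          have "(\<integral>\<^sup>+x. ennreal ((s n x - s (r i) x)\<^sup>2) \<partial>?M) = ennreal (oint \<Omega> (\<lambda>x. (s n x - s (r i) x)\<^sup>2))"
            unfolding oint_def using d2[of n "r i"]
            by (intro nn_integral_eq_integral) (auto simp: L2_def)
          then show ?thesis using N n \<open>r i \<ge> N\<close> by (simp add: ennreal_leI less_imp_le)
        qed
        then show "\<forall>\<^sub>F i in sequentially. (\<integral>\<^sup>+x. ennreal ((s n x - s (r i) x)\<^sup>2) \<partial>?M) \<le> ennreal e"
          by (auto simp: eventually_sequentially)
      qed
      finally show ?thesis .
    qed
    then show ?thesis by blast
  qed
  obtain N where N: "\<forall>n\<ge>N. (\<integral>\<^sup>+x. ennreal ((s n x - f x)\<^sup>2) \<partial>?M) \<le> ennreal 1"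
    using key[of 1] by auto
  \<comment> \<open>Membership of f follows afterwards by writing it as \<open>s N\<close> minus
    this difference.\<close>
  have "L2 \<Omega> (\<lambda>x. s N x - f x)"
    unfolding L2_def
  proof
    show "integrable ?M (\<lambda>x. (s N x - f x)\<^sup>2)"
      by (rule integrableI_bounded) (use N[rule_format, of N] in \<open>auto simp: le_less_trans\<close>)
  qed measurable
  then have f: "L2 \<Omega> f" using L2_diff[OF s[of N], of "\<lambda>x. s N x - f x"] by simp
  moreover have "(\<lambda>n. oint \<Omega> (\<lambda>x. (s n x - f x)\<^sup>2)) \<longlonglongrightarrow> 0"
  proof (rule LIMSEQ_I)
    fix e :: real assume "e > 0"
    then obtain N where N: "\<forall>n\<ge>N. (\<integral>\<^sup>+x. ennreal ((s n x - f x)\<^sup>2) \<partial>?M) \<le> ennreal (e/2)"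
      using key[of "e/2"] by auto
    have "norm (oint \<Omega> (\<lambda>x. (s n x - f x)\<^sup>2) - 0) < e" if "n \<ge> N" for n
    proof -
      have "ennreal (oint \<Omega> (\<lambda>x. (s n x - f x)\<^sup>2)) = (\<integral>\<^sup>+x. ennreal ((s n x - f x)\<^sup>2) \<partial>?M)"
        unfolding oint_def using L2_diff[OF s f, of n]
        by (intro nn_integral_eq_integral[symmetric]) (auto simp: L2_def)
      then have "ennreal (oint \<Omega> (\<lambda>x. (s n x - f x)\<^sup>2)) \<le> ennreal (e/2)" using N that by auto
      then have "oint \<Omega> (\<lambda>x. (s n x - f x)\<^sup>2) \<le> e/2" using \<open>e > 0\<close> by (subst (asm) ennreal_le_iff) auto
      moreover have "oint \<Omega> (\<lambda>x. (s n x - f x)\<^sup>2) \<ge> 0" by (simp add: oint_def)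
      ultimately show ?thesis using \<open>e > 0\<close> by simp
    qed
    then show "\<exists>N. \<forall>n\<ge>N. norm (oint \<Omega> (\<lambda>x. (s n x - f x)\<^sup>2) - 0) < e" by blast
  qed
  ultimately show ?thesis by (rule that)
qed

lemma oint_mono:
  assumes "integrable (lebesgue_on \<Omega>) f" "integrable (lebesgue_on \<Omega>) g" "\<And>x. x \<in> \<Omega> \<Longrightarrow> f x \<le> g x"
  shows "oint \<Omega> f \<le> oint \<Omega> g"
  unfolding oint_def by (rule integral_mono) (use assms in \<open>auto simp: space_restrict_space\<close>)

lemma oint_cong: "(\<And>x. x \<in> \<Omega> \<Longrightarrow> f x = g x) \<Longrightarrow> oint \<Omega> f = oint \<Omega> g"
  unfolding oint_def by (rule Bochner_Integration.integral_cong) (auto simp: space_restrict_space)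

lemma oint_cong_AE:
  assumes "f \<in> borel_measurable (lebesgue_on \<Omega>)" "g \<in> borel_measurable (lebesgue_on \<Omega>)"
    "AE x in lebesgue_on \<Omega>. f x = g x"
  shows "oint \<Omega> f = oint \<Omega> g"
  unfolding oint_def by (rule integral_cong_AE[OF assms])

lemma L2v_component: "L2v \<Omega> v \<Longrightarrow> L2 \<Omega> (\<lambda>x. v x $ i)"
  by (simp add: L2v_def)

lemma L2v_add: "L2v \<Omega> v \<Longrightarrow> L2v \<Omega> w \<Longrightarrow> L2v \<Omega> (\<lambda>x. v x + w x)"
  by (simp add: L2v_def L2_add)

lemma L2v_diff: "L2v \<Omega> v \<Longrightarrow> L2v \<Omega> w \<Longrightarrow> L2v \<Omega> (\<lambda>x. v x - w x)"
  by (simp add: L2v_def L2_diff)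

lemma L2v_uminus: "L2v \<Omega> v \<Longrightarrow> L2v \<Omega> (\<lambda>x. - v x)"
  by (simp add: L2v_def L2_uminus)

lemma L2v_bounded_scale:
  "k \<in> borel_measurable (lebesgue_on \<Omega>) \<Longrightarrow> (\<And>x. x \<in> \<Omega> \<Longrightarrow> \<bar>k x\<bar> \<le> C) \<Longrightarrow> L2v \<Omega> v \<Longrightarrow> L2v \<Omega> (\<lambda>x. k x *\<^sub>R v x)"
  by (auto simp: L2v_def intro!: L2_bounded_mult[where C=C])

lemma L2v_inner_integrable:
  "L2v \<Omega> v \<Longrightarrow> L2v \<Omega> w \<Longrightarrow> integrable (lebesgue_on \<Omega>) (\<lambda>x. v x \<bullet> w x)"
  unfolding inner_vec_def by (auto simp: L2v_def intro!: L2_mult_integrable)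

lemma oint_inner_sum:
  "L2v \<Omega> v \<Longrightarrow> L2v \<Omega> w \<Longrightarrow> oint \<Omega> (\<lambda>x. v x \<bullet> w x) = (\<Sum>i\<in>UNIV. oint \<Omega> (\<lambda>x. v x $ i * w x $ i))"
  by (simp add: oint_def inner_vec_def L2_mult_integrable L2v_component)

section \<open>Smooth functions and bumps\<close>

lemma smooth_fun_differentiable: "smooth_fun \<phi> \<Longrightarrow> \<phi> differentiable (at x)"
  by (auto elim: smooth_fun.cases)

lemma smooth_fun_pd: "smooth_fun \<phi> \<Longrightarrow> smooth_fun (pd i \<phi>)"
  by (auto elim: smooth_fun.cases)

lemma smooth_fun_continuous_on: "smooth_fun \<phi> \<Longrightarrow> continuous_on S \<phi>"
  by (meson differentiable_imp_continuous_within continuous_at_imp_continuous_on smooth_fun_differentiable)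

lemma smooth_fun_borel_measurable [measurable]: "smooth_fun \<phi> \<Longrightarrow> \<phi> \<in> borel_measurable borel"
  by (intro borel_measurable_continuous_onI smooth_fun_continuous_on)

lemma pd_eqI: "(\<phi> has_derivative D) (at x) \<Longrightarrow> pd i \<phi> x = D (axis i 1)"
  by (metis pd_def frechet_derivative_at)

text \<open>Total differentiability makes the derivative linear, so expanding h along the axes
  recovers it from the partial derivatives that define \<open>grad\<close>.\<close>

lemma has_derivative_grad:
  assumes "\<phi> differentiable (at x)"
  shows "(\<phi> has_derivative (\<lambda>h. grad \<phi> x \<bullet> h)) (at x)"
proof -
  let ?D = "frechet_derivative \<phi> (at x)"
  have D: "(\<phi> has_derivative ?D) (at x)"
    using assms by (simp add: frechet_derivative_works)
  then have lin: "linear ?D" by (rule has_derivative_linear)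
  have "?D h = grad \<phi> x \<bullet> h" for h
  proof -
    have "?D h = ?D (\<Sum>i\<in>UNIV. h $ i *\<^sub>R axis i 1)"
      using basis_expansion[of h] by (simp add: scalar_mult_eq_scaleR)
    also have "\<dots> = (\<Sum>i\<in>UNIV. h $ i * ?D (axis i 1))"
      using lin by (simp add: linear_sum linear_cmul)
    finally show ?thesis
      by (simp add: grad_def pd_def inner_vec_def mult.commute)
  qed
  then have "?D = (\<lambda>h. grad \<phi> x \<bullet> h)" by blast
  with D show ?thesis by simp
qed

lemma smooth_fun_has_derivative: "smooth_fun \<phi> \<Longrightarrow> (\<phi> has_derivative (\<lambda>h. grad \<phi> x \<bullet> h)) (at x)"
  by (intro has_derivative_grad smooth_fun_differentiable)

lemma pd_add:
  assumes "\<phi> differentiable (at x)" "\<psi> differentiable (at x)"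
  shows "pd i (\<lambda>x. \<phi> x + \<psi> x) x = pd i \<phi> x + pd i \<psi> x"
  by (rule trans[OF pd_eqI[OF has_derivative_add[OF has_derivative_grad[OF assms(1)] has_derivative_grad[OF assms(2)]]]])
     (simp add: grad_def inner_axis)

lemma pd_mult:
  assumes "\<phi> differentiable (at x)" "\<psi> differentiable (at x)"
  shows "pd i (\<lambda>x. \<phi> x * \<psi> x) x = \<phi> x * pd i \<psi> x + pd i \<phi> x * \<psi> x"
  by (rule trans[OF pd_eqI[OF has_derivative_mult[OF has_derivative_grad[OF assms(1)] has_derivative_grad[OF assms(2)]]]])
     (simp add: grad_def inner_axis)

lemma pd_const: "pd i (\<lambda>x. c) = (\<lambda>x. 0)"
  by (rule ext, rule trans[OF pd_eqI[OF has_derivative_const]]) simp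

text \<open>The coinduction for products fails for the set of products of two smooth functions; it works for
  the algebra they generate, which is closed under partial derivatives.\<close>

inductive smooth_alg :: "(real^'n \<Rightarrow> real) \<Rightarrow> bool" where
  base: "smooth_fun \<phi> \<Longrightarrow> smooth_alg \<phi>"
| add: "smooth_alg \<phi> \<Longrightarrow> smooth_alg \<psi> \<Longrightarrow> smooth_alg (\<lambda>x. \<phi> x + \<psi> x)"
| mult: "smooth_alg \<phi> \<Longrightarrow> smooth_alg \<psi> \<Longrightarrow> smooth_alg (\<lambda>x. \<phi> x * \<psi> x)"

lemma smooth_alg_step:
  "smooth_alg \<phi> \<Longrightarrow> (\<forall>x. \<phi> differentiable (at x)) \<and> (\<forall>i. smooth_alg (pd i \<phi>))"
proof (induction rule: smooth_alg.induct)
  case (base \<phi>)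
  then show ?case by (auto intro: smooth_alg.base smooth_fun_differentiable smooth_fun_pd)
next
  case (add \<phi> \<psi>)
  then have "pd i (\<lambda>x. \<phi> x + \<psi> x) = (\<lambda>x. pd i \<phi> x + pd i \<psi> x)" for i
    by (auto simp: fun_eq_iff pd_add)
  with add show ?case by (auto intro: smooth_alg.add)
next
  case (mult \<phi> \<psi>)
  then have "pd i (\<lambda>x. \<phi> x * \<psi> x) = (\<lambda>x. \<phi> x * pd i \<psi> x + pd i \<phi> x * \<psi> x)" for i
    by (auto simp: fun_eq_iff pd_mult)
  with mult show ?case by (auto intro!: smooth_alg.add smooth_alg.mult)
qed

text \<open>Coinduction with the whole algebra as invariant: \<open>smooth_alg_step\<close> is the
  required one-step unfolding.\<close>

lemma smooth_alg_imp_smooth: "smooth_alg \<phi> \<Longrightarrow> smooth_fun \<phi>"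
  by (coinduction arbitrary: \<phi> rule: smooth_fun.coinduct) (use smooth_alg_step in blast)

lemma smooth_fun_add: "smooth_fun \<phi> \<Longrightarrow> smooth_fun \<psi> \<Longrightarrow> smooth_fun (\<lambda>x. \<phi> x + \<psi> x)"
  by (rule smooth_alg_imp_smooth, rule smooth_alg.add) (auto intro: smooth_alg.base)

lemma smooth_fun_mult: "smooth_fun \<phi> \<Longrightarrow> smooth_fun \<psi> \<Longrightarrow> smooth_fun (\<lambda>x. \<phi> x * \<psi> x)"
  by (rule smooth_alg_imp_smooth, rule smooth_alg.mult) (auto intro: smooth_alg.base)

lemma smooth_fun_const: "smooth_fun (\<lambda>x. c)"
  by (coinduction arbitrary: c rule: smooth_fun.coinduct) (auto simp: pd_const)

lemma smooth_fun_cmult: "smooth_fun \<phi> \<Longrightarrow> smooth_fun (\<lambda>x. c * \<phi> x)"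
  by (intro smooth_fun_mult smooth_fun_const)

lemma smooth_fun_prod:
  "finite I \<Longrightarrow> (\<And>i. i \<in> I \<Longrightarrow> smooth_fun (\<phi> i)) \<Longrightarrow> smooth_fun (\<lambda>x. \<Prod>i\<in>I. \<phi> i x)"
  by (induction I rule: finite_induct) (auto intro: smooth_fun_const smooth_fun_mult)

lemma pd_cmult: "smooth_fun \<phi> \<Longrightarrow> pd i (\<lambda>x. c * \<phi> x) = (\<lambda>x. c * pd i \<phi> x)"
  by (auto simp: fun_eq_iff pd_mult pd_const smooth_fun_differentiable smooth_fun_const)

lemma grad_add: "smooth_fun \<phi> \<Longrightarrow> smooth_fun \<psi> \<Longrightarrow> grad (\<lambda>x. \<phi> x + \<psi> x) x = grad \<phi> x + grad \<psi> x"
  by (simp add: grad_def vec_eq_iff pd_add smooth_fun_differentiable)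

lemma grad_cmult: "smooth_fun \<phi> \<Longrightarrow> grad (\<lambda>x. c * \<phi> x) x = c *\<^sub>R grad \<phi> x"
  by (simp add: grad_def vec_eq_iff pd_cmult)

lemma grad_const: "grad (\<lambda>x. c) x = 0"
  by (simp add: grad_def vec_eq_iff pd_const)

lemma continuous_on_grad: "smooth_fun \<phi> \<Longrightarrow> continuous_on S (grad \<phi>)"
proof -
  assume "smooth_fun \<phi>"
  then have "continuous_on S (pd i \<phi>)" for i by (intro smooth_fun_continuous_on smooth_fun_pd)
  then have "continuous_on S (\<lambda>x. \<chi> i. pd i \<phi> x)" by (intro continuous_on_vec_lambda)
  then show ?thesis by (simp add: grad_def[abs_def])
qed

lemma smooth_fun_sum:
  "finite I \<Longrightarrow> (\<And>i. i \<in> I \<Longrightarrow> smooth_fun (\<phi> i)) \<Longrightarrow> smooth_fun (\<lambda>x. \<Sum>i\<in>I. \<phi> i x)"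
  by (induction I rule: finite_induct) (auto intro: smooth_fun_const smooth_fun_add)

lemma smooth_fun_diff: "smooth_fun \<phi> \<Longrightarrow> smooth_fun \<psi> \<Longrightarrow> smooth_fun (\<lambda>x. \<phi> x - \<psi> x)"
  using smooth_fun_add[of \<phi> "\<lambda>x. - 1 * \<psi> x"] smooth_fun_cmult[of \<psi> "- 1"] by simp

lemma smooth_fun_power2: "smooth_fun \<phi> \<Longrightarrow> smooth_fun (\<lambda>x. (\<phi> x)\<^sup>2)"
  using smooth_fun_mult[of \<phi> \<phi>] by (simp add: power2_eq_square)

lemma smooth_fun_grad_inner: "smooth_fun \<phi> \<Longrightarrow> smooth_fun (\<lambda>x. grad \<phi> x \<bullet> h)"
proof -
  assume "smooth_fun \<phi>"
  then have "smooth_fun (\<lambda>x. h $ i * pd i \<phi> x)" for i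
    by (rule smooth_fun_cmult[OF smooth_fun_pd])
  then have "smooth_fun (\<lambda>x. \<Sum>i\<in>UNIV. h $ i * pd i \<phi> x)" by (intro smooth_fun_sum) auto
  then show ?thesis by (simp add: grad_def inner_vec_def mult.commute)
qed

lemma smooth_fun_grad_square: "smooth_fun \<phi> \<Longrightarrow> smooth_fun (\<lambda>x. grad \<phi> x \<bullet> grad \<phi> x)"
proof -
  assume "smooth_fun \<phi>"
  then have "smooth_fun (\<lambda>x. (pd i \<phi> x)\<^sup>2)" for i
    by (rule smooth_fun_power2[OF smooth_fun_pd])
  then have "smooth_fun (\<lambda>x. \<Sum>i\<in>UNIV. (pd i \<phi> x)\<^sup>2)" by (intro smooth_fun_sum) auto
  then show ?thesis by (simp add: grad_def inner_vec_def power2_eq_square)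
qed

lemma pd_shift:
  assumes "smooth_fun \<phi>" shows "pd i (\<lambda>x. \<phi> (x + h)) = (\<lambda>x. pd i \<phi> (x + h))"
proof
  fix x
  have "((\<lambda>x. \<phi> (x + h)) has_derivative (\<lambda>k. grad \<phi> (x + h) \<bullet> k)) (at x)"
    by (rule has_derivative_compose[of "\<lambda>x. x + h" "\<lambda>k. k", OF _ smooth_fun_has_derivative[OF assms]])
       (auto intro!: derivative_eq_intros)
  from pd_eqI[OF this] show "pd i (\<lambda>x. \<phi> (x + h)) x = pd i \<phi> (x + h)"
    by (simp add: grad_def inner_axis)
qed

lemma smooth_fun_shift: "smooth_fun \<phi> \<Longrightarrow> smooth_fun (\<lambda>x. \<phi> (x + h))"
proof (coinduction arbitrary: \<phi> rule: smooth_fun.coinduct)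
  case (smooth_fun \<phi>)
  then have "(\<lambda>x. \<phi> (x + h)) differentiable at x" for x
    by (intro differentiable_compose[of \<phi> "\<lambda>x. x + h", OF smooth_fun_differentiable]) auto
  with smooth_fun show ?case by (auto simp: pd_shift intro: smooth_fun_pd)
qed

lemma smooth_fun_line_derivative:
  assumes "smooth_fun \<phi>"
  shows "((\<lambda>s. \<phi> (x + s *\<^sub>R h)) has_real_derivative grad \<phi> (x + s *\<^sub>R h) \<bullet> h) (at s within S)"
proof -
  have "((\<lambda>s. \<phi> (x + s *\<^sub>R h)) has_derivative (\<lambda>t. grad \<phi> (x + s *\<^sub>R h) \<bullet> (t *\<^sub>R h))) (at s within S)"
    by (rule has_derivative_compose[of "\<lambda>s. x + s *\<^sub>R h" "\<lambda>t. t *\<^sub>R h", OF _ smooth_fun_has_derivative[OF assms]])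
       (auto intro!: derivative_eq_intros)
  then show ?thesis by (simp add: has_field_derivative_def mult_commute_abs)
qed

text \<open>The fundamental theorem of calculus on the segment from x to x + h, written over the
  real line with an indicator so that Fubini can be applied to it later.\<close>

lemma smooth_fun_line_integral:
  assumes "smooth_fun \<phi>"
  shows "(LINT s|lborel. indicator {0..1} s *\<^sub>R (grad \<phi> (x + s *\<^sub>R h) \<bullet> h)) = \<phi> (x + h) - \<phi> x"
proof -
  have "(LINT s|lborel. indicator {0..1} s *\<^sub>R (grad \<phi> (x + s *\<^sub>R h) \<bullet> h)) = \<phi> (x + 1 *\<^sub>R h) - \<phi> (x + 0 *\<^sub>R h)"
  proof (rule integral_FTC_atLeastAtMost)
    show "continuous_on {0..1} (\<lambda>s. grad \<phi> (x + s *\<^sub>R h) \<bullet> h)"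
      by (intro continuous_intros continuous_on_compose2[OF continuous_on_grad[OF assms, of UNIV]]) auto
  qed (use smooth_fun_line_derivative[OF assms] in \<open>auto simp: has_real_derivative_iff_has_vector_derivative\<close>)
  then show ?thesis by simp
qed

section \<open>Symmetry of second partial derivatives\<close>

text \<open>The mean value theorem is applied twice: first in direction i to the increment in
  direction j, then in direction j to the resulting partial derivative. The left side is symmetric
  in i and j, which is what \<open>pd_commute\<close> exploits.\<close>

lemma second_difference_mvt:
  assumes "smooth_fun f" "t > 0"
  obtains y where "dist y x \<le> 2 * t"
    "f (x + t *\<^sub>R axis i 1 + t *\<^sub>R axis j 1) - f (x + t *\<^sub>R axis i 1) - f (x + t *\<^sub>R axis j 1) + f x
       = t\<^sup>2 * pd j (pd i f) y"
proof -
  let ?i = "axis i 1 :: real^'a" and ?j = "axis j 1 :: real^'a"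
  define g where "g s = f ((x + t *\<^sub>R ?j) + s *\<^sub>R ?i) - f (x + s *\<^sub>R ?i)" for s
  have g: "(g has_real_derivative pd i f ((x + t *\<^sub>R ?j) + s *\<^sub>R ?i) - pd i f (x + s *\<^sub>R ?i)) (at s)" for s
    unfolding g_def using smooth_fun_line_derivative[OF assms(1), where h="?i"]
    by (intro derivative_intros) (simp_all add: grad_def inner_axis)
  obtain \<sigma> where \<sigma>: "0 < \<sigma>" "\<sigma> < t" "g t - g 0 = (t - 0) * (pd i f ((x + t *\<^sub>R ?j) + \<sigma> *\<^sub>R ?i) - pd i f (x + \<sigma> *\<^sub>R ?i))"
    using MVT2[OF assms(2), of g "\<lambda>s. pd i f ((x + t *\<^sub>R ?j) + s *\<^sub>R ?i) - pd i f (x + s *\<^sub>R ?i)"] g by blast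
  define k where "k \<tau> = pd i f ((x + \<sigma> *\<^sub>R ?i) + \<tau> *\<^sub>R ?j)" for \<tau>
  have k: "(k has_real_derivative pd j (pd i f) ((x + \<sigma> *\<^sub>R ?i) + \<tau> *\<^sub>R ?j)) (at \<tau>)" for \<tau>
    unfolding k_def using smooth_fun_line_derivative[OF smooth_fun_pd[OF assms(1)], where h="?j"]
    by (simp add: grad_def inner_axis)
  obtain \<tau> where \<tau>: "0 < \<tau>" "\<tau> < t" "k t - k 0 = (t - 0) * pd j (pd i f) ((x + \<sigma> *\<^sub>R ?i) + \<tau> *\<^sub>R ?j)"
    using MVT2[OF assms(2), of k "\<lambda>\<tau>. pd j (pd i f) ((x + \<sigma> *\<^sub>R ?i) + \<tau> *\<^sub>R ?j)"] k by blast
  let ?y = "(x + \<sigma> *\<^sub>R ?i) + \<tau> *\<^sub>R ?j"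
  have "dist ?y x \<le> norm (\<sigma> *\<^sub>R ?i) + norm (\<tau> *\<^sub>R ?j)"
    unfolding dist_norm using norm_triangle_ineq[of "\<sigma> *\<^sub>R ?i" "\<tau> *\<^sub>R ?j"] by (simp add: algebra_simps)
  also have "\<dots> \<le> 2 * t" using \<sigma> \<tau> by (simp add: norm_axis_1)
  finally have "dist ?y x \<le> 2 * t" .
  moreover have "g t - g 0 = t * (k t - k 0)"
    using \<sigma>(3) by (simp add: k_def algebra_simps)
  then have "g t - g 0 = t\<^sup>2 * pd j (pd i f) ?y"
    using \<tau>(3) by (simp add: power2_eq_square)
  ultimately show ?thesis
    by (intro that[of ?y]) (simp_all add: g_def algebra_simps)
qed

text \<open>Both mixed derivatives, taken at points near x, equal the same second difference divided
  by t^2, and both are continuous. This symmetry makes the weak curl of a weak gradient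
  vanish.\<close>

lemma pd_commute:
  assumes "smooth_fun f" shows "pd i (pd j f) = pd j (pd i f)"
proof
  fix x
  let ?A = "pd i (pd j f)" and ?B = "pd j (pd i f)"
  have cont: "isCont ?A x" "isCont ?B x"
    using assms by (auto intro!: smooth_fun_pd differentiable_imp_continuous_within smooth_fun_differentiable)
  show "?A x = ?B x"
  proof (rule ccontr)
    assume ne: "?A x \<noteq> ?B x"
    define e where "e = dist (?A x) (?B x) / 2"
    have "e > 0" using ne by (simp add: e_def)
    obtain d1 where d1: "d1 > 0" "\<And>y. dist y x < d1 \<Longrightarrow> dist (?A y) (?A x) < e"
      using cont(1) \<open>e > 0\<close> unfolding continuous_at_eps_delta by blast
    obtain d2 where d2: "d2 > 0" "\<And>y. dist y x < d2 \<Longrightarrow> dist (?B y) (?B x) < e"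
      using cont(2) \<open>e > 0\<close> unfolding continuous_at_eps_delta by blast
    \<comment> \<open>Both intermediate points lie within 2t of x, so 2t has to stay below
      \<open>d1\<close> and \<open>d2\<close>.\<close>
    define t where "t = min d1 d2 / 3"
    have t: "t > 0" "2 * t < d1" "2 * t < d2" using d1 d2 by (auto simp: t_def)
    obtain y where y: "dist y x \<le> 2 * t"
      "f (x + t *\<^sub>R axis i 1 + t *\<^sub>R axis j 1) - f (x + t *\<^sub>R axis i 1) - f (x + t *\<^sub>R axis j 1) + f x = t\<^sup>2 * ?B y"
      by (rule second_difference_mvt[OF assms t(1)])
    obtain z where z: "dist z x \<le> 2 * t"
      "f (x + t *\<^sub>R axis j 1 + t *\<^sub>R axis i 1) - f (x + t *\<^sub>R axis j 1) - f (x + t *\<^sub>R axis i 1) + f x = t\<^sup>2 * ?A z"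
      by (rule second_difference_mvt[OF assms t(1)])
    have "t\<^sup>2 * ?B y = t\<^sup>2 * ?A z"
      unfolding y(2)[symmetric] z(2)[symmetric] by (simp add: algebra_simps)
    then have "?B y = ?A z" using t(1) by simp
    moreover have "dist (?A z) (?A x) < e" using z(1) t by (intro d1) simp
    moreover have "dist (?B y) (?B x) < e" using y(1) t by (intro d2) simp
    ultimately show False
      using dist_triangle2[of "?A x" "?B x" "?A z"] by (simp add: e_def dist_commute)
  qed
qed

section \<open>The functions p(1/t) exp(-1/t) and smooth bumps over boxes\<close>

text \<open>Differentiating exp(-1/t), extended by 0, produces powers of 1/t. Admitting a polynomial
  factor in 1/t gives a family closed under differentiation, which coinduction for
  \<open>smooth_fun\<close> needs. The basic function is \<open>flat 1\<close>.\<close>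

definition flat :: "real poly \<Rightarrow> real \<Rightarrow> real" where
  "flat p t = (if t > 0 then poly p (1 / t) * exp (- (1 / t)) else 0)"

text \<open>In the variable s = 1/t this is the decay of a polynomial times exp(-s) at
  infinity.\<close>

lemma flat_tendsto_0:
  fixes p :: "real poly"
  shows "((\<lambda>t. poly p (1 / t) * exp (- (1 / t))) \<longlongrightarrow> 0) (at_right 0)"
proof -
  have "((\<lambda>s::real. \<Sum>i\<le>degree p. coeff p i * (s ^ i / exp s)) \<longlongrightarrow> (\<Sum>i\<le>degree p. coeff p i * 0)) at_top"
    by (intro tendsto_intros tendsto_power_div_exp_0)
  moreover have "(\<Sum>i\<le>degree p. coeff p i * (s ^ i / exp s)) = poly p s * exp (- s)" for s :: real
    by (simp add: poly_altdef sum_distrib_right exp_minus divide_inverse mult.assoc)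
  ultimately have "((\<lambda>s. poly p s * exp (- s)) \<longlongrightarrow> 0) at_top" by simp
  from filterlim_compose[OF this filterlim_inverse_at_top_right]
  show ?thesis by (simp add: inverse_eq_divide)
qed

text \<open>For t > 0 the derivative of p(1/t) exp(-1/t) is (1/t^2) (p - p')(1/t) exp(-1/t), whence
  the new polynomial X^2 (p - p').\<close>

lemma flat_has_derivative:
  "(flat p has_real_derivative flat ([:0, 0, 1:] * (p - pderiv p)) t) (at t)"
proof -
  consider "t > 0" | "t < 0" | "t = 0" by linarith
  then show ?thesis
  proof cases
    case 1
    have "((\<lambda>t. poly p (1 / t) * exp (- (1 / t))) has_real_derivative flat ([:0, 0, 1:] * (p - pderiv p)) t) (at t)"
      using 1 by (auto intro!: derivative_eq_intros DERIV_chain2[OF poly_DERIV]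
          simp: flat_def power2_eq_square field_simps)
    then show ?thesis
      by (rule has_field_derivative_transform_within_open[of _ _ _ "{0<..}"]) (use 1 in \<open>auto simp: flat_def\<close>)
  next
    case 2
    have "((\<lambda>t. 0) has_real_derivative flat ([:0, 0, 1:] * (p - pderiv p)) t) (at t)"
      using 2 by (auto simp: flat_def)
    then show ?thesis
      by (rule has_field_derivative_transform_within_open[of _ _ _ "{..<0}"]) (use 2 in \<open>auto simp: flat_def\<close>)
  next
    case 3
    have "((\<lambda>y. (flat p y - flat p 0) / (y - 0)) \<longlongrightarrow> 0) (at 0)"
    proof (rule filterlim_split_at)
      show "((\<lambda>y. (flat p y - flat p 0) / (y - 0)) \<longlongrightarrow> 0) (at_left 0)"
        by (rule tendsto_eventually) (auto simp: eventually_at_filter flat_def)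
      \<comment> \<open>Division by y multiplies the polynomial by X, so the right difference
        quotient is again covered by \<open>flat_tendsto_0\<close>.\<close>
      show "((\<lambda>y. (flat p y - flat p 0) / (y - 0)) \<longlongrightarrow> 0) (at_right 0)"
        by (rule Lim_transform_eventually[OF flat_tendsto_0[of "pCons 0 p"]])
           (auto simp: eventually_at_filter flat_def)
    qed
    then show ?thesis using 3 by (simp add: has_field_derivative_iff flat_def)
  qed
qed

text \<open>The coinduction ranges over the factor c as well as over p, because a partial derivative
  changes the polynomial and pulls out s times a component of an axis vector.\<close>

lemma smooth_fun_flat: "smooth_fun (\<lambda>x::real^'n. c * flat p (s * x $ i + b))"
proof (coinduction arbitrary: c p rule: smooth_fun.coinduct)
  case smooth_fun
  let ?p = "[:0, 0, 1:] * (p - pderiv p)"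
  have D: "((\<lambda>x::real^'n. c * flat p (s * x $ i + b)) has_derivative
      (\<lambda>h. c * (flat ?p (s * x $ i + b) * (s * h $ i)))) (at x)" for x
  proof -
    have "((\<lambda>x::real^'n. flat p (s * x $ i + b)) has_derivative
      (\<lambda>h. flat ?p (s * x $ i + b) * (s * h $ i))) (at x)"
      by (rule has_derivative_compose[of "\<lambda>x. s * x $ i + b" _ _ _ "flat p",
            OF _ flat_has_derivative[unfolded has_field_derivative_def]])
         (auto intro!: derivative_eq_intros bounded_linear.has_derivative[OF bounded_linear_vec_nth])
    then show ?thesis by (rule has_derivative_mult_right)
  qed
  have "pd j (\<lambda>x::real^'n. c * flat p (s * x $ i + b))
      = (\<lambda>x. (c * (s * axis j 1 $ i)) * flat ?p (s * x $ i + b))" for j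
    by (rule ext) (simp add: pd_eqI[OF D])
  then show ?case using D by (auto simp: differentiable_def)
qed

text \<open>For t > 0 a factor \<open>flat 1 (k * t)\<close> is exp(-1/(k t)), so k controls the
  steepness: as k grows, the product tends to the indicator of the open box while staying between 0
  and 1.\<close>

definition box_bump :: "real \<Rightarrow> real^'n \<Rightarrow> real^'n \<Rightarrow> real^'n \<Rightarrow> real" where
  "box_bump k a b x = (\<Prod>i\<in>UNIV. flat 1 (k * (x $ i - a $ i)) * flat 1 (k * (b $ i - x $ i)))"

lemma smooth_fun_box_bump:
  fixes a b :: "real^'n"
  shows "smooth_fun (box_bump k a b)"
proof -
  have "smooth_fun (\<lambda>x::real^'n. flat 1 (k * (x $ i - a $ i)) * flat 1 (k * (b $ i - x $ i)))" for i
    using smooth_fun_mult[OF smooth_fun_flat[of 1 1 k i "- k * a $ i"] smooth_fun_flat[of 1 1 "-k" i "k * b $ i"]]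
    by (simp add: algebra_simps)
  then show ?thesis
    unfolding box_bump_def[abs_def] by (intro smooth_fun_prod) auto
qed

lemma flat_1_bounds: "0 \<le> flat 1 t" "flat 1 t \<le> 1"
  by (auto simp: flat_def)

lemma box_bump_nonneg: "0 \<le> box_bump k a b x"
  unfolding box_bump_def by (intro prod_nonneg) (auto simp: flat_1_bounds)

lemma box_bump_le_1: "box_bump k a b x \<le> 1"
  unfolding box_bump_def by (intro prod_le_1) (auto simp: flat_1_bounds mult_le_one)

lemma box_bump_pos_iff: "k > 0 \<Longrightarrow> box_bump k a b x > 0 \<longleftrightarrow> x \<in> box a b"
proof -
  assume "k > 0"
  have "flat 1 t \<noteq> 0 \<longleftrightarrow> t > 0" for t by (simp add: flat_def)
  then have "box_bump k a b x \<noteq> 0 \<longleftrightarrow> x \<in> box a b"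
    using \<open>k > 0\<close> by (auto simp: box_bump_def mem_box_cart zero_less_mult_iff)
  with box_bump_nonneg[of k a b x] show ?thesis by linarith
qed

lemma box_bump_tendsto:
  "(\<lambda>n. box_bump (real (Suc n)) a b x) \<longlonglongrightarrow> indicator (box a b) x"
proof (cases "x \<in> box a b")
  case True
  have *: "(\<lambda>n. flat 1 (real (Suc n) * t)) \<longlonglongrightarrow> 1" if "t > 0" for t
  proof -
    have "(\<lambda>n. exp (- (1 / t * inverse (real (Suc n))))) \<longlonglongrightarrow> exp (- (1 / t * 0))"
      by (intro tendsto_intros LIMSEQ_inverse_real_of_nat)
    moreover have "flat 1 (real (Suc n) * t) = exp (- (1 / t * inverse (real (Suc n))))" for n
      using that by (simp add: flat_def divide_inverse mult.commute add_pos_nonneg)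
    ultimately show ?thesis by simp
  qed
  have "(\<lambda>n. box_bump (real (Suc n)) a b x) \<longlonglongrightarrow> (\<Prod>i\<in>(UNIV::'a set). 1 * 1)"
    unfolding box_bump_def using True
    by (intro tendsto_prod tendsto_mult *) (auto simp: mem_box_cart)
  then show ?thesis using True by simp
next
  case False
  then have "box_bump (real (Suc n)) a b x = 0" for n
    using box_bump_pos_iff[of "real (Suc n)" a b x] box_bump_nonneg[of "real (Suc n)" a b x] by simp
  then show ?thesis using False by simp
qed

lemma test_fun_smooth: "test_fun \<Omega> \<phi> \<Longrightarrow> smooth_fun \<phi>"
  by (simp add: test_fun_def)

lemma test_funI:
  assumes "smooth_fun \<phi>" "compact K" "K \<subseteq> \<Omega>" "\<And>x. x \<notin> K \<Longrightarrow> \<phi> x = 0"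
  shows "test_fun \<Omega> \<phi>"
proof -
  have "closure {x. \<phi> x \<noteq> 0} \<subseteq> K"
    using assms by (intro closure_minimal) (auto simp: compact_imp_closed)
  moreover from this have "compact (closure {x. \<phi> x \<noteq> 0})"
    using assms(2) by (meson closed_closure compact_closure bounded_subset closure_subset compact_imp_bounded order_trans)
  ultimately show ?thesis using assms by (auto simp: test_fun_def)
qed

text \<open>The bump is positive exactly on the open box, so its support lies in the closed box,
  which therefore has to fit into \<Omega>.\<close>

lemma test_fun_box_bump: "k > 0 \<Longrightarrow> cbox a b \<subseteq> \<Omega> \<Longrightarrow> test_fun \<Omega> (box_bump k a b)"
  using box_bump_pos_iff[of k a b] box_bump_nonneg[of k a b] box_subset_cbox[of a b]
  by (intro test_funI[of _ "cbox a b"] smooth_fun_box_bump) (auto simp: less_le)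

lemma eq_0_outside_support: "x \<notin> closure {x. \<phi> x \<noteq> 0} \<Longrightarrow> \<phi> x = 0"
  using subsetD[OF closure_subset, of x "{x. \<phi> x \<noteq> 0}"] by auto

text \<open>The complement of the support is open and \<phi> vanishes identically on it. Partial
  derivatives of test functions are test functions for this reason.\<close>

lemma pd_eq_0_outside:
  assumes "x \<notin> closure {x. \<phi> x \<noteq> 0}" shows "pd i \<phi> x = 0"
proof -
  have "(\<phi> has_derivative (\<lambda>h. 0)) (at x)"
  proof (rule has_derivative_transform_within_open[OF has_derivative_const])
    show "open (- closure {x. \<phi> x \<noteq> 0})" by auto
    show "0 = \<phi> y" if "y \<in> - closure {x. \<phi> x \<noteq> 0}" for y
      using eq_0_outside_support[of y \<phi>] that by simp
  qed (use assms in simp)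
  from pd_eqI[OF this] show ?thesis .
qed

lemma test_fun_pd: "test_fun \<Omega> \<phi> \<Longrightarrow> test_fun \<Omega> (pd i \<phi>)"
  by (rule test_funI[of _ "closure {x. \<phi> x \<noteq> 0}"])
     (auto simp: test_fun_def intro: smooth_fun_pd pd_eq_0_outside)

lemma test_fun_mult:
  assumes "smooth_fun \<psi>" "test_fun \<Omega> \<phi>"
  shows "test_fun \<Omega> (\<lambda>x. \<psi> x * \<phi> x)"
proof (rule test_funI[of _ "closure {x. \<phi> x \<noteq> 0}"])
  show "smooth_fun (\<lambda>x. \<psi> x * \<phi> x)"
    using assms by (intro smooth_fun_mult) (auto simp: test_fun_def)
  show "\<psi> x * \<phi> x = 0" if "x \<notin> closure {x. \<phi> x \<noteq> 0}" for x
    using eq_0_outside_support[OF that] by simp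
qed (use assms in \<open>auto simp: test_fun_def\<close>)

lemma test_fun_eq_0: "test_fun \<Omega> \<phi> \<Longrightarrow> x \<notin> \<Omega> \<Longrightarrow> \<phi> x = 0"
  using eq_0_outside_support[of x \<phi>] by (auto simp: test_fun_def)

section \<open>Weak derivatives and test functions\<close>

lemma smooth_fun_bounded_on:
  assumes "smooth_fun \<phi>" "bounded S"
  obtains M where "M > 0" "\<And>x. x \<in> S \<Longrightarrow> \<bar>\<phi> x\<bar> \<le> M"
proof -
  have "compact (\<phi> ` closure S)"
    using assms by (intro compact_continuous_image smooth_fun_continuous_on) auto
  then obtain M where "M > 0" "\<And>x. x \<in> closure S \<Longrightarrow> \<bar>\<phi> x\<bar> \<le> M"
    by (metis bounded_pos compact_imp_bounded image_eqI real_norm_def)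
  then show ?thesis using closure_subset[of S] by (intro that) auto
qed

lemma borel_measurable_lebesgue_on:
  "f \<in> borel_measurable borel \<Longrightarrow> f \<in> borel_measurable (lebesgue_on \<Omega>)"
  by (intro measurable_restrict_space1 measurable_completion) simp

lemma L2_smooth:
  assumes "bounded \<Omega>" "open \<Omega>" "smooth_fun \<phi>" shows "L2 \<Omega> \<phi>"
proof -
  obtain M where "\<And>x. x \<in> \<Omega> \<Longrightarrow> \<bar>\<phi> x\<bar> \<le> M"
    using smooth_fun_bounded_on[OF assms(3,1)] by blast
  from L2_bounded_mult[OF borel_measurable_lebesgue_on this L2_const[OF assms(1,2), of 1]]
  show ?thesis using assms(3) by simp
qed

lemma L2v_grad:
  assumes "bounded \<Omega>" "open \<Omega>" "smooth_fun \<phi>" shows "L2v \<Omega> (grad \<phi>)"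
  using assms by (auto simp: L2v_def grad_def intro: L2_smooth smooth_fun_pd)

text \<open>Passing from \<open>lebesgue_on \<Omega>\<close> to \<open>lborel\<close> gives access
  to translation invariance.\<close>

lemma oint_eq_lborel:
  fixes \<Omega> :: "(real^'n) set"
  assumes "open \<Omega>" "f \<in> borel_measurable borel" "\<And>x. x \<notin> \<Omega> \<Longrightarrow> f x = 0"
  shows "oint \<Omega> f = (LINT x|lborel. f x)"
proof -
  have \<Omega>: "\<Omega> \<in> sets lebesgue" using assms(1) by auto
  have "oint \<Omega> f = integral\<^sup>L lebesgue (\<lambda>x. if x \<in> \<Omega> then f x else 0)"
    using Lebesgue_Measure.integral_restrict_UNIV[OF \<Omega>, of f] by (simp add: oint_def)
  also have "(\<lambda>x. if x \<in> \<Omega> then f x else 0) = f" using assms(3) by auto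
  also have "integral\<^sup>L lebesgue f = (LINT x|lborel. f x)"
    using assms(2) by (intro integral_completion) simp
  finally show ?thesis .
qed

lemma lborel_integral_shift:
  fixes f :: "real^'n \<Rightarrow> real"
  assumes "f \<in> borel_measurable borel"
  shows "(LINT x|lborel. f (x + h)) = (LINT x|lborel. f x)"
proof -
  have "(LINT x|lborel. f x) = (LINT x|distr lborel borel ((+) h). f x)"
    by (simp add: lborel_distr_plus)
  also have "\<dots> = (LINT x|lborel. f (h + x))"
    using assms by (subst integral_distr) auto
  finally show ?thesis by (simp add: add.commute)
qed

section \<open>Integration along segments and integration by parts for test functions\<close>

text \<open>The integrand is dominated by |r(x)| |K| on \<Omega> times [0,1], which has finite
  integral. The weight r is merely Lebesgue measurable, so the first factor of the product is
  \<open>lebesgue_on \<Omega>\<close> and not \<open>lborel\<close>.\<close>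

lemma oint_line_Fubini:
  fixes \<Omega> :: "(real^'n) set" and r :: "real^'n \<Rightarrow> real" and G :: "real^'n \<Rightarrow> real \<Rightarrow> real"
  assumes \<Omega>: "bounded \<Omega>" "open \<Omega>" and r: "integrable (lebesgue_on \<Omega>) r"
    and G: "continuous_on UNIV (\<lambda>z. G (fst z) (snd z))"
    and K: "\<And>x s. x \<in> \<Omega> \<Longrightarrow> s \<in> {0..1} \<Longrightarrow> \<bar>G x s\<bar> \<le> K"
  shows "oint \<Omega> (\<lambda>x. r x * (LINT s|lborel. indicator {0..1} s * G x s))
       = (LINT s|lborel. indicator {0..1} s * oint \<Omega> (\<lambda>x. r x * G x s))" (is ?eq)
    and "integrable (lebesgue_on \<Omega>) (\<lambda>x. r x * (LINT s|lborel. indicator {0..1} s * G x s))" (is ?int)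
    and "integrable lborel (\<lambda>s. indicator {0..1} s * oint \<Omega> (\<lambda>x. r x * G x s))" (is ?int2)
proof -
  let ?M = "lebesgue_on \<Omega>"
  interpret fin: finite_measure ?M
    using \<Omega> by (intro finite_measure_lebesgue_on lmeasurable_open)
  interpret P: pair_sigma_finite ?M lborel ..
  have [measurable]: "r \<in> borel_measurable ?M" using r by auto
  have id: "(\<lambda>x. x) \<in> ?M \<rightarrow>\<^sub>M borel"
    by (rule borel_measurable_lebesgue_on) simp
  \<comment> \<open>Joint continuity gives Borel measurability on the product space; since the
    identity is measurable from \<open>?M\<close> to \<open>borel\<close>, this carries over to the
    product with \<open>?M\<close>.\<close>
  have [measurable]: "(\<lambda>z. G (fst z) (snd z)) \<in> borel_measurable (?M \<Otimes>\<^sub>M lborel)"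
  proof -
    have 1: "(\<lambda>z. G (fst z) (snd z)) \<in> borel_measurable borel"
      using G by (rule borel_measurable_continuous_onI)
    have 2: "(\<lambda>z. (fst z, snd z)) \<in> (?M \<Otimes>\<^sub>M lborel) \<rightarrow>\<^sub>M (borel \<Otimes>\<^sub>M borel)"
      by (intro measurable_Pair measurable_compose[OF measurable_fst id] measurable_snd'') simp_all
    have "(\<lambda>z. z) \<in> (?M \<Otimes>\<^sub>M lborel) \<rightarrow>\<^sub>M borel"
      using 2 by (simp add: borel_prod)
    from measurable_compose[OF this 1] show ?thesis by simp
  qed
  have Gs: "(\<lambda>s. G x s) \<in> borel_measurable lborel" for x
  proof -
    have "continuous_on UNIV (\<lambda>s. G (fst (x, s)) (snd (x, s)))"
      by (rule continuous_on_compose2[OF G]) (auto intro!: continuous_intros)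
    then show ?thesis by (simp add: borel_measurable_continuous_onI)
  qed
  define F where "F x s = r x * (indicator {0..1} s * G x s)" for x s
  have Fm: "(\<lambda>z. F (fst z) (snd z)) \<in> borel_measurable (?M \<Otimes>\<^sub>M lborel)"
    unfolding F_def by measurable
  have bd: "norm (F x s) \<le> \<bar>r x\<bar> * (\<bar>K\<bar> * indicator {0..1} s)" if "x \<in> \<Omega>" for x s
    using K[OF that, of s] by (auto simp: F_def abs_mult indicator_def intro!: mult_left_mono)
  have Fint: "integrable lborel (F x)" if "x \<in> \<Omega>" for x
  proof (rule Bochner_Integration.integrable_bound)
    show "integrable lborel (\<lambda>s. \<bar>r x\<bar> * (\<bar>K\<bar> * indicator {0..1} (s::real)))" by simp
    show "F x \<in> borel_measurable lborel" unfolding F_def using Gs[of x] by measurable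
  qed (use bd[OF that] in auto)
  have int: "integrable (?M \<Otimes>\<^sub>M lborel) (\<lambda>(x, s). F x s)"
  proof (rule P.Fubini_integrable)
    show "(\<lambda>(x, s). F x s) \<in> borel_measurable (?M \<Otimes>\<^sub>M lborel)"
      using Fm by (simp add: case_prod_beta')
    show "AE x in ?M. integrable lborel (\<lambda>y. case (x, y) of (x, s) \<Rightarrow> F x s)"
      using Fint by (intro AE_I2) (simp add: space_restrict_space)
    show "integrable ?M (\<lambda>x. \<integral>y. norm (case (x, y) of (x, s) \<Rightarrow> F x s) \<partial>lborel)"
    proof (rule Bochner_Integration.integrable_bound)
      show "integrable ?M (\<lambda>x. \<bar>r x\<bar> * \<bar>K\<bar>)" using r by simp
      have "(\<lambda>x. \<integral>y. norm (F (fst (x, y)) (snd (x, y))) \<partial>lborel) \<in> borel_measurable ?M"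
        by (rule lborel.borel_measurable_lebesgue_integral) (use Fm in \<open>simp add: case_prod_beta'\<close>)
      then show "(\<lambda>x. \<integral>y. norm (case (x, y) of (x, s) \<Rightarrow> F x s) \<partial>lborel) \<in> borel_measurable ?M"
        by simp
      have "(\<integral>s. norm (F x s) \<partial>lborel) \<le> (\<integral>s. \<bar>r x\<bar> * (\<bar>K\<bar> * indicator {0..1} (s::real)) \<partial>lborel)" if "x \<in> \<Omega>" for x
        using bd[OF that] Fint[OF that] by (intro integral_mono) auto
      then show "AE x in ?M. norm (\<integral>y. norm (case (x, y) of (x, s) \<Rightarrow> F x s) \<partial>lborel) \<le> norm (\<bar>r x\<bar> * \<bar>K\<bar>)"
        by (intro AE_I2) (auto simp: space_restrict_space abs_mult)
    qed
  qed
  have c1: "(\<integral>s. F x s \<partial>lborel) = r x * (LINT s|lborel. indicator {0..1} s * G x s)" for x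
    by (simp add: F_def)
  have c2: "(\<integral>x. F x s \<partial>?M) = indicator {0..1} s * oint \<Omega> (\<lambda>x. r x * G x s)" for s
  proof -
    have "F x s = indicator {0..1} s * (r x * G x s)" for x by (simp add: F_def)
    then show ?thesis by (simp add: oint_def)
  qed
  show ?eq using P.Fubini_integral[OF int] by (simp add: c1 c2 oint_def)
  show ?int using P.integrable_fst'[of "\<lambda>(x, s). F x s"] int by (simp add: c1)
  show ?int2 using P.integrable_snd[of F] int by (simp add: c2)
qed

lemma smooth_fun_line_integral':
  assumes "smooth_fun \<phi>"
  shows "(LINT s|lborel. indicator {0..1} s * (grad \<phi> (x + s *\<^sub>R h) \<bullet> h)) = \<phi> (x + h) - \<phi> x"
  using smooth_fun_line_integral[OF assms, of x h] by simp

lemma continuous_on_grad_line: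
  "smooth_fun \<phi> \<Longrightarrow> continuous_on UNIV (\<lambda>z. grad \<phi> (fst z + snd z *\<^sub>R h) \<bullet> h)"
  by (intro continuous_intros continuous_on_compose2[OF continuous_on_grad, of _ UNIV]) auto

lemma bounded_segment_nbhd:
  fixes \<Omega> :: "'a::euclidean_space set"
  assumes "bounded \<Omega>" shows "bounded {x + s *\<^sub>R h | x s. x \<in> \<Omega> \<and> s \<in> {0..1::real}}"
proof -
  have "compact ((\<lambda>z. fst z + snd z *\<^sub>R h) ` (closure \<Omega> \<times> {0..1}))"
  proof (intro compact_continuous_image compact_Times)
    show "continuous_on (closure \<Omega> \<times> {0..1}) (\<lambda>z. fst z + snd z *\<^sub>R h)" by (intro continuous_intros)
    show "compact (closure \<Omega>)" using assms by (simp only: compact_closure)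
  qed simp
  moreover have "{x + s *\<^sub>R h | x s. x \<in> \<Omega> \<and> s \<in> {0..1::real}} \<subseteq> (\<lambda>z. fst z + snd z *\<^sub>R h) ` (closure \<Omega> \<times> {0..1})"
  proof clarify
    fix x s assume "x \<in> \<Omega>" "s \<in> {0..1::real}"
    then have "(x, s) \<in> closure \<Omega> \<times> {0..1}" using closure_subset[of \<Omega>] by auto
    then show "x + s *\<^sub>R h \<in> (\<lambda>z. fst z + snd z *\<^sub>R h) ` (closure \<Omega> \<times> {0..1})"
      by (rule rev_image_eqI) simp
  qed
  ultimately show ?thesis by (rule bounded_subset[OF compact_imp_bounded])
qed

text \<open>Segments of direction h that start in a bounded set stay in a compact set, where the
  continuous integrand is bounded. This supplies the constant K for
  \<open>oint_line_Fubini\<close>.\<close>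

lemma grad_line_bounded:
  assumes "smooth_fun \<phi>" "bounded \<Omega>"
  obtains K where "\<And>x s. x \<in> \<Omega> \<Longrightarrow> s \<in> {0..1} \<Longrightarrow> \<bar>grad \<phi> (x + s *\<^sub>R h) \<bullet> h\<bar> \<le> K"
proof -
  let ?S = "{x + s *\<^sub>R h | x s. x \<in> \<Omega> \<and> s \<in> {0..1::real}}"
  have "compact ((\<lambda>y. grad \<phi> y \<bullet> h) ` closure ?S)"
    using assms bounded_segment_nbhd[OF assms(2), of h]
    by (intro compact_continuous_image continuous_intros continuous_on_grad) auto
  then have "bounded ((\<lambda>y. grad \<phi> y \<bullet> h) ` closure ?S)" by (rule compact_imp_bounded)
  then obtain K where K: "\<forall>z\<in>(\<lambda>y. grad \<phi> y \<bullet> h) ` closure ?S. norm z \<le> K"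
    unfolding bounded_iff by blast
  show ?thesis
  proof (rule that)
    fix x s assume "x \<in> \<Omega>" "s \<in> {0..1::real}"
    then have "x + s *\<^sub>R h \<in> closure ?S" by (intro subsetD[OF closure_subset]) blast
    then show "\<bar>grad \<phi> (x + s *\<^sub>R h) \<bullet> h\<bar> \<le> K" using K by force
  qed
qed

text \<open>Fubini applied to the fundamental theorem of calculus on each segment. A constant r
  leads to integration by parts, a weight r with zero weak gradient to translation
  invariance.\<close>

lemma oint_translation_difference:
  fixes \<Omega> :: "(real^'n) set"
  assumes \<Omega>: "bounded \<Omega>" "open \<Omega>" and r: "integrable (lebesgue_on \<Omega>) r" and \<phi>: "smooth_fun \<phi>"
  shows "oint \<Omega> (\<lambda>x. r x * (\<phi> (x + h) - \<phi> x))
       = (LINT s|lborel. indicator {0..1} s * oint \<Omega> (\<lambda>x. r x * (grad \<phi> (x + s *\<^sub>R h) \<bullet> h)))"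
proof -
  obtain K where K: "\<And>x s. x \<in> \<Omega> \<Longrightarrow> s \<in> {0..1} \<Longrightarrow> \<bar>grad \<phi> (x + s *\<^sub>R h) \<bullet> h\<bar> \<le> K"
    using grad_line_bounded[OF \<phi> \<Omega>(1)] by blast
  show ?thesis
    using oint_line_Fubini(1)[OF \<Omega> r continuous_on_grad_line[OF \<phi>] K]
    by (simp add: smooth_fun_line_integral'[OF \<phi>])
qed

text \<open>The integral of \<phi> is unchanged by a unit shift along the axis. In the formula for
  the difference every inner integral equals the integral of \<open>pd i \<phi>\<close>, which must
  therefore vanish.\<close>

lemma oint_pd_test_fun:
  fixes \<Omega> :: "(real^'n) set"
  assumes \<Omega>: "bounded \<Omega>" "open \<Omega>" and \<phi>: "test_fun \<Omega> \<phi>"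
  shows "oint \<Omega> (pd i \<phi>) = 0"
proof -
  let ?e = "axis i 1 :: real^'n"
  obtain R where R: "R > 0" "\<And>x. x \<in> \<Omega> \<Longrightarrow> norm x \<le> R" using \<Omega>(1) by (auto simp: bounded_pos)
  \<comment> \<open>The margin around \<Omega> keeps the supports of all shifts with s in [0,1]
    inside the ball, so integrals over it are integrals over the whole space.\<close>
  let ?B = "ball 0 (R + 2) :: (real^'n) set"
  have sm: "smooth_fun \<phi>" using \<phi> by (rule test_fun_smooth)
  have [measurable]: "\<phi> \<in> borel_measurable borel" "pd i \<phi> \<in> borel_measurable borel"
    using sm by (auto intro: smooth_fun_borel_measurable smooth_fun_pd)
  have out: "x + s *\<^sub>R ?e \<notin> \<Omega>" if "x \<notin> ?B" "s \<in> {0..1}" for x s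
  proof
    assume "x + s *\<^sub>R ?e \<in> \<Omega>"
    then have "norm (x + s *\<^sub>R ?e) \<le> R" by (rule R)
    moreover have "norm x \<le> norm (x + s *\<^sub>R ?e) + norm (s *\<^sub>R ?e)"
      using norm_triangle_ineq4[of "x + s *\<^sub>R ?e" "s *\<^sub>R ?e"] by simp
    moreover have "norm (s *\<^sub>R ?e) \<le> 1" using that by (simp add: norm_axis_1)
    ultimately show False using that by simp
  qed
  have L: "oint ?B (\<lambda>x. g (x + s *\<^sub>R ?e)) = (LINT x|lborel. g x)"
    if "g \<in> borel_measurable borel" "\<And>x. x \<notin> \<Omega> \<Longrightarrow> g x = 0" "s \<in> {0..1}" for g s
  proof -
    have "oint ?B (\<lambda>x. g (x + s *\<^sub>R ?e)) = (LINT x|lborel. g (x + s *\<^sub>R ?e))"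
    proof (rule oint_eq_lborel)
      show "(\<lambda>x. g (x + s *\<^sub>R ?e)) \<in> borel_measurable borel"
        using that(1) by measurable
      show "g (x + s *\<^sub>R ?e) = 0" if "x \<notin> ?B" for x
        by (rule \<open>\<And>x. x \<notin> \<Omega> \<Longrightarrow> g x = 0\<close>, rule out[OF that \<open>s \<in> {0..1}\<close>])
    qed simp
    then show ?thesis using lborel_integral_shift[OF that(1)] by simp
  qed
  have z: "\<phi> x = 0" "pd i \<phi> x = 0" if "x \<notin> \<Omega>" for x
    using test_fun_eq_0[OF \<phi> that] test_fun_eq_0[OF test_fun_pd[OF \<phi>] that] by auto
  have gi: "grad \<phi> x \<bullet> ?e = pd i \<phi> x" for x by (simp add: grad_def inner_axis)
  have ints: "integrable (lebesgue_on ?B) (\<lambda>x. \<phi> (x + h))" for h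
    by (intro L2_integrable L2_smooth smooth_fun_shift sm) auto
  have "(LINT x|lborel. pd i \<phi> x) = (LINT s|lborel. indicator {0..1::real} s * (LINT x|lborel. pd i \<phi> x))"
    by simp
  also have "\<dots> = (LINT s|lborel. indicator {0..1} s * oint ?B (\<lambda>x. 1 * (grad \<phi> (x + s *\<^sub>R ?e) \<bullet> ?e)))"
    using L[of "pd i \<phi>"] z by (intro Bochner_Integration.integral_cong) (auto simp: gi indicator_def)
  also have "\<dots> = oint ?B (\<lambda>x. 1 * (\<phi> (x + ?e) - \<phi> x))"
    by (rule oint_translation_difference[symmetric])
       (rule bounded_ball open_ball L2_integrable[OF bounded_ball open_ball L2_const[OF bounded_ball open_ball]] sm)+
  also have "\<dots> = oint ?B (\<lambda>x. \<phi> (x + ?e)) - oint ?B \<phi>"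
    using ints[of ?e] ints[of 0] by (simp add: oint_def)
  also have "\<dots> = 0"
    using L[of \<phi> 1] L[of \<phi> 0] z by simp
  finally have "(LINT x|lborel. pd i \<phi> x) = 0" .
  then show ?thesis using oint_eq_lborel[OF \<Omega>(2), of "pd i \<phi>"] z by simp
qed

text \<open>A smooth function times a test function is a test function, so its partial derivative
  integrates to 0, and the product rule splits this integral. The approximating sequence of the
  pressure uses it.\<close>

lemma has_weak_grad_smooth:
  fixes \<Omega> :: "(real^'n) set"
  assumes \<Omega>: "bounded \<Omega>" "open \<Omega>" and \<phi>: "smooth_fun \<phi>"
  shows "has_weak_grad \<Omega> \<phi> (grad \<phi>)"
  unfolding has_weak_grad_def
proof (intro allI impI)
  fix \<psi> i assume \<psi>: "test_fun \<Omega> \<psi>"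
  note sm = \<phi> test_fun_smooth[OF \<psi>]
  have int: "integrable (lebesgue_on \<Omega>) (\<lambda>x. \<phi> x * pd i \<psi> x)" "integrable (lebesgue_on \<Omega>) (\<lambda>x. pd i \<phi> x * \<psi> x)"
    using sm by (auto intro!: L2_mult_integrable L2_smooth \<Omega> smooth_fun_pd)
  have "0 = oint \<Omega> (pd i (\<lambda>x. \<phi> x * \<psi> x))"
    by (rule oint_pd_test_fun[symmetric]) (intro \<Omega> test_fun_mult \<phi> \<psi>)+
  also have "pd i (\<lambda>x. \<phi> x * \<psi> x) = (\<lambda>x. \<phi> x * pd i \<psi> x + pd i \<phi> x * \<psi> x)"
    using sm by (auto simp: pd_mult smooth_fun_differentiable)
  finally show "oint \<Omega> (\<lambda>x. \<phi> x * pd i \<psi> x) = - oint \<Omega> (\<lambda>x. grad \<phi> x $ i * \<psi> x)"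
    using int by (simp add: oint_def grad_def)
qed

section \<open>The fundamental lemma of the calculus of variations\<close>

text \<open>Dominated convergence with majorant |g|. The limit is expressed as a gauge integral over
  the closed box, the form in which cube averages are differentiated below.\<close>

lemma oint_box_bump_tendsto:
  fixes \<Omega> :: "(real^'n) set"
  assumes "open \<Omega>" "integrable (lebesgue_on \<Omega>) g"
  shows "(\<lambda>n. oint \<Omega> (\<lambda>x. g x * box_bump (real (Suc n)) a b x))
           \<longlonglongrightarrow> integral (cbox a b) (\<lambda>x. if x \<in> \<Omega> then g x else 0)"
proof -
  have \<Omega>: "\<Omega> \<in> sets lebesgue" using assms(1) by auto
  have [measurable]: "g \<in> borel_measurable (lebesgue_on \<Omega>)" using assms(2) by auto
  have [measurable]: "box_bump k a b \<in> borel_measurable (lebesgue_on \<Omega>)" for k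
    by (intro borel_measurable_lebesgue_on smooth_fun_borel_measurable smooth_fun_box_bump)
  have ind[measurable]: "(indicator (box a b) :: _ \<Rightarrow> real) \<in> borel_measurable (lebesgue_on \<Omega>)"
    by (intro borel_measurable_lebesgue_on) simp
  have lim: "(\<lambda>n. oint \<Omega> (\<lambda>x. g x * box_bump (real (Suc n)) a b x)) \<longlonglongrightarrow> oint \<Omega> (\<lambda>x. g x * indicator (box a b) x)"
    unfolding oint_def
  proof (rule integral_dominated_convergence)
    show "integrable (lebesgue_on \<Omega>) (\<lambda>x. \<bar>g x\<bar>)" using assms(2) by simp
    show "AE x in lebesgue_on \<Omega>. (\<lambda>n. g x * box_bump (real (Suc n)) a b x) \<longlonglongrightarrow> g x * indicator (box a b) x"
      by (intro AE_I2 tendsto_mult tendsto_const box_bump_tendsto)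
    show "AE x in lebesgue_on \<Omega>. norm (g x * box_bump (real (Suc n)) a b x) \<le> \<bar>g x\<bar>" for n
      by (intro AE_I2) (simp add: abs_mult box_bump_nonneg box_bump_le_1 mult_left_le)
  qed measurable
  have "integrable (lebesgue_on \<Omega>) (\<lambda>x. g x * indicator (box a b) x)"
    by (rule Bochner_Integration.integrable_bound[OF assms(2)]) (measurable, auto simp: indicator_def)
  then have "oint \<Omega> (\<lambda>x. g x * indicator (box a b) x) = integral \<Omega> (\<lambda>x. g x * indicator (box a b) x)"
    unfolding oint_def by (rule lebesgue_integral_eq_integral[OF _ \<Omega>])
  also have "\<dots> = integral UNIV (\<lambda>x. if x \<in> \<Omega> then g x * indicator (box a b) x else 0)"
    by (simp add: Henstock_Kurzweil_Integration.integral_restrict_UNIV)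
  also have "(\<lambda>x. if x \<in> \<Omega> then g x * indicator (box a b) x else 0)
      = (\<lambda>x. if x \<in> box a b then (if x \<in> \<Omega> then g x else 0) else 0)"
    by (auto simp: indicator_def)
  also have "integral UNIV \<dots> = integral (box a b) (\<lambda>x. if x \<in> \<Omega> then g x else 0)"
    by (rule Henstock_Kurzweil_Integration.integral_restrict_UNIV)
  also have "\<dots> = integral (cbox a b) (\<lambda>x. if x \<in> \<Omega> then g x else 0)"
    by (rule integral_open_interval)
  finally show ?thesis using lim by simp
qed

text \<open>Lebesgue's differentiation theorem for cubes with lower corner x, applied to the
  extension of g by 0.\<close>

lemma AE_cube_averages:
  fixes \<Omega> :: "(real^'n) set"
  assumes "open \<Omega>" "integrable (lebesgue_on \<Omega>) g"
  obtains N where "negligible N"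
    "\<And>x e. x \<in> \<Omega> \<Longrightarrow> x \<notin> N \<Longrightarrow> e > 0 \<Longrightarrow> \<exists>d>0. \<forall>h. 0 < h \<and> h < d \<longrightarrow>
       \<bar>integral (cbox x (x + h *\<^sub>R One)) (\<lambda>x. if x \<in> \<Omega> then g x else 0) / h ^ DIM(real^'n) - g x\<bar> < e"
proof -
  have \<Omega>: "\<Omega> \<in> sets lebesgue" using assms(1) by auto
  let ?f = "\<lambda>x. if x \<in> \<Omega> then g x else 0"
  have "?f integrable_on UNIV"
    using assms(2) Lebesgue_Measure.integrable_restrict_UNIV[OF \<Omega>, of g] by (intro integrable_on_lebesgue) simp
  then have "?f integrable_on cbox a b" for a b
    by (rule integrable_on_subcbox) simp
  from integrable_ccontinuous_explicit[OF this] obtain N where N: "negligible N"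
    "\<And>x e. \<lbrakk>x \<notin> N; 0 < e\<rbrakk> \<Longrightarrow> \<exists>d>0. \<forall>h. 0 < h \<and> h < d \<longrightarrow>
       norm (integral (cbox x (x + h *\<^sub>R One)) ?f /\<^sub>R h ^ DIM(real^'n) - ?f x) < e"
    by blast
  show ?thesis
  proof (rule that[OF N(1)])
    fix x e assume "x \<in> \<Omega>" "x \<notin> N" "e > (0::real)"
    then show "\<exists>d>0. \<forall>h. 0 < h \<and> h < d \<longrightarrow>
       \<bar>integral (cbox x (x + h *\<^sub>R One)) ?f / h ^ DIM(real^'n) - g x\<bar> < e"
      using N(2)[of x e] by (simp add: divide_inverse mult.commute)
  qed
qed

lemma AE_lebesgue_on_negligible:
  assumes "open \<Omega>" "negligible N" "\<And>x. x \<in> \<Omega> \<Longrightarrow> x \<notin> N \<Longrightarrow> P x"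
  shows "AE x in lebesgue_on \<Omega>. P x"
proof -
  have "AE x in lebesgue. x \<notin> N"
    using assms(2) by (intro AE_not_in) (simp add: negligible_iff_null_sets)
  then have "AE x in lebesgue. x \<in> \<Omega> \<longrightarrow> P x" by eventually_elim (use assms(3) in blast)
  then show ?thesis using assms(1) by (simp add: AE_restrict_space_iff)
qed

lemma small_cube_subset:
  fixes x :: "real^'n"
  assumes "open S" "x \<in> S"
  obtains d where "d > 0" "\<And>h. 0 < h \<Longrightarrow> h < d \<Longrightarrow> cbox x (x + h *\<^sub>R One) \<subseteq> S"
proof -
  obtain e where e: "e > 0" "ball x e \<subseteq> S" using assms open_contains_ball by blast
  \<comment> \<open>A point of the cube differs from x by at most h in each coordinate, so its
    distance from x is at most the dimension times h; the added 1 makes the final bound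
    strict.\<close>
  define d where "d = e / (real DIM(real^'n) + 1)"
  have "d > 0" using e by (simp add: d_def)
  moreover have "cbox x (x + h *\<^sub>R One) \<subseteq> S" if h: "0 < h" "h < d" for h
  proof
    fix y assume y: "y \<in> cbox x (x + h *\<^sub>R One)"
    have "\<bar>(y - x) \<bullet> b\<bar> \<le> h" if "b \<in> Basis" for b
      using y that by (auto simp: mem_box inner_diff_left inner_add_left abs_le_iff)
    then have "norm (y - x) \<le> (\<Sum>b\<in>(Basis :: (real^'n) set). h)"
      using norm_le_l1[of "y - x"] by (meson order_trans sum_mono)
    also have "\<dots> = real DIM(real^'n) * h" by simp
    also have "\<dots> \<le> real DIM(real^'n) * d" using h by (intro mult_left_mono) auto
    also have "\<dots> < real DIM(real^'n) * d + d" using \<open>d > 0\<close> by simp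
    also have "\<dots> = (real DIM(real^'n) + 1) * d" by (simp add: algebra_simps)
    also have "\<dots> = e" by (simp add: d_def del: DIM_cart)
    finally show "y \<in> S" using e by (auto simp: dist_norm norm_minus_commute)
  qed
  ultimately show ?thesis by (rule that)
qed

text \<open>Bumps over cubes inside \<Omega> converge to the cube indicators, so all small cube
  integrals of g vanish; differentiating cube averages gives g = 0 off the exceptional set.\<close>

lemma AE_eq_0_if_test_orthogonal:
  fixes \<Omega> :: "(real^'n) set"
  assumes "open \<Omega>" "integrable (lebesgue_on \<Omega>) g"
    and "\<And>\<phi>. test_fun \<Omega> \<phi> \<Longrightarrow> oint \<Omega> (\<lambda>x. g x * \<phi> x) = 0"
  shows "AE x in lebesgue_on \<Omega>. g x = 0"
proof -
  obtain N where N: "negligible N"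
    "\<And>x e. x \<in> \<Omega> \<Longrightarrow> x \<notin> N \<Longrightarrow> e > 0 \<Longrightarrow> \<exists>d>0. \<forall>h. 0 < h \<and> h < d \<longrightarrow>
       \<bar>integral (cbox x (x + h *\<^sub>R One)) (\<lambda>x. if x \<in> \<Omega> then g x else 0) / h ^ DIM(real^'n) - g x\<bar> < e"
    using AE_cube_averages[OF assms(1,2)] by blast
  have "g x = 0" if x: "x \<in> \<Omega>" "x \<notin> N" for x
  proof (rule ccontr)
    assume "g x \<noteq> 0"
    then obtain d where d: "d > 0" "\<forall>h. 0 < h \<and> h < d \<longrightarrow>
       \<bar>integral (cbox x (x + h *\<^sub>R One)) (\<lambda>x. if x \<in> \<Omega> then g x else 0) / h ^ DIM(real^'n) - g x\<bar> < \<bar>g x\<bar>"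
      using N(2)[OF x, of "\<bar>g x\<bar>"] by auto
    obtain d' where d': "d' > 0" "\<And>h. 0 < h \<Longrightarrow> h < d' \<Longrightarrow> cbox x (x + h *\<^sub>R One) \<subseteq> \<Omega>"
      using small_cube_subset[OF assms(1) x(1)] by blast
    define h where "h = min d d' / 2"
    have h: "0 < h" "h < d" "h < d'" using d d' by (auto simp: h_def)
    have "oint \<Omega> (\<lambda>y. g y * box_bump (real (Suc n)) x (x + h *\<^sub>R One) y) = 0" for n
      by (intro assms(3) test_fun_box_bump d'(2) h) simp
    then have "integral (cbox x (x + h *\<^sub>R One)) (\<lambda>x. if x \<in> \<Omega> then g x else 0) = 0"
      using oint_box_bump_tendsto[OF assms(1,2), of x "x + h *\<^sub>R One"] by (simp add: LIMSEQ_const_iff)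
    then show False using d(2) h by force
  qed
  then show ?thesis by (rule AE_lebesgue_on_negligible[OF assms(1) N(1)])
qed

section \<open>Functions with zero weak gradient on a connected set\<close>

lemma integrable_mult_smooth:
  assumes "bounded \<Omega>" "integrable (lebesgue_on \<Omega>) r" "smooth_fun \<phi>"
  shows "integrable (lebesgue_on \<Omega>) (\<lambda>x. r x * \<phi> x)"
proof -
  obtain M where M: "\<And>x. x \<in> \<Omega> \<Longrightarrow> \<bar>\<phi> x\<bar> \<le> M"
    using smooth_fun_bounded_on[OF assms(3,1)] by blast
  show ?thesis
  proof (rule Bochner_Integration.integrable_bound)
    show "integrable (lebesgue_on \<Omega>) (\<lambda>x. \<bar>r x\<bar> * M)" using assms(2) by simp
    have [measurable]: "\<phi> \<in> borel_measurable (lebesgue_on \<Omega>)" "r \<in> borel_measurable (lebesgue_on \<Omega>)"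
      using assms by (auto intro: borel_measurable_lebesgue_on)
    show "(\<lambda>x. r x * \<phi> x) \<in> borel_measurable (lebesgue_on \<Omega>)" by measurable
    show "AE x in lebesgue_on \<Omega>. norm (r x * \<phi> x) \<le> norm (\<bar>r x\<bar> * M)"
    proof (rule AE_I2)
      fix x assume "x \<in> space (lebesgue_on \<Omega>)"
      then have "\<bar>\<phi> x\<bar> \<le> \<bar>M\<bar>" using M[of x] by (simp add: space_restrict_space)
      then show "norm (r x * \<phi> x) \<le> norm (\<bar>r x\<bar> * M)" by (simp add: abs_mult mult_left_mono)
    qed
  qed
qed

text \<open>Along the shifts \<phi>(x + s h) the pairing with r changes at the rate given by r
  against partial derivatives of a test function, which is 0. Convexity of C keeps the support of
  every intermediate shift inside \<Omega>.\<close>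

lemma weak_grad_0_translation_invariant:
  fixes \<Omega> :: "(real^'n) set"
  assumes \<Omega>: "bounded \<Omega>" "open \<Omega>" and r: "integrable (lebesgue_on \<Omega>) r"
    and zero: "\<And>\<phi> i. test_fun \<Omega> \<phi> \<Longrightarrow> oint \<Omega> (\<lambda>x. r x * pd i \<phi> x) = 0"
    and C: "convex C" "C \<subseteq> \<Omega>"
    and \<phi>: "smooth_fun \<phi>" "compact K" "\<And>x. x \<notin> K \<Longrightarrow> \<phi> x = 0"
    and K: "K \<subseteq> C" "\<And>x. x \<in> K \<Longrightarrow> x - h \<in> C"
  shows "oint \<Omega> (\<lambda>x. r x * \<phi> (x + h)) = oint \<Omega> (\<lambda>x. r x * \<phi> x)"
proof -
  have test: "test_fun \<Omega> (\<lambda>x. \<phi> (x + s *\<^sub>R h))" if s: "s \<in> {0..1}" for s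
  proof (rule test_funI)
    show "smooth_fun (\<lambda>x. \<phi> (x + s *\<^sub>R h))" using \<phi>(1) by (rule smooth_fun_shift)
    show "compact ((\<lambda>x. x - s *\<^sub>R h) ` K)"
      using \<phi>(2) by (intro compact_continuous_image) (auto intro!: continuous_intros)
    show "(\<lambda>x. x - s *\<^sub>R h) ` K \<subseteq> \<Omega>"
    proof (rule image_subsetI)
      fix x assume x: "x \<in> K"
      have "(1 - s) *\<^sub>R x + s *\<^sub>R (x - h) \<in> C"
        using s K x by (intro convexD[OF C(1)]) auto
      then show "x - s *\<^sub>R h \<in> \<Omega>" using C(2) by (auto simp: algebra_simps)
    qed
    show "\<phi> (x + s *\<^sub>R h) = 0" if "x \<notin> (\<lambda>x. x - s *\<^sub>R h) ` K" for x
      by (rule \<phi>(3)) (use that in \<open>force simp: image_iff algebra_simps\<close>)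
  qed
  have inner0: "oint \<Omega> (\<lambda>x. r x * (grad \<phi> (x + s *\<^sub>R h) \<bullet> h)) = 0" if s: "s \<in> {0..1}" for s
  proof -
    let ?\<psi> = "\<lambda>x. \<phi> (x + s *\<^sub>R h)"
    have "smooth_fun (pd i ?\<psi>)" for i using smooth_fun_pd[OF smooth_fun_shift[OF \<phi>(1)]] .
    then have int: "integrable (lebesgue_on \<Omega>) (\<lambda>x. h $ i * (r x * pd i ?\<psi> x))" for i
      by (intro integrable_mult_right integrable_mult_smooth \<Omega> r)
    have "(\<lambda>x. r x * (grad \<phi> (x + s *\<^sub>R h) \<bullet> h)) = (\<lambda>x. \<Sum>i\<in>UNIV. h $ i * (r x * pd i ?\<psi> x))"
      by (simp add: fun_eq_iff inner_vec_def grad_def pd_shift[OF \<phi>(1)] sum_distrib_left algebra_simps)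
    then have "oint \<Omega> (\<lambda>x. r x * (grad \<phi> (x + s *\<^sub>R h) \<bullet> h)) = (\<Sum>i\<in>UNIV. oint \<Omega> (\<lambda>x. h $ i * (r x * pd i ?\<psi> x)))"
      using int by (simp add: oint_def)
    also have "\<dots> = (\<Sum>i\<in>UNIV. h $ i * oint \<Omega> (\<lambda>x. r x * pd i ?\<psi> x))"
      by (simp add: oint_def)
    finally show ?thesis using zero[OF test[OF s]] by simp
  qed
  have "oint \<Omega> (\<lambda>x. r x * (\<phi> (x + h) - \<phi> x)) = (LINT s|lborel. indicator {0..1::real} s * 0)"
    unfolding oint_translation_difference[OF \<Omega> r \<phi>(1)]
    by (intro Bochner_Integration.integral_cong) (auto simp: inner0 indicator_def)
  moreover have "integrable (lebesgue_on \<Omega>) (\<lambda>x. r x * \<phi> (x + h))" "integrable (lebesgue_on \<Omega>) (\<lambda>x. r x * \<phi> x)"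
    using \<phi>(1) by (intro integrable_mult_smooth \<Omega> r smooth_fun_shift; assumption)+
  ultimately show ?thesis by (simp add: oint_def right_diff_distrib)
qed

lemma box_bump_shift: "box_bump k a b (x + h) = box_bump k (a - h) (b - h) x"
  by (simp add: box_bump_def algebra_simps)

lemma box_bump_eq_0: "k > 0 \<Longrightarrow> x \<notin> cbox a b \<Longrightarrow> box_bump k a b x = 0"
  using box_bump_pos_iff[of k a b x] box_bump_nonneg[of k a b x] box_subset_cbox[of a b] by auto

text \<open>Cubes of equal size in a common convex subset carry equal integrals of r, since their
  bumps are translates of each other. Cube averages then make r constant on balls off a null set,
  and connectedness makes the local constants agree.\<close>

lemma weak_grad_0_AE_const:
  fixes \<Omega> :: "(real^'n) set"
  assumes \<Omega>: "bounded \<Omega>" "open \<Omega>" "connected \<Omega>" and r: "integrable (lebesgue_on \<Omega>) r"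
    and zero: "\<And>\<phi> i. test_fun \<Omega> \<phi> \<Longrightarrow> oint \<Omega> (\<lambda>x. r x * pd i \<phi> x) = 0"
  shows "\<exists>c. AE x in lebesgue_on \<Omega>. r x = c"
proof -
  let ?I = "\<lambda>x h. integral (cbox x (x + h *\<^sub>R One)) (\<lambda>x. if x \<in> \<Omega> then r x else 0)"
  obtain N where N: "negligible N"
    "\<And>x e. x \<in> \<Omega> \<Longrightarrow> x \<notin> N \<Longrightarrow> e > 0 \<Longrightarrow> \<exists>d>0. \<forall>h. 0 < h \<and> h < d \<longrightarrow> \<bar>?I x h / h ^ DIM(real^'n) - r x\<bar> < e"
    using AE_cube_averages[OF \<Omega>(2) r] by blast
  have I_eq: "?I x h = ?I y h"
    if C: "convex C" "C \<subseteq> \<Omega>" "cbox x (x + h *\<^sub>R One) \<subseteq> C" "cbox y (y + h *\<^sub>R One) \<subseteq> C" for C x y h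
  proof (rule LIMSEQ_unique[OF oint_box_bump_tendsto[OF \<Omega>(2) r]])
    have "oint \<Omega> (\<lambda>z. r z * box_bump (real (Suc n)) y (y + h *\<^sub>R One) z)
        = oint \<Omega> (\<lambda>z. r z * box_bump (real (Suc n)) x (x + h *\<^sub>R One) z)" for n
    proof -
      have "oint \<Omega> (\<lambda>z. r z * box_bump (real (Suc n)) x (x + h *\<^sub>R One) (z + (x - y)))
          = oint \<Omega> (\<lambda>z. r z * box_bump (real (Suc n)) x (x + h *\<^sub>R One) z)"
      proof (rule weak_grad_0_translation_invariant[OF \<Omega>(1,2) r zero C(1,2) smooth_fun_box_bump])
        show "compact (cbox x (x + h *\<^sub>R One))" by simp
        show "z - (x - y) \<in> C" if "z \<in> cbox x (x + h *\<^sub>R One)" for z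
          using that C(4) by (intro subsetD[OF C(4)]) (auto simp: mem_box algebra_simps)
      qed (use C in \<open>auto intro!: box_bump_eq_0\<close>)
      moreover have "x - (x - y) = y" "x + h *\<^sub>R One - (x - y) = y + h *\<^sub>R One" by simp_all
      ultimately show ?thesis by (simp only: box_bump_shift)
    qed
    then show "(\<lambda>n. oint \<Omega> (\<lambda>z. r z * box_bump (real (Suc n)) x (x + h *\<^sub>R One) z)) \<longlonglongrightarrow> ?I y h"
      using oint_box_bump_tendsto[OF \<Omega>(2) r, of y "y + h *\<^sub>R One"] by simp
  qed
  have ball_const: "r x = r y"
    if C: "convex C" "open C" "C \<subseteq> \<Omega>" "x \<in> C - N" "y \<in> C - N" for C x y
  proof (rule ccontr)
    assume "r x \<noteq> r y"
    define e where "e = \<bar>r x - r y\<bar> / 2"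
    have "e > 0" using \<open>r x \<noteq> r y\<close> by (simp add: e_def)
    obtain d1 where d1: "d1 > 0" "\<forall>h. 0 < h \<and> h < d1 \<longrightarrow> \<bar>?I x h / h ^ DIM(real^'n) - r x\<bar> < e"
      using N(2)[of x e] C \<open>e > 0\<close> by blast
    obtain d2 where d2: "d2 > 0" "\<forall>h. 0 < h \<and> h < d2 \<longrightarrow> \<bar>?I y h / h ^ DIM(real^'n) - r y\<bar> < e"
      using N(2)[of y e] C \<open>e > 0\<close> by blast
    obtain d3 where d3: "d3 > 0" "\<And>h. 0 < h \<Longrightarrow> h < d3 \<Longrightarrow> cbox x (x + h *\<^sub>R One) \<subseteq> C"
      using small_cube_subset[OF C(2), of x] C(4) by blast
    obtain d4 where d4: "d4 > 0" "\<And>h. 0 < h \<Longrightarrow> h < d4 \<Longrightarrow> cbox y (y + h *\<^sub>R One) \<subseteq> C"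
      using small_cube_subset[OF C(2), of y] C(5) by blast
    define h where "h = Min {d1, d2, d3, d4} / 2"
    have h: "0 < h" "h < d1" "h < d2" "h < d3" "h < d4"
      using d1(1) d2(1) d3(1) d4(1) by (auto simp: h_def)
    have "?I x h = ?I y h" using I_eq[OF C(1,3) d3(2) d4(2)] h by blast
    then have "\<bar>?I y h / h ^ DIM(real^'n) - r x\<bar> < e" "\<bar>?I y h / h ^ DIM(real^'n) - r y\<bar> < e"
      using d1(2)[rule_format, of h] d2(2)[rule_format, of h] h by simp_all
    moreover have False if "\<bar>A - p\<bar> < \<bar>p - q\<bar> / 2" "\<bar>A - q\<bar> < \<bar>p - q\<bar> / 2" for A p q :: real
      using that by (simp add: abs_if split: if_splits)
    ultimately show False unfolding e_def by blast
  qed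
  \<comment> \<open>On N the values of r are arbitrary, so a value v near x replaces r x. The claim
    is vacuous if the ball minus N is empty, which makes the choice by \<open>SOME\<close>
    harmless.\<close>
  have "\<exists>v. \<exists>e>0. ball x e \<subseteq> \<Omega> \<and> (\<forall>y\<in>ball x e - N. r y = v)" if "x \<in> \<Omega>" for x
  proof -
    obtain e where e: "e > 0" "ball x e \<subseteq> \<Omega>" by (rule openE[OF \<Omega>(2) \<open>x \<in> \<Omega>\<close>])
    have "\<forall>y\<in>ball x e - N. r y = r (SOME z. z \<in> ball x e - N)"
    proof
      fix y assume y: "y \<in> ball x e - N"
      show "r y = r (SOME z. z \<in> ball x e - N)"
        by (rule ball_const[OF convex_ball open_ball e(2) y]) (rule someI[of "\<lambda>z. z \<in> ball x e - N", OF y])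
    qed
    with e show ?thesis by (intro exI conjI)
  qed
  then obtain v where v: "\<And>x. x \<in> \<Omega> \<Longrightarrow> \<exists>e>0. ball x e \<subseteq> \<Omega> \<and> (\<forall>y\<in>ball x e - N. r y = v x)"
    by metis
  \<comment> \<open>Overlapping balls meet in a nonempty open set, which the negligible N cannot
    contain; a common point outside N identifies their two values.\<close>
  have pick: "\<exists>z\<in>S. z \<notin> N" if "open S" "S \<noteq> {}" for S
    using open_not_negligible[OF that] negligible_subset[OF N(1)] by blast
  have loc: "\<forall>\<^sub>F b in at a within \<Omega>. v a = v b" if a: "a \<in> \<Omega>" for a
  proof -
    obtain e where e: "e > 0" "\<forall>y\<in>ball a e - N. r y = v a" using v[OF a] by blast
    have "v a = v b" if "b \<in> \<Omega>" "dist b a < e" for b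
    proof -
      obtain e' where e': "e' > 0" "\<forall>y\<in>ball b e' - N. r y = v b" using v[OF \<open>b \<in> \<Omega>\<close>] by blast
      have "b \<in> ball a e \<inter> ball b e'" using that e' by (simp add: dist_commute)
      then obtain z where "z \<in> ball a e \<inter> ball b e'" "z \<notin> N" using pick[of "ball a e \<inter> ball b e'"] by blast
      then show ?thesis using e(2) e'(2) by (metis DiffI IntD1 IntD2)
    qed
    then show ?thesis using e(1) by (auto simp: eventually_at)
  qed
  have const: "v a = v b" if "a \<in> \<Omega>" "b \<in> \<Omega>" for a b
    using connected_local_const[OF \<Omega>(3) that] loc by blast
  show ?thesis
  proof (cases "\<Omega> = {}")
    case True
    then show ?thesis by (auto intro!: exI AE_I2 simp: space_restrict_space)
  next
    case False
    then obtain a where a: "a \<in> \<Omega>" by blast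
    have "r x = v a" if "x \<in> \<Omega>" "x \<notin> N" for x
    proof -
      obtain e where "e > 0" "\<forall>y\<in>ball x e - N. r y = v x" using v[OF \<open>x \<in> \<Omega>\<close>] by blast
      then have "r x = v x" using \<open>x \<notin> N\<close> by simp
      also have "v x = v a" by (rule const[OF \<open>x \<in> \<Omega>\<close> a])
      finally show ?thesis .
    qed
    then have "AE x in lebesgue_on \<Omega>. r x = v a" by (rule AE_lebesgue_on_negligible[OF \<Omega>(2) N(1)])
    then show ?thesis by (rule exI)
  qed
qed

section \<open>Weak derivatives of differences\<close>

lemma has_weak_grad_diff:
  fixes \<Omega> :: "(real^'n) set"
  assumes \<Omega>: "bounded \<Omega>" "open \<Omega>" and q: "L2 \<Omega> q" "L2 \<Omega> r" and G: "L2v \<Omega> G" "L2v \<Omega> H"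
    and w: "has_weak_grad \<Omega> q G" "has_weak_grad \<Omega> r H"
  shows "has_weak_grad \<Omega> (\<lambda>x. q x - r x) (\<lambda>x. G x - H x)"
  unfolding has_weak_grad_def
proof (intro allI impI)
  fix \<phi> i assume \<phi>: "test_fun \<Omega> \<phi>"
  have sm: "L2 \<Omega> \<phi>" "L2 \<Omega> (pd i \<phi>)"
    using L2_smooth[OF \<Omega>] test_fun_smooth[OF \<phi>] smooth_fun_pd by blast+
  then have "integrable (lebesgue_on \<Omega>) (\<lambda>x. q x * pd i \<phi> x)" "integrable (lebesgue_on \<Omega>) (\<lambda>x. r x * pd i \<phi> x)"
    "integrable (lebesgue_on \<Omega>) (\<lambda>x. G x $ i * \<phi> x)" "integrable (lebesgue_on \<Omega>) (\<lambda>x. H x $ i * \<phi> x)"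
    using q G by (auto intro: L2_mult_integrable L2v_component)
  moreover have "oint \<Omega> (\<lambda>x. q x * pd i \<phi> x) = - oint \<Omega> (\<lambda>x. G x $ i * \<phi> x)"
    "oint \<Omega> (\<lambda>x. r x * pd i \<phi> x) = - oint \<Omega> (\<lambda>x. H x $ i * \<phi> x)"
    using w \<phi> unfolding has_weak_grad_def by blast+
  ultimately show "oint \<Omega> (\<lambda>x. (q x - r x) * pd i \<phi> x) = - oint \<Omega> (\<lambda>x. (G x - H x) $ i * \<phi> x)"
    by (simp add: oint_def left_diff_distrib)
qed

lemma has_weak_div_diff:
  fixes \<Omega> :: "(real^'n) set"
  assumes \<Omega>: "bounded \<Omega>" "open \<Omega>" and v: "L2v \<Omega> v" "L2v \<Omega> w" and g: "L2 \<Omega> g" "L2 \<Omega> h"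
    and d: "has_weak_div \<Omega> v g" "has_weak_div \<Omega> w h"
  shows "has_weak_div \<Omega> (\<lambda>x. v x - w x) (\<lambda>x. g x - h x)"
  unfolding has_weak_div_def
proof (intro allI impI)
  fix \<phi> assume \<phi>: "test_fun \<Omega> \<phi>"
  have sm: "L2 \<Omega> \<phi>" "L2v \<Omega> (grad \<phi>)"
    using L2_smooth[OF \<Omega>] L2v_grad[OF \<Omega>] test_fun_smooth[OF \<phi>] by blast+
  then have "integrable (lebesgue_on \<Omega>) (\<lambda>x. v x \<bullet> grad \<phi> x)" "integrable (lebesgue_on \<Omega>) (\<lambda>x. w x \<bullet> grad \<phi> x)"
    "integrable (lebesgue_on \<Omega>) (\<lambda>x. g x * \<phi> x)" "integrable (lebesgue_on \<Omega>) (\<lambda>x. h x * \<phi> x)"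
    using v g by (auto intro: L2_mult_integrable L2v_inner_integrable)
  moreover have "oint \<Omega> (\<lambda>x. v x \<bullet> grad \<phi> x) = - oint \<Omega> (\<lambda>x. g x * \<phi> x)"
    "oint \<Omega> (\<lambda>x. w x \<bullet> grad \<phi> x) = - oint \<Omega> (\<lambda>x. h x * \<phi> x)"
    using d \<phi> unfolding has_weak_div_def by blast+
  ultimately show "oint \<Omega> (\<lambda>x. (v x - w x) \<bullet> grad \<phi> x) = - oint \<Omega> (\<lambda>x. (g x - h x) * \<phi> x)"
    by (simp add: oint_def left_diff_distrib inner_diff_left)
qed

lemma has_weak_curl_diff:
  fixes \<Omega> :: "(real^'n) set"
  assumes \<Omega>: "bounded \<Omega>" "open \<Omega>" and v: "L2v \<Omega> v" "L2v \<Omega> w"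
    and g: "\<And>i j. L2 \<Omega> (\<lambda>x. V x i j)" "\<And>i j. L2 \<Omega> (\<lambda>x. W x i j)"
    and d: "has_weak_curl \<Omega> v V" "has_weak_curl \<Omega> w W"
  shows "has_weak_curl \<Omega> (\<lambda>x. v x - w x) (\<lambda>x i j. V x i j - W x i j)"
  unfolding has_weak_curl_def
proof (intro allI impI)
  fix \<phi> i j assume \<phi>: "test_fun \<Omega> \<phi>"
  have sm: "L2 \<Omega> \<phi>" "L2 \<Omega> (pd i \<phi>)" "L2 \<Omega> (pd j \<phi>)"
    using L2_smooth[OF \<Omega>] test_fun_smooth[OF \<phi>] smooth_fun_pd by blast+
  then have "integrable (lebesgue_on \<Omega>) (\<lambda>x. V x i j * \<phi> x)" "integrable (lebesgue_on \<Omega>) (\<lambda>x. W x i j * \<phi> x)"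
    "integrable (lebesgue_on \<Omega>) (\<lambda>x. v x $ j * pd i \<phi> x)" "integrable (lebesgue_on \<Omega>) (\<lambda>x. v x $ i * pd j \<phi> x)"
    "integrable (lebesgue_on \<Omega>) (\<lambda>x. w x $ j * pd i \<phi> x)" "integrable (lebesgue_on \<Omega>) (\<lambda>x. w x $ i * pd j \<phi> x)"
    using v g by (auto intro: L2_mult_integrable L2v_component)
  moreover have "oint \<Omega> (\<lambda>x. V x i j * \<phi> x) = - oint \<Omega> (\<lambda>x. v x $ j * pd i \<phi> x - v x $ i * pd j \<phi> x)"
    "oint \<Omega> (\<lambda>x. W x i j * \<phi> x) = - oint \<Omega> (\<lambda>x. w x $ j * pd i \<phi> x - w x $ i * pd j \<phi> x)"
    using d \<phi> unfolding has_weak_curl_def by blast+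
  ultimately show "oint \<Omega> (\<lambda>x. (V x i j - W x i j) * \<phi> x)
      = - oint \<Omega> (\<lambda>x. (v x - w x) $ j * pd i \<phi> x - (v x - w x) $ i * pd j \<phi> x)"
    by (simp add: oint_def left_diff_distrib)
qed

section \<open>Translation estimates and local Poincare inequalities\<close>

locale bounded_open =
  fixes \<Omega> :: "(real^'n) set"
  assumes bdd: "bounded \<Omega>" and op: "open \<Omega>"
begin

lemma smooth_integrable: "smooth_fun f \<Longrightarrow> integrable (lebesgue_on \<Omega>) f"
  by (rule L2_integrable[OF bdd op L2_smooth[OF bdd op]])

lemma indicator_smooth_integrable:
  assumes "A \<in> sets borel" "smooth_fun f"
  shows "integrable (lebesgue_on \<Omega>) (\<lambda>x. indicator A x * f x)"
proof (rule Bochner_Integration.integrable_bound[OF smooth_integrable[OF assms(2)]])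
  show "(\<lambda>x. indicator A x * f x) \<in> borel_measurable (lebesgue_on \<Omega>)"
  proof (rule borel_measurable_lebesgue_on)
    note [measurable] = assms(1) smooth_fun_borel_measurable[OF assms(2)]
    show "(\<lambda>x. indicator A x * f x) \<in> borel_measurable borel" by measurable
  qed
qed (auto simp: indicator_def)

lemma lborel_integrable_if:
  fixes f :: "real^'n \<Rightarrow> real"
  assumes "f \<in> borel_measurable borel" "integrable (lebesgue_on \<Omega>) f" "\<And>x. x \<notin> \<Omega> \<Longrightarrow> f x = 0"
  shows "integrable lborel f"
proof -
  have "integrable lebesgue (\<lambda>x. if x \<in> \<Omega> then f x else 0)"
    using assms(2) op Lebesgue_Measure.integrable_restrict_UNIV[of \<Omega> f] by simp
  also have "(\<lambda>x. if x \<in> \<Omega> then f x else 0) = f" using assms(3) by auto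
  finally show ?thesis using assms(1) integrable_completion[of f lborel] by simp
qed

text \<open>The substitution x + h moves A into B; nonnegativity of F permits enlarging the set, and
  the majorant H enlarges the integrand in the same step.\<close>

lemma oint_shift_le:
  assumes A: "A \<in> sets borel" "A \<subseteq> \<Omega>" and B: "B \<in> sets borel" "B \<subseteq> \<Omega>"
    and AB: "\<And>x. x \<in> A \<Longrightarrow> x + h \<in> B"
    and F: "smooth_fun F" "\<And>x. F x \<ge> 0" "smooth_fun H" "\<And>x. F x \<le> H x"
  shows "oint \<Omega> (\<lambda>x. indicator A x * F (x + h)) \<le> oint \<Omega> (\<lambda>x. indicator B x * H x)"
proof -
  note [measurable] = A(1) B(1) smooth_fun_borel_measurable[OF F(1)] smooth_fun_borel_measurable[OF F(3)]
  have "oint \<Omega> (\<lambda>x. indicator A x * F (x + h)) = (LINT x|lborel. indicator A x * F (x + h))"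
    by (rule oint_eq_lborel[OF op]) (use A in \<open>auto simp: indicator_def\<close>)
  also have "\<dots> = (LINT x|lborel. (\<lambda>y. indicator A (y - h) * F y) (x + h))" by simp
  also have "\<dots> = (LINT x|lborel. indicator A (x - h) * F x)"
    by (rule lborel_integral_shift) measurable
  also have "\<dots> \<le> (LINT x|lborel. indicator B x * H x)"
  proof (rule integral_mono')
    show "integrable lborel (\<lambda>x. indicator B x * H x)"
      by (rule lborel_integrable_if[OF _ indicator_smooth_integrable[OF B(1) F(3)]]) (use B in \<open>auto simp: indicator_def\<close>)
    show "indicator A (x - h) * F x \<le> indicator B x * H x" for x
      using AB[of "x - h"] F(2,4)[of x] by (auto simp: indicator_def intro: order_trans)
    show "0 \<le> indicator B x * H x" for x using F(2,4)[of x] by (auto simp: indicator_def intro: order_trans)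
  qed
  also have "\<dots> = oint \<Omega> (\<lambda>x. indicator B x * H x)"
    by (rule oint_eq_lborel[OF op, symmetric]) (use B in \<open>auto simp: indicator_def\<close>)
  finally show ?thesis .
qed

text \<open>Cauchy-Schwarz on [0,1] in variance form: the increment is the mean of the directional
  derivative over the segment, and the integral of its squared deviation from the mean is
  nonnegative.\<close>

lemma square_le_line_integral:
  assumes \<phi>: "smooth_fun \<phi>"
  shows "(\<phi> (x + h) - \<phi> x)\<^sup>2 \<le> (LINT s|lborel. indicator {0..1} s * (grad \<phi> (x + s *\<^sub>R h) \<bullet> h)\<^sup>2)"
proof -
  let ?g = "\<lambda>s. grad \<phi> (x + s *\<^sub>R h) \<bullet> h"
  let ?m = "\<phi> (x + h) - \<phi> x"
  have "continuous_on {0..1} (\<lambda>s. grad \<phi> (x + s *\<^sub>R h))"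
    by (rule continuous_on_compose2[OF continuous_on_grad[OF \<phi>, of UNIV]]) (auto intro!: continuous_intros)
  then have c: "continuous_on {0..1} ?g" by (intro continuous_intros)
  have int: "integrable lborel (\<lambda>s. indicator {0..1} s * k s)" if "continuous_on {0..1} k" for k :: "real \<Rightarrow> real"
    using borel_integrable_atLeastAtMost'[OF that] by (simp add: set_integrable_def)
  have i1: "integrable lborel (\<lambda>s. indicator {0..1} s * (?g s)\<^sup>2)"
    by (rule int) (intro continuous_intros c)
  have i2: "integrable lborel (\<lambda>s. indicator {0..1} s * ?g s)"
    by (rule int) (intro continuous_intros c)
  have i3: "integrable lborel (\<lambda>s. indicator {0..1::real} s * ?m\<^sup>2)"
    by (rule int) (intro continuous_intros)
  have "0 \<le> (LINT s|lborel. indicator {0..1} s * (?g s - ?m)\<^sup>2)"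
    by (intro Bochner_Integration.integral_nonneg) auto
  also have "(\<lambda>s. indicator {0..1} s * (?g s - ?m)\<^sup>2)
      = (\<lambda>s. indicator {0..1} s * (?g s)\<^sup>2 - 2 * ?m * (indicator {0..1} s * ?g s) + indicator {0..1} s * ?m\<^sup>2)"
    by (simp add: fun_eq_iff power2_eq_square algebra_simps)
  also have "(LINT s|lborel. \<dots> s) = (LINT s|lborel. indicator {0..1} s * (?g s)\<^sup>2)
      - 2 * ?m * (LINT s|lborel. indicator {0..1} s * ?g s) + (LINT s|lborel. indicator {0..1::real} s * ?m\<^sup>2)"
    using i1 i2 i3 by (subst Bochner_Integration.integral_add, simp, simp, subst Bochner_Integration.integral_diff) auto
  also have "(LINT s|lborel. indicator {0..1} s * ?g s) = ?m"
    by (rule smooth_fun_line_integral'[OF \<phi>])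
  also have "(LINT s|lborel. indicator {0..1::real} s * ?m\<^sup>2) = ?m\<^sup>2" by simp
  finally have "0 \<le> (LINT s|lborel. indicator {0..1} s * (?g s)\<^sup>2) - 2 * ?m * ?m + ?m\<^sup>2" .
  moreover have "2 * ?m * ?m = 2 * ?m\<^sup>2" by (simp add: power2_eq_square)
  ultimately show ?thesis by linarith
qed

text \<open>The squared increment is bounded by the integral of the squared directional derivative
  along the segment. After Fubini, each fixed s is a translation of A by s h that stays in \<Omega>,
  so the full Dirichlet integral dominates it.\<close>

lemma translation_estimate:
  assumes \<phi>: "smooth_fun \<phi>" and A: "A \<in> sets borel" "A \<subseteq> \<Omega>"
    and seg: "\<And>x s. x \<in> A \<Longrightarrow> s \<in> {0..1} \<Longrightarrow> x + s *\<^sub>R h \<in> \<Omega>"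
  shows "oint \<Omega> (\<lambda>x. indicator A x * (\<phi> (x + h) - \<phi> x)\<^sup>2) \<le> (norm h)\<^sup>2 * oint \<Omega> (\<lambda>x. grad \<phi> x \<bullet> grad \<phi> x)"
proof -
  let ?D = "oint \<Omega> (\<lambda>x. grad \<phi> x \<bullet> grad \<phi> x)"
  let ?G = "\<lambda>x s. (grad \<phi> (x + s *\<^sub>R h) \<bullet> h)\<^sup>2"
  obtain K where K: "\<And>x s. x \<in> \<Omega> \<Longrightarrow> s \<in> {0..1} \<Longrightarrow> \<bar>grad \<phi> (x + s *\<^sub>R h) \<bullet> h\<bar> \<le> K"
    using grad_line_bounded[OF \<phi> bdd] by blast
  have K2: "\<bar>?G x s\<bar> \<le> K\<^sup>2" if "x \<in> \<Omega>" "s \<in> {0..1}" for x s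
    using power_mono[OF K[OF that], of 2] by simp
  have Gc: "continuous_on UNIV (\<lambda>z. ?G (fst z) (snd z))"
    by (intro continuous_intros continuous_on_grad_line \<phi>)
  have indA: "integrable (lebesgue_on \<Omega>) (indicator A :: _ \<Rightarrow> real)"
    using indicator_smooth_integrable[OF A(1) smooth_fun_const[of 1]] by simp
  note Fub = oint_line_Fubini[OF bdd op indA Gc K2]
  have "oint \<Omega> (\<lambda>x. indicator A x * (\<phi> (x + h) - \<phi> x)\<^sup>2)
      \<le> oint \<Omega> (\<lambda>x. indicator A x * (LINT s|lborel. indicator {0..1} s * ?G x s))"
  proof (rule oint_mono[OF _ Fub(2)])
    show "integrable (lebesgue_on \<Omega>) (\<lambda>x. indicator A x * (\<phi> (x + h) - \<phi> x)\<^sup>2)"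
      by (rule indicator_smooth_integrable[OF A(1) smooth_fun_power2[OF smooth_fun_diff[OF smooth_fun_shift[OF \<phi>] \<phi>]]])
    show "indicator A x * (\<phi> (x + h) - \<phi> x)\<^sup>2 \<le> indicator A x * (LINT s|lborel. indicator {0..1} s * ?G x s)" for x
      using square_le_line_integral[OF \<phi>, of x h] by (intro mult_left_mono) auto
  qed
  also have "\<dots> = (LINT s|lborel. indicator {0..1} s * oint \<Omega> (\<lambda>x. indicator A x * ?G x s))"
    by (rule Fub(1))
  also have "\<dots> \<le> (LINT s|lborel. indicator {0..1::real} s * ((norm h)\<^sup>2 * ?D))"
  proof (rule integral_mono)
    show "indicator {0..1} s * oint \<Omega> (\<lambda>x. indicator A x * ?G x s) \<le> indicator {0..1} s * ((norm h)\<^sup>2 * ?D)" for s :: real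
    proof (cases "s \<in> {0..1}")
      case True
      have sq: "(grad \<phi> x \<bullet> h)\<^sup>2 \<le> (norm h)\<^sup>2 * (grad \<phi> x \<bullet> grad \<phi> x)" for x
        using Cauchy_Schwarz_ineq[of "grad \<phi> x" h] by (simp add: power2_norm_eq_inner mult.commute)
      have "oint \<Omega> (\<lambda>x. indicator A x * ?G x s) \<le> oint \<Omega> (\<lambda>x. indicator \<Omega> x * ((norm h)\<^sup>2 * (grad \<phi> x \<bullet> grad \<phi> x)))"
        by (rule oint_shift_le[OF A, of \<Omega> "s *\<^sub>R h" "\<lambda>y. (grad \<phi> y \<bullet> h)\<^sup>2"])
           (use op seg[OF _ True] sq in \<open>auto intro: smooth_fun_power2[OF smooth_fun_grad_inner[OF \<phi>]]
              smooth_fun_cmult[OF smooth_fun_grad_square[OF \<phi>]]\<close>)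
      also have "\<dots> = oint \<Omega> (\<lambda>x. (norm h)\<^sup>2 * (grad \<phi> x \<bullet> grad \<phi> x))" by (rule oint_cong) simp
      also have "\<dots> = (norm h)\<^sup>2 * ?D" by (simp add: oint_def)
      finally show ?thesis by (auto intro!: mult_left_mono)
    qed simp
  qed (use Fub(3) in auto)
  also have "\<dots> = (norm h)\<^sup>2 * ?D" by simp
  finally show ?thesis .
qed

text \<open>The gradient is integrated over all of \<Omega> and not over A, so that segments used to
  compare values may leave A and the property can be translated and glued. C is uniform in \<phi>,
  while c depends on \<phi>.\<close>

definition poincare_on :: "(real^'n) set \<Rightarrow> bool" where
  "poincare_on A \<longleftrightarrow> A \<in> sets borel \<and> A \<subseteq> \<Omega> \<and> (\<exists>C\<ge>0. \<forall>\<phi>. smooth_fun \<phi> \<longrightarrow>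
     (\<exists>c. oint \<Omega> (\<lambda>x. indicator A x * (\<phi> x - c)\<^sup>2) \<le> C * oint \<Omega> (\<lambda>x. grad \<phi> x \<bullet> grad \<phi> x)))"

lemma Dirichlet_nonneg: "0 \<le> oint \<Omega> (\<lambda>x. grad \<phi> x \<bullet> grad \<phi> x)"
  by (simp add: oint_def)

lemma smooth_fun_diff_square: "smooth_fun \<phi> \<Longrightarrow> smooth_fun (\<lambda>x. (\<phi> x - c)\<^sup>2)"
  by (rule smooth_fun_power2[OF smooth_fun_diff[OF _ smooth_fun_const]])

lemma oint_indicator_pos:
  assumes "open U" "U \<noteq> {}" "U \<subseteq> \<Omega>" shows "oint \<Omega> (indicator U) > 0"
proof -
  have "oint \<Omega> (indicator U) = (LINT x|lborel. indicator U x)"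
    by (rule oint_eq_lborel[OF op]) (use assms in \<open>auto simp: indicator_def\<close>)
  also have "\<dots> = measure lborel U" by simp
  finally have eq: "oint \<Omega> (indicator U) = measure lborel U" .
  have bU: "bounded U" using bdd assms(3) bounded_subset by blast
  have "U \<notin> null_sets lborel"
    using open_not_negligible[OF assms(1,2)] assms(1)
    by (metis borel_open emeasure_lborel_countable negligible_iff_null_sets null_sets_completionI)
  then have "emeasure lborel U \<noteq> 0" using assms(1) by (auto simp: null_sets_def)
  moreover have "emeasure lborel U < \<infinity>" by (rule emeasure_bounded_finite[OF bU])
  ultimately show ?thesis unfolding eq by (simp add: measure_def enn2real_positive_iff zero_less_iff_neq_zero)
qed

text \<open>On U the function is close to both constants a and b, which bounds (a - b)^2 by the
  Dirichlet integral over the measure of U; then a can serve on B too.\<close>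

lemma poincare_on_Un:
  assumes "poincare_on A" "poincare_on B" "open U" "U \<noteq> {}" "U \<subseteq> A \<inter> B"
  shows "poincare_on (A \<union> B)"
proof -
  let ?D = "\<lambda>\<phi>. oint \<Omega> (\<lambda>x. grad \<phi> x \<bullet> grad \<phi> x)"
  obtain C1 where C1: "C1 \<ge> 0" "\<And>\<phi>. smooth_fun \<phi> \<Longrightarrow>
     \<exists>c. oint \<Omega> (\<lambda>x. indicator A x * (\<phi> x - c)\<^sup>2) \<le> C1 * ?D \<phi>"
    and A: "A \<in> sets borel" "A \<subseteq> \<Omega>"
    using assms(1) unfolding poincare_on_def by blast
  obtain C2 where C2: "C2 \<ge> 0" "\<And>\<phi>. smooth_fun \<phi> \<Longrightarrow>
     \<exists>c. oint \<Omega> (\<lambda>x. indicator B x * (\<phi> x - c)\<^sup>2) \<le> C2 * ?D \<phi>"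
    and B: "B \<in> sets borel" "B \<subseteq> \<Omega>"
    using assms(2) unfolding poincare_on_def by blast
  define m where "m = oint \<Omega> (indicator U)"
  have m: "m > 0" unfolding m_def using assms A by (intro oint_indicator_pos) auto
  define V where "V = oint \<Omega> (\<lambda>x. 1)"
  have V: "V \<ge> 0" by (simp add: V_def oint_def)
  \<comment> \<open>\<open>C1\<close> pays for A and \<open>2 * C2\<close> for B. The last term is 2
    (a - b)^2 integrated over \<Omega>, where (a - b)^2 is at most (2 C1 + 2 C2) / m times the
    Dirichlet integral.\<close>
  define C where "C = C1 + 2 * C2 + 2 * V * ((2 * C1 + 2 * C2) / m)"
  have "C \<ge> 0" using C1(1) C2(1) m V by (simp add: C_def)
  moreover have "\<exists>c. oint \<Omega> (\<lambda>x. indicator (A \<union> B) x * (\<phi> x - c)\<^sup>2) \<le> C * ?D \<phi>"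
    if \<phi>: "smooth_fun \<phi>" for \<phi>
  proof -
    obtain a where a: "oint \<Omega> (\<lambda>x. indicator A x * (\<phi> x - a)\<^sup>2) \<le> C1 * ?D \<phi>" using C1(2)[OF \<phi>] by blast
    obtain b where b: "oint \<Omega> (\<lambda>x. indicator B x * (\<phi> x - b)\<^sup>2) \<le> C2 * ?D \<phi>" using C2(2)[OF \<phi>] by blast
    have iA: "integrable (lebesgue_on \<Omega>) (\<lambda>x. indicator A x * (\<phi> x - a)\<^sup>2)"
      by (rule indicator_smooth_integrable[OF A(1) smooth_fun_diff_square[OF \<phi>]])
    have iB: "integrable (lebesgue_on \<Omega>) (\<lambda>x. indicator B x * (\<phi> x - b)\<^sup>2)"
      by (rule indicator_smooth_integrable[OF B(1) smooth_fun_diff_square[OF \<phi>]])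
    have iAB: "integrable (lebesgue_on \<Omega>) (\<lambda>x. indicator (A \<union> B) x * (\<phi> x - a)\<^sup>2)"
      by (rule indicator_smooth_integrable[OF _ smooth_fun_diff_square[OF \<phi>]]) (use A B in auto)
    have iU: "integrable (lebesgue_on \<Omega>) (\<lambda>x. indicator U x * (a - b)\<^sup>2)"
      by (rule indicator_smooth_integrable[OF _ smooth_fun_const]) (use assms in auto)
    have i1: "integrable (lebesgue_on \<Omega>) (\<lambda>x. c)" for c :: real
      by (rule smooth_integrable[OF smooth_fun_const])
    have sq: "(a - b)\<^sup>2 \<le> 2 * (t - a)\<^sup>2 + 2 * (t - b)\<^sup>2" for t
      using zero_le_power2[of "(t - a) + (t - b)"] by (simp add: power2_eq_square algebra_simps)
    have sq2: "(t - a)\<^sup>2 \<le> 2 * (t - b)\<^sup>2 + 2 * (a - b)\<^sup>2" for t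
      using zero_le_power2[of "(t - b) + (a - b)"] by (simp add: power2_eq_square algebra_simps)
    have "m * (a - b)\<^sup>2 = oint \<Omega> (\<lambda>x. indicator U x * (a - b)\<^sup>2)" by (simp add: m_def oint_def)
    also have "\<dots> \<le> oint \<Omega> (\<lambda>x. 2 * (indicator A x * (\<phi> x - a)\<^sup>2) + 2 * (indicator B x * (\<phi> x - b)\<^sup>2))"
    proof (rule oint_mono[OF iU])
      show "integrable (lebesgue_on \<Omega>) (\<lambda>x. 2 * (indicator A x * (\<phi> x - a)\<^sup>2) + 2 * (indicator B x * (\<phi> x - b)\<^sup>2))"
        by (intro Bochner_Integration.integrable_add integrable_mult_right iA iB)
    qed (use assms(5) sq in \<open>auto simp: indicator_def\<close>)
    also have "\<dots> = 2 * oint \<Omega> (\<lambda>x. indicator A x * (\<phi> x - a)\<^sup>2) + 2 * oint \<Omega> (\<lambda>x. indicator B x * (\<phi> x - b)\<^sup>2)"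
      using iA iB by (simp add: oint_def)
    also have "\<dots> \<le> (2 * C1 + 2 * C2) * ?D \<phi>" using a b by (simp add: algebra_simps)
    finally have ab: "(a - b)\<^sup>2 \<le> (2 * C1 + 2 * C2) / m * ?D \<phi>" using m by (simp add: field_simps)
    have "oint \<Omega> (\<lambda>x. indicator (A \<union> B) x * (\<phi> x - a)\<^sup>2)
        \<le> oint \<Omega> (\<lambda>x. indicator A x * (\<phi> x - a)\<^sup>2 + 2 * (indicator B x * (\<phi> x - b)\<^sup>2) + 2 * (a - b)\<^sup>2)"
    proof (rule oint_mono[OF iAB])
      show "integrable (lebesgue_on \<Omega>) (\<lambda>x. indicator A x * (\<phi> x - a)\<^sup>2 + 2 * (indicator B x * (\<phi> x - b)\<^sup>2) + 2 * (a - b)\<^sup>2)"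
        by (intro Bochner_Integration.integrable_add integrable_mult_right iA iB i1)
      show "indicator (A \<union> B) x * (\<phi> x - a)\<^sup>2
          \<le> indicator A x * (\<phi> x - a)\<^sup>2 + 2 * (indicator B x * (\<phi> x - b)\<^sup>2) + 2 * (a - b)\<^sup>2" for x
        using sq2[of "\<phi> x"] by (auto simp: indicator_def add_increasing2)
    qed
    also have "\<dots> = oint \<Omega> (\<lambda>x. indicator A x * (\<phi> x - a)\<^sup>2) + 2 * oint \<Omega> (\<lambda>x. indicator B x * (\<phi> x - b)\<^sup>2) + V * (2 * (a - b)\<^sup>2)"
      using iA iB i1 by (simp add: oint_def V_def)
    also have "\<dots> \<le> C1 * ?D \<phi> + 2 * (C2 * ?D \<phi>) + V * (2 * ((2 * C1 + 2 * C2) / m * ?D \<phi>))"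
      by (intro add_mono mult_left_mono a b ab V) auto
    also have "\<dots> = C * ?D \<phi>" by (simp add: C_def algebra_simps)
    finally show ?thesis by blast
  qed
  ultimately show ?thesis unfolding poincare_on_def using A B by blast
qed

text \<open>On A, the value at x is compared with that at x + h by the translation estimate, and the
  latter with the constant belonging to B. The factors 2 come from (s + t)^2 \<le> 2 s^2 + 2
  t^2.\<close>

lemma poincare_on_translate:
  assumes B: "poincare_on B" and A: "A \<in> sets borel" "A \<subseteq> \<Omega>"
    and seg: "\<And>x s. x \<in> A \<Longrightarrow> s \<in> {0..1} \<Longrightarrow> x + s *\<^sub>R h \<in> \<Omega>" and AB: "\<And>x. x \<in> A \<Longrightarrow> x + h \<in> B"
  shows "poincare_on A"
proof -
  let ?D = "\<lambda>\<phi>. oint \<Omega> (\<lambda>x. grad \<phi> x \<bullet> grad \<phi> x)"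
  obtain C where C: "C \<ge> 0" "\<And>\<phi>. smooth_fun \<phi> \<Longrightarrow>
     \<exists>c. oint \<Omega> (\<lambda>x. indicator B x * (\<phi> x - c)\<^sup>2) \<le> C * ?D \<phi>"
    and B': "B \<in> sets borel" "B \<subseteq> \<Omega>"
    using B unfolding poincare_on_def by blast
  have "\<exists>c. oint \<Omega> (\<lambda>x. indicator A x * (\<phi> x - c)\<^sup>2) \<le> (2 * (norm h)\<^sup>2 + 2 * C) * ?D \<phi>" if \<phi>: "smooth_fun \<phi>" for \<phi>
  proof -
    obtain c where c: "oint \<Omega> (\<lambda>x. indicator B x * (\<phi> x - c)\<^sup>2) \<le> C * ?D \<phi>" using C(2)[OF \<phi>] by blast
    have sm: "smooth_fun (\<lambda>x. (\<phi> (x + h) - \<phi> x)\<^sup>2)" "smooth_fun (\<lambda>x. (\<phi> (x + h) - c)\<^sup>2)"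
      by (rule smooth_fun_power2[OF smooth_fun_diff[OF smooth_fun_shift[OF \<phi>] \<phi>]])
         (rule smooth_fun_diff_square[OF smooth_fun_shift[OF \<phi>]])
    note i = indicator_smooth_integrable[OF A(1) sm(1)] indicator_smooth_integrable[OF A(1) sm(2)]
    have sq: "(t - c)\<^sup>2 \<le> 2 * (u - t)\<^sup>2 + 2 * (u - c)\<^sup>2" for t u
      using zero_le_power2[of "(u - t) + (u - c)"] by (simp add: power2_eq_square algebra_simps)
    have "oint \<Omega> (\<lambda>x. indicator A x * (\<phi> x - c)\<^sup>2)
        \<le> oint \<Omega> (\<lambda>x. 2 * (indicator A x * (\<phi> (x + h) - \<phi> x)\<^sup>2) + 2 * (indicator A x * (\<phi> (x + h) - c)\<^sup>2))"
    proof (rule oint_mono[OF indicator_smooth_integrable[OF A(1) smooth_fun_diff_square[OF \<phi>]]])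
      show "integrable (lebesgue_on \<Omega>) (\<lambda>x. 2 * (indicator A x * (\<phi> (x + h) - \<phi> x)\<^sup>2) + 2 * (indicator A x * (\<phi> (x + h) - c)\<^sup>2))"
        by (intro Bochner_Integration.integrable_add integrable_mult_right i)
    qed (use sq in \<open>auto simp: indicator_def\<close>)
    also have "\<dots> = 2 * oint \<Omega> (\<lambda>x. indicator A x * (\<phi> (x + h) - \<phi> x)\<^sup>2) + 2 * oint \<Omega> (\<lambda>x. indicator A x * (\<phi> (x + h) - c)\<^sup>2)"
      using i by (simp add: oint_def)
    also have "oint \<Omega> (\<lambda>x. indicator A x * (\<phi> (x + h) - c)\<^sup>2) \<le> oint \<Omega> (\<lambda>x. indicator B x * (\<phi> x - c)\<^sup>2)"
      by (rule oint_shift_le[OF A B' AB, where F="\<lambda>x. (\<phi> x - c)\<^sup>2"]) (auto intro: smooth_fun_diff_square[OF \<phi>])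
    also have "\<dots> \<le> C * ?D \<phi>" by (rule c)
    also have "oint \<Omega> (\<lambda>x. indicator A x * (\<phi> (x + h) - \<phi> x)\<^sup>2) \<le> (norm h)\<^sup>2 * ?D \<phi>"
      by (rule translation_estimate[OF \<phi> A seg])
    finally have "oint \<Omega> (\<lambda>x. indicator A x * (\<phi> x - c)\<^sup>2) \<le> 2 * ((norm h)\<^sup>2 * ?D \<phi>) + 2 * (C * ?D \<phi>)" by simp
    then show ?thesis by (intro exI[of _ c]) (simp add: algebra_simps)
  qed
  moreover have "0 \<le> 2 * (norm h)\<^sup>2 + 2 * C" using C(1) by simp
  ultimately show ?thesis unfolding poincare_on_def using A by blast
qed

section \<open>The Poincare inequality on Lipschitz domains\<close>

text \<open>Integrating (\<phi> x - \<phi> y)^2 over K twice and putting x = y + h gives an integral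
  over h of squared increments, each controlled by the translation estimate because convexity keeps
  the segments in K. For some y the inner integral is at most its average, and \<phi> y is the
  constant.\<close>

lemma poincare_on_convex:
  assumes K: "convex K" "open K" "K \<noteq> {}" "K \<subseteq> \<Omega>"
  shows "poincare_on K"
proof -
  let ?D = "\<lambda>\<phi>. oint \<Omega> (\<lambda>x. grad \<phi> x \<bullet> grad \<phi> x)"
  have Kb[measurable]: "K \<in> sets borel" using K(2) by simp
  obtain \<rho> where \<rho>: "\<rho> > 0" "\<And>x. x \<in> K \<Longrightarrow> norm x \<le> \<rho>"
    using bounded_subset[OF bdd K(4)] by (auto simp: bounded_pos)
  \<comment> \<open>Two points of K differ by a vector h of norm at most \<open>2 * \<rho>\<close>:
    the first factor bounds |h|^2, the second is the volume of the ball of such h.\<close>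
  define C0 where "C0 = (2 * \<rho>)\<^sup>2 * measure lborel (cball (0::real^'n) (2 * \<rho>))"
  define m where "m = measure lborel K"
  have em: "emeasure lborel K = ennreal m"
    unfolding m_def using emeasure_bounded_finite[OF bounded_subset[OF bdd K(4)]]
    by (intro emeasure_eq_ennreal_measure) auto
  have "oint \<Omega> (indicator K) = (LINT x|lborel. indicator K x)"
    by (rule oint_eq_lborel[OF op]) (use K in \<open>auto simp: indicator_def\<close>)
  then have "oint \<Omega> (indicator K) = m" by (simp add: m_def)
  with oint_indicator_pos[OF K(2-4)] have m: "m > 0" by simp
  have "C0 \<ge> 0" by (simp add: C0_def)
  have "\<exists>c. oint \<Omega> (\<lambda>x. indicator K x * (\<phi> x - c)\<^sup>2) \<le> (C0 / m) * ?D \<phi>" if \<phi>: "smooth_fun \<phi>" for \<phi>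
  proof -
    note [measurable] = smooth_fun_borel_measurable[OF \<phi>]
    \<comment> \<open>With values in the extended nonnegative reals, the integrals can be exchanged
      without an integrability condition.\<close>
    define E where "E = (\<lambda>y x. ennreal (indicator K x * (\<phi> x - \<phi> y)\<^sup>2))"
    have oE: "(\<integral>\<^sup>+x. E y x \<partial>lborel) = ennreal (oint \<Omega> (\<lambda>x. indicator K x * (\<phi> x - \<phi> y)\<^sup>2))" for y
    proof -
      have z: "indicator K x * (\<phi> x - \<phi> y)\<^sup>2 = 0" if "x \<notin> \<Omega>" for x using that K by (auto simp: indicator_def)
      have "integrable lborel (\<lambda>x. indicator K x * (\<phi> x - \<phi> y)\<^sup>2)"
        by (rule lborel_integrable_if[OF _ indicator_smooth_integrable[OF Kb smooth_fun_diff_square[OF \<phi>]] z]) measurable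
      then have "(\<integral>\<^sup>+x. E y x \<partial>lborel) = ennreal (LINT x|lborel. indicator K x * (\<phi> x - \<phi> y)\<^sup>2)"
        unfolding E_def by (rule nn_integral_eq_integral) simp
      also have "(LINT x|lborel. indicator K x * (\<phi> x - \<phi> y)\<^sup>2) = oint \<Omega> (\<lambda>x. indicator K x * (\<phi> x - \<phi> y)\<^sup>2)"
        by (rule oint_eq_lborel[OF op _ z, symmetric]) measurable
      finally show ?thesis .
    qed
    have shift: "(\<integral>\<^sup>+x. E y x \<partial>lborel) = (\<integral>\<^sup>+h. E y (y + h) \<partial>lborel)" for y
    proof -
      have "(\<integral>\<^sup>+x. E y x \<partial>lborel) = (\<integral>\<^sup>+x. E y x \<partial>distr lborel borel ((+) y))"
        by (simp add: lborel_distr_plus)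
      also have "\<dots> = (\<integral>\<^sup>+h. E y (y + h) \<partial>lborel)"
        unfolding E_def by (subst nn_integral_distr) auto
      finally show ?thesis .
    qed
    have step: "(\<integral>\<^sup>+y. indicator K y * E y (y + h) \<partial>lborel) \<le> ennreal ((2 * \<rho>)\<^sup>2 * ?D \<phi>) * indicator (cball 0 (2 * \<rho>)) h" for h
    proof -
      \<comment> \<open>The points y for which y and y + h both lie in K.\<close>
      define A where "A = K \<inter> (\<lambda>x. x + h) -` K"
      have A[measurable]: "A \<in> sets borel" unfolding A_def
        using Kb by (intro sets.Int) (auto simp: measurable_sets_borel[of "\<lambda>x. x + h" borel])
      have AO: "A \<subseteq> \<Omega>" using K by (auto simp: A_def)
      have seg: "x + s *\<^sub>R h \<in> \<Omega>" if "x \<in> A" "s \<in> {0..1}" for x s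
      proof -
        have "(1 - s) *\<^sub>R x + s *\<^sub>R (x + h) \<in> K" using that by (intro convexD[OF K(1)]) (auto simp: A_def)
        then show ?thesis using K by (auto simp: algebra_simps)
      qed
      have eq: "indicator K y * E y (y + h) = ennreal (indicator A y * (\<phi> (y + h) - \<phi> y)\<^sup>2)" for y
        by (auto simp: E_def A_def indicator_def)
      have z: "indicator A x * (\<phi> (x + h) - \<phi> x)\<^sup>2 = 0" if "x \<notin> \<Omega>" for x using that AO by (auto simp: indicator_def)
      have sm: "smooth_fun (\<lambda>x. (\<phi> (x + h) - \<phi> x)\<^sup>2)"
        by (rule smooth_fun_power2[OF smooth_fun_diff[OF smooth_fun_shift[OF \<phi>] \<phi>]])
      have "integrable lborel (\<lambda>x. indicator A x * (\<phi> (x + h) - \<phi> x)\<^sup>2)"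
        by (rule lborel_integrable_if[OF _ indicator_smooth_integrable[OF A sm] z]) measurable
      then have "(\<integral>\<^sup>+y. indicator K y * E y (y + h) \<partial>lborel) = ennreal (LINT x|lborel. indicator A x * (\<phi> (x + h) - \<phi> x)\<^sup>2)"
        unfolding eq by (rule nn_integral_eq_integral) simp
      also have "(LINT x|lborel. indicator A x * (\<phi> (x + h) - \<phi> x)\<^sup>2) = oint \<Omega> (\<lambda>x. indicator A x * (\<phi> (x + h) - \<phi> x)\<^sup>2)"
        by (rule oint_eq_lborel[OF op _ z, symmetric]) measurable
      finally have I: "(\<integral>\<^sup>+y. indicator K y * E y (y + h) \<partial>lborel) = ennreal (oint \<Omega> (\<lambda>x. indicator A x * (\<phi> (x + h) - \<phi> x)\<^sup>2))" .
      show ?thesis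
      proof (cases "norm h \<le> 2 * \<rho>")
        case True
        have "oint \<Omega> (\<lambda>x. indicator A x * (\<phi> (x + h) - \<phi> x)\<^sup>2) \<le> (norm h)\<^sup>2 * ?D \<phi>"
          by (rule translation_estimate[OF \<phi> A AO seg])
        also have "\<dots> \<le> (2 * \<rho>)\<^sup>2 * ?D \<phi>"
          using True by (intro mult_right_mono power_mono Dirichlet_nonneg) auto
        finally show ?thesis using True by (simp add: I ennreal_leI)
      next
        case False
        have "A = {}"
        proof (rule ccontr)
          assume "A \<noteq> {}"
          then obtain x where "x \<in> K" "x + h \<in> K" by (auto simp: A_def)
          then have "norm h \<le> 2 * \<rho>"
            using \<rho>(2)[of x] \<rho>(2)[of "x + h"] norm_triangle_ineq4[of "x + h" x] by simp
          with False show False by simp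
        qed
        then show ?thesis by (simp add: I oint_def)
      qed
    qed
    have [measurable]: "(\<lambda>(y, h). indicator K y * E y (y + h)) \<in> borel_measurable (lborel \<Otimes>\<^sub>M lborel)"
      unfolding E_def by measurable
    have Em: "(\<lambda>y. \<integral>\<^sup>+x. E y x \<partial>lborel) \<in> borel_measurable lborel"
      unfolding E_def by measurable
    have "(\<integral>\<^sup>+y. indicator K y * (\<integral>\<^sup>+x. E y x \<partial>lborel) \<partial>lborel)
        = (\<integral>\<^sup>+y. \<integral>\<^sup>+h. indicator K y * E y (y + h) \<partial>lborel \<partial>lborel)"
      unfolding shift by (intro nn_integral_cong nn_integral_cmult[symmetric]) (simp add: E_def)
    also have "\<dots> = (\<integral>\<^sup>+h. \<integral>\<^sup>+y. indicator K y * E y (y + h) \<partial>lborel \<partial>lborel)"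
      by (rule lborel_pair.Fubini') measurable
    also have "\<dots> \<le> (\<integral>\<^sup>+h. ennreal ((2 * \<rho>)\<^sup>2 * ?D \<phi>) * indicator (cball (0::real^'n) (2 * \<rho>)) h \<partial>lborel)"
      by (intro nn_integral_mono step)
    also have "\<dots> = ennreal ((2 * \<rho>)\<^sup>2 * ?D \<phi>) * emeasure lborel (cball (0::real^'n) (2 * \<rho>))"
      by (simp add: nn_integral_cmult_indicator)
    also have "emeasure lborel (cball (0::real^'n) (2 * \<rho>)) = ennreal (measure lborel (cball (0::real^'n) (2 * \<rho>)))"
      using emeasure_bounded_finite[OF bounded_cball[of "0::real^'n" "2 * \<rho>"]]
      by (intro emeasure_eq_ennreal_measure) auto
    also have "ennreal ((2 * \<rho>)\<^sup>2 * ?D \<phi>) * \<dots> = ennreal (C0 * ?D \<phi>)"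
      unfolding C0_def using Dirichlet_nonneg[of \<phi>] by (subst ennreal_mult[symmetric]) (auto simp: algebra_simps)
    finally have main: "(\<integral>\<^sup>+y. indicator K y * (\<integral>\<^sup>+x. E y x \<partial>lborel) \<partial>lborel) \<le> ennreal (C0 * ?D \<phi>)" .
    \<comment> \<open>If every y in K exceeded the average, integrating over K, which has measure
      \<open>m > 0\<close>, would give strictly more than \<open>C0\<close> times the Dirichlet
      integral.\<close>
    have "\<exists>y\<in>K. (\<integral>\<^sup>+x. E y x \<partial>lborel) \<le> ennreal ((C0 / m) * ?D \<phi>)"
    proof (rule ccontr)
      assume "\<not> ?thesis"
      then have less: "ennreal ((C0 / m) * ?D \<phi>) < (\<integral>\<^sup>+x. E y x \<partial>lborel)" if "y \<in> K" for y
        using that by (auto simp: not_le)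
      have K_eq: "(\<integral>\<^sup>+y. ennreal ((C0 / m) * ?D \<phi>) * indicator K y \<partial>lborel) = ennreal (C0 * ?D \<phi>)"
        using m \<open>C0 \<ge> 0\<close> Dirichlet_nonneg[of \<phi>]
        by (simp add: nn_integral_cmult_indicator em ennreal_mult[symmetric])
      have "(\<integral>\<^sup>+y. ennreal ((C0 / m) * ?D \<phi>) * indicator K y \<partial>lborel)
          < (\<integral>\<^sup>+y. indicator K y * (\<integral>\<^sup>+x. E y x \<partial>lborel) \<partial>lborel)"
      proof (rule nn_integral_less)
        show "(\<lambda>y. indicator K y * (\<integral>\<^sup>+x. E y x \<partial>lborel)) \<in> borel_measurable lborel"
          using Em by measurable
        show "(\<integral>\<^sup>+y. ennreal ((C0 / m) * ?D \<phi>) * indicator K y \<partial>lborel) \<noteq> \<infinity>"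
          unfolding K_eq by simp
        show "AE y in lborel. ennreal ((C0 / m) * ?D \<phi>) * indicator K y \<le> indicator K y * (\<integral>\<^sup>+x. E y x \<partial>lborel)"
          using less by (intro AE_I2) (auto simp: indicator_def less_imp_le)
        show "\<not> (AE y in lborel. indicator K y * (\<integral>\<^sup>+x. E y x \<partial>lborel) \<le> ennreal ((C0 / m) * ?D \<phi>) * indicator K y)"
        proof
          assume "AE y in lborel. indicator K y * (\<integral>\<^sup>+x. E y x \<partial>lborel) \<le> ennreal ((C0 / m) * ?D \<phi>) * indicator K y"
          then have "AE y in lborel. y \<notin> K"
            by eventually_elim (use less in \<open>force simp: indicator_def\<close>)
          then have "emeasure lborel K = 0" by (subst (asm) AE_iff_measurable[of K]) auto
          then show False using em m by simp
        qed
      qed measurable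
      with main K_eq show False by simp
    qed
    then obtain y where "(\<integral>\<^sup>+x. E y x \<partial>lborel) \<le> ennreal ((C0 / m) * ?D \<phi>)" by blast
    then have "oint \<Omega> (\<lambda>x. indicator K x * (\<phi> x - \<phi> y)\<^sup>2) \<le> (C0 / m) * ?D \<phi>"
      unfolding oE using m \<open>C0 \<ge> 0\<close> Dirichlet_nonneg[of \<phi>] by (subst (asm) ennreal_le_iff) auto
    then show ?thesis by blast
  qed
  moreover have "C0 / m \<ge> 0" using m \<open>C0 \<ge> 0\<close> by simp
  ultimately show ?thesis unfolding poincare_on_def using Kb K(4) by blast
qed

text \<open>Near a boundary point, \<open>\<Omega>\<close> is pushed by a fixed vector \<open>- h e\<close> into a ball inside \<open>\<Omega>\<close>,
  along segments that stay below the graph.\<close>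

lemma poincare_near_frontier:
  assumes "lipschitz_boundary \<Omega>" and x: "x \<in> frontier \<Omega>"
  shows "\<exists>\<delta>>0. poincare_on (\<Omega> \<inter> ball x \<delta>)"
proof -
  obtain r e g L where r: "r > 0" "norm e = 1" and L: "\<And>a b. \<bar>g a - g b\<bar> \<le> L * norm (a - b)"
    and graph: "\<Omega> \<inter> ball x r = {y \<in> ball x r. y \<bullet> e < g (y - (y \<bullet> e) *\<^sub>R e)}"
    using assms unfolding lipschitz_boundary_def by meson
  \<comment> \<open>P is the orthogonal projection onto the complement of e; it does not increase
    distances and is constant along the direction of the push.\<close>
  define P where "P y = y - (y \<bullet> e) *\<^sub>R e" for y
  \<comment> \<open>The boundary description does not fix the sign of L; the absolute value is still
    a Lipschitz constant and makes 1 + M positive.\<close>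
  define M where "M = \<bar>L\<bar>"
  have M: "M \<ge> 0" "\<bar>g a - g b\<bar> \<le> M * norm (a - b)" for a b
    unfolding M_def using L[of a b] mult_right_mono[OF abs_ge_self[of L] norm_ge_zero[of "a - b"]] by auto
  have ee: "e \<bullet> e = 1" using r(2) by (simp add: norm_eq_1)
  have in_iff: "y \<in> \<Omega> \<longleftrightarrow> y \<bullet> e < g (P y)" if "y \<in> ball x r" for y
    using graph that unfolding P_def by blast
  have P_shift: "P (y - t *\<^sub>R e) = P y" for y t
    by (simp add: P_def inner_diff_left ee algebra_simps)
  have P_dist: "norm (P y - P z) \<le> norm (y - z)" for y z
  proof -
    have "P y - P z = (y - z) - ((y - z) \<bullet> e) *\<^sub>R e" by (simp add: P_def algebra_simps inner_diff_left)
    moreover have "(norm ((y - z) - ((y - z) \<bullet> e) *\<^sub>R e))\<^sup>2 = (norm (y - z))\<^sup>2 - ((y - z) \<bullet> e)\<^sup>2"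
      unfolding power2_norm_eq_inner
      by (simp add: inner_diff_left inner_diff_right inner_commute ee power2_eq_square algebra_simps)
    ultimately have "(norm (P y - P z))\<^sup>2 \<le> (norm (y - z))\<^sup>2" by simp
    then show ?thesis by (rule power2_le_imp_le) simp
  qed
  \<comment> \<open>Points of \<Omega> accumulate at x and lie below the graph. If x lay above it,
    the gap \<open>x \<bullet> e - g (P x)\<close> would have to close over an arbitrarily small
    distance d, but it can shrink by at most (1 + M) d.\<close>
  have xe: "x \<bullet> e \<le> g (P x)"
  proof (rule ccontr)
    assume neg: "\<not> x \<bullet> e \<le> g (P x)"
    define t where "t = min (r / 2) ((x \<bullet> e - g (P x)) / (2 * (1 + M)))"
    have t: "t > 0" using neg r M by (simp add: t_def)
    obtain y where y: "y \<in> \<Omega>" "dist y x < t"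
      using x t by (auto simp: frontier_def closure_approachable)
    then have "y \<in> ball x r" using r by (auto simp: t_def dist_commute)
    then have "y \<bullet> e < g (P y)" using in_iff y by blast
    moreover have "g (P y) \<le> g (P x) + M * dist y x"
      using M(2)[of "P y" "P x"] P_dist[of y x] mult_left_mono[OF P_dist[of y x] M(1)] by (simp add: dist_norm)
    moreover have "x \<bullet> e \<le> y \<bullet> e + dist y x"
      using Cauchy_Schwarz_ineq2[of "x - y" e] r(2) by (simp add: inner_diff_left dist_norm norm_minus_commute)
    ultimately have "x \<bullet> e - g (P x) < (1 + M) * dist y x" by (simp add: algebra_simps)
    also have "\<dots> \<le> (1 + M) * t" using y(2) M by (intro mult_left_mono) auto
    also have "\<dots> \<le> (1 + M) * ((x \<bullet> e - g (P x)) / (2 * (1 + M)))"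
      using M by (intro mult_left_mono) (auto simp: t_def)
    also have "\<dots> = (x \<bullet> e - g (P x)) / 2" using M by (simp add: field_simps)
    finally show False using neg by simp
  qed
  \<comment> \<open>The two choices give (1 + M) \<delta> = h/2: moving x by less than \<delta>
    raises the height relative to the graph by at most h/2, while the push lowers it by h. With h =
    r/2 all points involved stay in \<open>ball x r\<close>.\<close>
  define h where "h = r / 2"
  define \<delta> where "\<delta> = h / (2 * (1 + M))"
  have h: "h > 0" using r by (simp add: h_def)
  have \<delta>: "\<delta> > 0" using h M by (simp add: \<delta>_def)
  have \<delta>h: "(1 + M) * \<delta> = h / 2" using M by (simp add: \<delta>_def field_simps)
  have \<delta>2: "\<delta> \<le> h / 2" using \<delta>h mult_nonneg_nonneg[OF M(1), of \<delta>] \<delta> by (simp add: algebra_simps)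
  have ballB: "ball (x - h *\<^sub>R e) \<delta> \<subseteq> \<Omega>"
  proof
    fix z assume z: "z \<in> ball (x - h *\<^sub>R e) \<delta>"
    define w where "w = z + h *\<^sub>R e"
    have w: "norm (w - x) < \<delta>" using z by (simp add: w_def dist_norm norm_minus_commute algebra_simps)
    have "norm (z - x) \<le> norm (w - x) + norm (h *\<^sub>R e)"
      using norm_triangle_ineq4[of "w - x" "h *\<^sub>R e"] by (simp add: w_def algebra_simps)
    then have "norm (z - x) < r" using w \<delta>2 h r(2) by (simp add: h_def)
    then have zr: "z \<in> ball x r" by (simp add: dist_norm norm_minus_commute)
    have "z \<bullet> e = w \<bullet> e - h" by (simp add: w_def inner_add_left ee)
    moreover have "w \<bullet> e \<le> x \<bullet> e + norm (w - x)"
      using Cauchy_Schwarz_ineq2[of "w - x" e] r(2) by (simp add: inner_diff_left)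
    moreover have "g (P z) = g (P w)" using P_shift[of w h] by (simp add: w_def)
    moreover have "g (P x) \<le> g (P w) + M * norm (w - x)"
      using M(2)[of "P w" "P x"] mult_left_mono[OF P_dist[of w x] M(1)] by simp
    moreover have "(1 + M) * norm (w - x) \<le> (1 + M) * \<delta>" using w M by (intro mult_left_mono) auto
    then have "norm (w - x) + M * norm (w - x) \<le> h / 2" using \<delta>h by (simp add: algebra_simps)
    ultimately have "z \<bullet> e < g (P z)" using xe h by linarith
    then show "z \<in> \<Omega>" using in_iff[OF zr] by simp
  qed
  have "poincare_on (\<Omega> \<inter> ball x \<delta>)"
  proof (rule poincare_on_translate[where h="- h *\<^sub>R e"])
    show "poincare_on (ball (x - h *\<^sub>R e) \<delta>)"
      using \<delta> ballB by (intro poincare_on_convex) auto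
    show "\<Omega> \<inter> ball x \<delta> \<in> sets borel" using op by auto
    show "\<Omega> \<inter> ball x \<delta> \<subseteq> \<Omega>" by blast
    show "y + - h *\<^sub>R e \<in> ball (x - h *\<^sub>R e) \<delta>" if "y \<in> \<Omega> \<inter> ball x \<delta>" for y
      using that by (simp add: dist_norm algebra_simps)
    show "y + s *\<^sub>R (- h *\<^sub>R e) \<in> \<Omega>" if y: "y \<in> \<Omega> \<inter> ball x \<delta>" and s: "s \<in> {0..1}" for y s
    proof -
      let ?z = "y - (s * h) *\<^sub>R e"
      have yr: "y \<in> ball x r" using y \<delta>2 h by (simp add: h_def)
      have "norm (?z - x) \<le> norm (y - x) + norm ((s * h) *\<^sub>R e)"
        using norm_triangle_ineq4[of "y - x" "(s * h) *\<^sub>R e"] by (simp add: algebra_simps)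
      also have "norm ((s * h) *\<^sub>R e) \<le> h" using s h r(2) by (simp add: mult_left_le_one_le)
      also have "norm (y - x) < \<delta>" using y by (simp add: dist_norm norm_minus_commute)
      finally have zr: "?z \<in> ball x r" using \<delta>2 h by (simp add: h_def dist_norm norm_minus_commute)
      have "?z \<bullet> e \<le> y \<bullet> e" using s h by (simp add: inner_diff_left ee)
      also have "\<dots> < g (P y)" using in_iff[OF yr] y by simp
      also have "\<dots> = g (P ?z)" by (simp add: P_shift)
      finally show ?thesis using in_iff[OF zr] by simp
    qed
  qed
  with \<delta> show ?thesis by blast
qed

lemma poincare_locally:
  assumes "lipschitz_boundary \<Omega>" "x \<in> closure \<Omega>"
  shows "\<exists>\<delta>>0. poincare_on (\<Omega> \<inter> ball x \<delta>)"
proof (cases "x \<in> \<Omega>")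
  case True
  obtain \<delta> where \<delta>: "\<delta> > 0" "ball x \<delta> \<subseteq> \<Omega>" by (rule openE[OF op True])
  then have "poincare_on (ball x \<delta>)" by (intro poincare_on_convex) auto
  moreover have "\<Omega> \<inter> ball x \<delta> = ball x \<delta>" using \<delta> by blast
  ultimately show ?thesis using \<delta> by auto
next
  case False
  then have "x \<in> frontier \<Omega>" using assms(2) op by (simp add: frontier_def interior_open)
  then show ?thesis by (rule poincare_near_frontier[OF assms(1)])
qed

text \<open>A maximal subfamily whose union satisfies the inequality is the whole family: otherwise
  connectedness makes a further member meet its union in a nonempty open set, and
  \<open>poincare_on_Un\<close> enlarges it.\<close>

lemma poincare_finite_cover:
  assumes con: "connected \<Omega>" and \<F>: "finite \<F>" "\<Union>\<F> = \<Omega>" "\<F> \<noteq> {}"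
    and U: "\<And>U. U \<in> \<F> \<Longrightarrow> open U \<and> U \<noteq> {} \<and> poincare_on U"
  shows "poincare_on \<Omega>"
proof -
  define good where "good \<S> \<longleftrightarrow> \<S> \<subseteq> \<F> \<and> \<S> \<noteq> {} \<and> poincare_on (\<Union>\<S>)" for \<S>
  obtain U0 where "U0 \<in> \<F>" using \<F>(3) by blast
  then have "good {U0}" using U by (simp add: good_def)
  moreover have "finite {\<S>. good \<S>}"
    by (rule finite_subset[of _ "Pow \<F>"]) (use \<F>(1) in \<open>auto simp: good_def\<close>)
  ultimately obtain \<S> where \<S>: "good \<S>" "\<And>\<T>. good \<T> \<Longrightarrow> \<S> \<subseteq> \<T> \<Longrightarrow> \<S> = \<T>"
    using finite_has_maximal[of "{\<S>. good \<S>}"] by blast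
  have "\<S> = \<F>"
  proof (rule ccontr)
    assume "\<S> \<noteq> \<F>"
    then have sub: "\<S> \<subseteq> \<F>" "\<S> \<noteq> {}" "\<F> - \<S> \<noteq> {}" using \<S>(1) by (auto simp: good_def)
    have "\<Union>\<S> \<inter> \<Union>(\<F> - \<S>) = {}"
    proof (rule ccontr)
      assume "\<Union>\<S> \<inter> \<Union>(\<F> - \<S>) \<noteq> {}"
      then obtain V where V: "V \<in> \<F> - \<S>" "\<Union>\<S> \<inter> V \<noteq> {}" by blast
      have "poincare_on (\<Union>\<S> \<union> V)"
      proof (rule poincare_on_Un)
        show "open (\<Union>\<S> \<inter> V)" using V U sub by (intro open_Int open_Union) auto
      qed (use V U \<S>(1) in \<open>auto simp: good_def\<close>)
      moreover have "\<Union>(insert V \<S>) = \<Union>\<S> \<union> V" by auto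
      ultimately have "good (insert V \<S>)" using \<S>(1) V by (simp add: good_def)
      then have "\<S> = insert V \<S>" by (rule \<S>(2)) blast
      then show False using V by blast
    qed
    moreover have "\<Union>\<S> \<union> \<Union>(\<F> - \<S>) = \<Omega>" using sub \<F>(2) by blast
    moreover have "open (\<Union>\<S>)" "open (\<Union>(\<F> - \<S>))" using U sub by (auto intro!: open_Union)
    moreover have "\<Union>\<S> \<noteq> {}" "\<Union>(\<F> - \<S>) \<noteq> {}" using U sub by blast+
    ultimately show False
      using connectedD[OF con, of "\<Union>\<S>" "\<Union>(\<F> - \<S>)"] by auto
  qed
  then show ?thesis using \<S>(1) \<F>(2) by (simp add: good_def)
qed

lemma poincare_on_domain:
  assumes "connected \<Omega>" "lipschitz_boundary \<Omega>" shows "poincare_on \<Omega>"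
proof (cases "\<Omega> = {}")
  case True
  then have "oint \<Omega> g = 0" for g by (simp add: oint_def)
  then show ?thesis unfolding poincare_on_def using op by auto
next
  case False
  obtain \<delta> where \<delta>: "\<And>x. x \<in> closure \<Omega> \<Longrightarrow> \<delta> x > 0 \<and> poincare_on (\<Omega> \<inter> ball x (\<delta> x))"
    using poincare_locally[OF assms(2)] by metis
  have "compact (closure \<Omega>)" using bdd by simp
  moreover have "closure \<Omega> \<subseteq> (\<Union>x\<in>closure \<Omega>. ball x (\<delta> x))" using \<delta> by force
  ultimately obtain X where X: "X \<subseteq> closure \<Omega>" "finite X" "closure \<Omega> \<subseteq> (\<Union>x\<in>X. ball x (\<delta> x))"
    using compactE_image[of "closure \<Omega>" "closure \<Omega>" "\<lambda>x. ball x (\<delta> x)"] by blast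
  define \<F> where "\<F> = (\<lambda>x. \<Omega> \<inter> ball x (\<delta> x)) ` X"
  have nonempty: "\<Omega> \<inter> ball x (\<delta> x) \<noteq> {}" if "x \<in> X" for x
  proof -
    have "x \<in> closure \<Omega>" "\<delta> x > 0" using that X \<delta> by auto
    then obtain y where "y \<in> \<Omega>" "dist y x < \<delta> x" by (meson closure_approachable)
    then show ?thesis by (auto simp: dist_commute)
  qed
  have cover: "\<Union>\<F> = \<Omega>" using X(3) closure_subset[of \<Omega>] by (auto simp: \<F>_def)
  show ?thesis
  proof (rule poincare_finite_cover[OF assms(1) _ cover])
    show "finite \<F>" using X(2) by (simp add: \<F>_def)
    show "\<F> \<noteq> {}" using cover False by auto
    show "open U \<and> U \<noteq> {} \<and> poincare_on U" if "U \<in> \<F>" for U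
      using that nonempty \<delta> X(1) op by (auto simp: \<F>_def)
  qed
qed

end

section \<open>Minimizing sequences and choice of weak derivatives\<close>

text \<open>Here \<open>comb t x y\<close> stands for \<open>x + t y\<close>: the lemma is applied to functions \<open>real^'n \<Rightarrow> real\<close>,
  whose type is not an instance of \<^class>\<open>real_vector\<close>.\<close>

lemma minimizing_sequence:
  fixes a :: "'v \<Rightarrow> 'v \<Rightarrow> real" and l :: "'v \<Rightarrow> real" and comb :: "real \<Rightarrow> 'v \<Rightarrow> 'v \<Rightarrow> 'v"
  assumes S: "z \<in> S" "\<And>t x y. x \<in> S \<Longrightarrow> y \<in> S \<Longrightarrow> comb t x y \<in> S"
    and a_comb: "\<And>t x y w. x \<in> S \<Longrightarrow> y \<in> S \<Longrightarrow> w \<in> S \<Longrightarrow> a (comb t x y) w = a x w + t * a y w"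
    and a_sym: "\<And>x y. a x y = a y x" and a_nonneg: "\<And>x. 0 \<le> a x x"
    and l_comb: "\<And>t x y. x \<in> S \<Longrightarrow> y \<in> S \<Longrightarrow> l (comb t x y) = l x + t * l y"
    and l_bound: "\<And>x. x \<in> S \<Longrightarrow> (l x)\<^sup>2 \<le> K * a x x" and K: "K \<ge> 0"
  obtains s where "\<And>n. s n \<in> S"
    "\<And>e. e > 0 \<Longrightarrow> \<exists>N. \<forall>i\<ge>N. \<forall>j\<ge>N. a (comb (- 1) (s i) (s j)) (comb (- 1) (s i) (s j)) < e"
    "\<And>x. x \<in> S \<Longrightarrow> (\<lambda>n. a (s n) x) \<longlonglongrightarrow> l x"
proof -
  \<comment> \<open>The quadratic energy with Euler equation \<open>a x y = l y\<close>.
    Completeness of S is not assumed, so a minimizing sequence replaces a minimizer.\<close>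
  define J where "J x = a x x / 2 - l x" for x
  have J_low: "- K / 2 \<le> J x" if "x \<in> S" for x
  proof -
    \<comment> \<open>Arithmetic-geometric mean: \<open>K * a x x\<close> is at most the square of
      (K + a x x) / 2.\<close>
    have "(l x)\<^sup>2 \<le> ((K + a x x) / 2)\<^sup>2"
      using l_bound[OF that] zero_le_power2[of "K - a x x"] by (simp add: power2_eq_square algebra_simps)
    then have "\<bar>l x\<bar> \<le> \<bar>(K + a x x) / 2\<bar>" by (rule abs_le_square_iff[THEN iffD2])
    then show ?thesis using K a_nonneg[of x] by (simp add: J_def)
  qed
  define m where "m = (INF x\<in>S. J x)"
  have bdd: "bdd_below (J ` S)" using J_low by (intro bdd_belowI2) auto
  have m_le: "m \<le> J x" if "x \<in> S" for x unfolding m_def using that bdd by (intro cINF_lower)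
  have "\<exists>x\<in>S. J x < m + 1 / real (Suc n)" for n
  proof -
    have "m < m + 1 / real (Suc n)" by simp
    then show ?thesis unfolding m_def using S(1) bdd by (subst (asm) cINF_less_iff) auto
  qed
  then obtain s where s: "\<And>n. s n \<in> S" "\<And>n. J (s n) < m + 1 / real (Suc n)" by metis
  \<comment> \<open>Comparing J at \<open>s n\<close> and at \<open>comb t (s n) x\<close> gives a
    quadratic in t that is nonnegative and has constant term 2 / (n + 1); its discriminant bounds
    the residual.\<close>
  have key: "(a (s n) x - l x)\<^sup>2 \<le> 2 / real (Suc n) * a x x" if x: "x \<in> S" for n x
  proof (rule discriminant_le)
    fix t
    have sx: "comb t (s n) x \<in> S" by (rule S(2)[OF s(1) x])
    have "a (comb t (s n) x) (comb t (s n) x) = a (s n) (s n) + 2 * t * a (s n) x + t\<^sup>2 * a x x"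
      using a_comb[OF s(1) x sx] a_comb[OF s(1) x s(1)] a_comb[OF s(1) x x]
      by (simp add: a_sym[of "s n" "comb t (s n) x"] a_sym[of x "comb t (s n) x"] a_sym[of x "s n"]
            power2_eq_square algebra_simps)
    then have "J (comb t (s n) x) = J (s n) + t * (a (s n) x - l x) + t\<^sup>2 * a x x / 2"
      by (simp add: J_def l_comb[OF s(1) x] algebra_simps add_divide_distrib)
    moreover have "m \<le> J (comb t (s n) x)" by (rule m_le[OF sx])
    ultimately show "0 \<le> 2 / real (Suc n) + 2 * t * (a (s n) x - l x) + t\<^sup>2 * a x x"
      using s(2)[of n] by simp
  qed (rule a_nonneg)
  have lim2: "(\<lambda>n. 2 / real (Suc n) * c) \<longlonglongrightarrow> 0" for c :: real
  proof -
    have "(\<lambda>n. 2 * c * inverse (real (Suc n))) \<longlonglongrightarrow> 2 * c * 0"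
      by (intro tendsto_mult tendsto_const LIMSEQ_inverse_real_of_nat)
    then show ?thesis by (simp add: divide_inverse mult_ac)
  qed
  show ?thesis
  proof (rule that[OF s(1)])
    fix x assume x: "x \<in> S"
    have "(\<lambda>n. (a (s n) x - l x)\<^sup>2) \<longlonglongrightarrow> 0"
      by (rule tendsto_sandwich[OF _ _ tendsto_const lim2[of "a x x"]]) (use key[OF x] in auto)
    then have "(\<lambda>n. a (s n) x - l x) \<longlonglongrightarrow> 0" by simp
    then show "(\<lambda>n. a (s n) x) \<longlonglongrightarrow> l x" by (simp add: LIM_zero_iff)
  next
    fix e :: real assume e: "e > 0"
    have "(\<lambda>n. 2 / real (Suc n) * 4) \<longlonglongrightarrow> 0" by (rule lim2)
    \<comment> \<open>The energy of a difference will be at most 4 / (i + 1) + 4 / (j + 1), hence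
      below e once 8 / (n + 1) < e for the indices concerned.\<close>
    then obtain N where N: "\<And>n. n \<ge> N \<Longrightarrow> 2 / real (Suc n) * 4 < e"
      using e by (force dest: order_tendstoD(2) simp: eventually_sequentially)
    have "a (comb (- 1) (s i) (s j)) (comb (- 1) (s i) (s j)) < e" if ij: "i \<ge> N" "j \<ge> N" for i j
    proof -
      let ?x = "comb (- 1) (s i) (s j)"
      have x: "?x \<in> S" by (rule S(2)[OF s(1) s(1)])
      have gen: "(P - Q)\<^sup>2 \<le> 2 * P\<^sup>2 + 2 * Q\<^sup>2" for P Q :: real
        using zero_le_power2[of "P + Q"] by (simp add: power2_eq_square algebra_simps)
      \<comment> \<open>Testing both residuals with the difference itself bounds the square of
        \<open>a ?x ?x\<close> by a small multiple of \<open>a ?x ?x\<close>, and one factor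
        cancels.\<close>
      have eq: "a ?x ?x = (a (s i) ?x - l ?x) - (a (s j) ?x - l ?x)"
        using a_comb[OF s(1) s(1) x, of "- 1" i j] by simp
      have "(a ?x ?x)\<^sup>2 \<le> 2 * (a (s i) ?x - l ?x)\<^sup>2 + 2 * (a (s j) ?x - l ?x)\<^sup>2"
        unfolding eq by (rule gen)
      also have "\<dots> \<le> 2 * (2 / real (Suc i) * a ?x ?x) + 2 * (2 / real (Suc j) * a ?x ?x)"
        by (intro add_mono mult_left_mono key x) auto
      also have "\<dots> = (2 * (2 / real (Suc i)) + 2 * (2 / real (Suc j))) * a ?x ?x"
        by (simp add: algebra_simps)
      finally have sq: "a ?x ?x * a ?x ?x \<le> (2 * (2 / real (Suc i)) + 2 * (2 / real (Suc j))) * a ?x ?x"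
        by (simp add: power2_eq_square)
      show ?thesis
      proof (cases "a ?x ?x = 0")
        case False
        then have "a ?x ?x > 0" using a_nonneg[of ?x] by simp
        then have "a ?x ?x \<le> 2 * (2 / real (Suc i)) + 2 * (2 / real (Suc j))"
          using sq by (simp only: mult_le_cancel_right)
        then show ?thesis using N[OF ij(1)] N[OF ij(2)] by simp
      qed (use e in simp)
    qed
    then show "\<exists>N. \<forall>i\<ge>N. \<forall>j\<ge>N. a (comb (- 1) (s i) (s j)) (comb (- 1) (s i) (s j)) < e" by blast
  qed
qed

section \<open>Independence of the chosen weak derivatives\<close>

context bounded_open begin

text \<open>For two weak derivatives of the same function the test integrals coincide by definition,
  so this is their uniqueness.\<close>

lemma AE_eq_if_same_test_integrals:
  assumes "L2 \<Omega> g" "L2 \<Omega> h"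
    and "\<And>\<phi>. test_fun \<Omega> \<phi> \<Longrightarrow> oint \<Omega> (\<lambda>x. g x * \<phi> x) = oint \<Omega> (\<lambda>x. h x * \<phi> x)"
  shows "AE x in lebesgue_on \<Omega>. g x = h x"
proof -
  have "AE x in lebesgue_on \<Omega>. g x - h x = 0"
  proof (rule AE_eq_0_if_test_orthogonal[OF op])
    show "integrable (lebesgue_on \<Omega>) (\<lambda>x. g x - h x)" by (intro L2_integrable[OF bdd op] L2_diff assms)
    fix \<phi> assume \<phi>: "test_fun \<Omega> \<phi>"
    have "L2 \<Omega> \<phi>" by (rule L2_smooth[OF bdd op test_fun_smooth[OF \<phi>]])
    then show "oint \<Omega> (\<lambda>x. (g x - h x) * \<phi> x) = 0"
      using assms(3)[OF \<phi>] by (simp add: oint_def left_diff_distrib L2_mult_integrable assms(1,2))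
  qed
  then show ?thesis by simp
qed

text \<open>A witness G makes the Hilbert choice meaningful, and testing each component identifies
  the choice with G almost everywhere. A witness constructed by hand, such as a limit of gradients,
  thereby determines \<open>wgrad\<close>; \<open>wdiv\<close> and \<open>wcurl\<close> follow the
  same pattern.\<close>

lemma wgrad:
  assumes "L2v \<Omega> G" "has_weak_grad \<Omega> q G"
  shows "L2v \<Omega> (wgrad \<Omega> q)" "has_weak_grad \<Omega> q (wgrad \<Omega> q)" "AE x in lebesgue_on \<Omega>. wgrad \<Omega> q x = G x"
proof -
  have *: "L2v \<Omega> (wgrad \<Omega> q) \<and> has_weak_grad \<Omega> q (wgrad \<Omega> q)"
    unfolding wgrad_def by (rule someI[of _ G]) (use assms in blast)
  then show "L2v \<Omega> (wgrad \<Omega> q)" "has_weak_grad \<Omega> q (wgrad \<Omega> q)" by auto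
  have "AE x in lebesgue_on \<Omega>. wgrad \<Omega> q x $ i = G x $ i" for i
    by (rule AE_eq_if_same_test_integrals)
       (use * assms in \<open>auto simp: L2v_component has_weak_grad_def\<close>)
  then have "AE x in lebesgue_on \<Omega>. \<forall>i\<in>UNIV. wgrad \<Omega> q x $ i = G x $ i"
    by (intro AE_finite_allI) auto
  then show "AE x in lebesgue_on \<Omega>. wgrad \<Omega> q x = G x" by (simp add: vec_eq_iff)
qed

lemma wdiv:
  assumes "L2 \<Omega> g" "has_weak_div \<Omega> v g"
  shows "L2 \<Omega> (wdiv \<Omega> v)" "has_weak_div \<Omega> v (wdiv \<Omega> v)" "AE x in lebesgue_on \<Omega>. wdiv \<Omega> v x = g x"
proof -
  have *: "L2 \<Omega> (wdiv \<Omega> v) \<and> has_weak_div \<Omega> v (wdiv \<Omega> v)"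
    unfolding wdiv_def by (rule someI[of _ g]) (use assms in blast)
  then show "L2 \<Omega> (wdiv \<Omega> v)" "has_weak_div \<Omega> v (wdiv \<Omega> v)" by auto
  show "AE x in lebesgue_on \<Omega>. wdiv \<Omega> v x = g x"
    by (rule AE_eq_if_same_test_integrals) (use * assms in \<open>auto simp: has_weak_div_def\<close>)
qed

lemma wcurl:
  assumes "\<And>i j. L2 \<Omega> (\<lambda>x. W x i j)" "has_weak_curl \<Omega> w W"
  shows "L2 \<Omega> (\<lambda>x. wcurl \<Omega> w x i j)" "has_weak_curl \<Omega> w (wcurl \<Omega> w)"
    "AE x in lebesgue_on \<Omega>. wcurl \<Omega> w x i j = W x i j"
proof -
  have *: "(\<forall>i j. L2 \<Omega> (\<lambda>x. wcurl \<Omega> w x i j)) \<and> has_weak_curl \<Omega> w (wcurl \<Omega> w)"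
    unfolding wcurl_def by (rule someI[of _ W]) (use assms in blast)
  then show "L2 \<Omega> (\<lambda>x. wcurl \<Omega> w x i j)" "has_weak_curl \<Omega> w (wcurl \<Omega> w)" by auto
  show "AE x in lebesgue_on \<Omega>. wcurl \<Omega> w x i j = W x i j"
    by (rule AE_eq_if_same_test_integrals) (use * assms in \<open>auto simp: has_weak_curl_def\<close>)
qed

lemma inU_wdiv: "inU \<Omega> lam v \<Longrightarrow> L2 \<Omega> (wdiv \<Omega> v)" "inU \<Omega> lam v \<Longrightarrow> has_weak_div \<Omega> v (wdiv \<Omega> v)"
  unfolding inU_def using wdiv by blast+

lemma inU_wcurl:
  "inU \<Omega> lam v \<Longrightarrow> L2 \<Omega> (\<lambda>x. wcurl \<Omega> (\<lambda>x. lam x *\<^sub>R v x) x i j)"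
  "inU \<Omega> lam v \<Longrightarrow> has_weak_curl \<Omega> (\<lambda>x. lam x *\<^sub>R v x) (wcurl \<Omega> (\<lambda>x. lam x *\<^sub>R v x))"
  unfolding inU_def using wcurl by blast+

lemma inP_wgrad: "inP \<Omega> q \<Longrightarrow> L2v \<Omega> (wgrad \<Omega> q)" "inP \<Omega> q \<Longrightarrow> has_weak_grad \<Omega> q (wgrad \<Omega> q)"
  unfolding inP_def using wgrad by blast+

text \<open>For mean zero, the integral of (\<phi> - c)^2 is that of \<phi>^2 plus the integral of
  c^2, so replacing c by 0 only lowers the left side.\<close>

lemma poincare_mean_zero:
  assumes "poincare_on \<Omega>"
  obtains C where "C \<ge> 0" "\<And>\<phi>. smooth_fun \<phi> \<Longrightarrow> oint \<Omega> \<phi> = 0 \<Longrightarrow>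
    oint \<Omega> (\<lambda>x. (\<phi> x)\<^sup>2) \<le> C * oint \<Omega> (\<lambda>x. grad \<phi> x \<bullet> grad \<phi> x)"
proof -
  obtain C where C: "C \<ge> 0" "\<And>\<phi>. smooth_fun \<phi> \<Longrightarrow>
     \<exists>c. oint \<Omega> (\<lambda>x. indicator \<Omega> x * (\<phi> x - c)\<^sup>2) \<le> C * oint \<Omega> (\<lambda>x. grad \<phi> x \<bullet> grad \<phi> x)"
    using assms unfolding poincare_on_def by blast
  have "oint \<Omega> (\<lambda>x. (\<phi> x)\<^sup>2) \<le> C * oint \<Omega> (\<lambda>x. grad \<phi> x \<bullet> grad \<phi> x)"
    if \<phi>: "smooth_fun \<phi>" and z: "oint \<Omega> \<phi> = 0" for \<phi>
  proof -
    obtain c where c: "oint \<Omega> (\<lambda>x. indicator \<Omega> x * (\<phi> x - c)\<^sup>2) \<le> C * oint \<Omega> (\<lambda>x. grad \<phi> x \<bullet> grad \<phi> x)"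
      using C(2)[OF \<phi>] by blast
    have int: "integrable (lebesgue_on \<Omega>) \<phi>" "integrable (lebesgue_on \<Omega>) (\<lambda>x. (\<phi> x)\<^sup>2)"
      "integrable (lebesgue_on \<Omega>) (\<lambda>x. c\<^sup>2)"
      using \<phi> by (auto intro!: smooth_integrable smooth_fun_power2 smooth_fun_const)
    have "oint \<Omega> (\<lambda>x. indicator \<Omega> x * (\<phi> x - c)\<^sup>2) = oint \<Omega> (\<lambda>x. (\<phi> x)\<^sup>2 - 2 * c * \<phi> x + c\<^sup>2)"
      by (rule oint_cong) (simp add: power2_eq_square algebra_simps)
    also have "\<dots> = oint \<Omega> (\<lambda>x. (\<phi> x)\<^sup>2) - 2 * c * oint \<Omega> \<phi> + oint \<Omega> (\<lambda>x. c\<^sup>2)"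
      using int by (simp add: oint_def)
    moreover have "0 \<le> oint \<Omega> (\<lambda>x. c\<^sup>2)" by (simp add: oint_def)
    ultimately show ?thesis using c z by simp
  qed
  with C(1) show ?thesis by (rule that)
qed

end

section \<open>Existence\<close>

locale darcy = bounded_open \<Omega> for \<Omega> :: "(real^'n) set" +
  fixes kap lam f :: "real^'n \<Rightarrow> real" and kmin kmax lmin lmax :: real
  assumes conn: "connected \<Omega>" and lip: "lipschitz_boundary \<Omega>"
    and lam_inv: "\<And>x. x \<in> \<Omega> \<Longrightarrow> lam x = 1 / kap x"
    and lam_cont: "continuous_on \<Omega> lam"
    and kmin: "0 < kmin" and lmin: "0 < lmin"
    and kap_bd: "\<And>x. x \<in> \<Omega> \<Longrightarrow> kmin \<le> kap x \<and> kap x \<le> kmax"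
    and lam_bd: "\<And>x. x \<in> \<Omega> \<Longrightarrow> lmin \<le> lam x \<and> lam x \<le> lmax"
    and f_L2: "L2 \<Omega> f" and f_mean: "oint \<Omega> f = 0"
begin

lemma kap_lam: "x \<in> \<Omega> \<Longrightarrow> kap x * lam x = 1" "x \<in> \<Omega> \<Longrightarrow> lam x * kap x = 1"
  using lam_inv[of x] kap_bd[of x] kmin by auto

lemma lam_measurable [measurable]: "lam \<in> borel_measurable (lebesgue_on \<Omega>)"
  by (rule continuous_imp_measurable_on_sets_lebesgue[OF lam_cont]) (use op in auto)

lemma kap_measurable [measurable]: "kap \<in> borel_measurable (lebesgue_on \<Omega>)"
proof -
  have "(\<lambda>x. 1 / lam x) \<in> borel_measurable (lebesgue_on \<Omega>)" by measurable
  moreover have "1 / lam x = kap x" if "x \<in> space (lebesgue_on \<Omega>)" for x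
    using that kap_lam[of x] by (auto simp: space_restrict_space divide_simps)
  ultimately show ?thesis
    using measurable_cong[of "lebesgue_on \<Omega>" "\<lambda>x. 1 / lam x" kap borel] by blast
qed

lemma kap_abs: "x \<in> \<Omega> \<Longrightarrow> \<bar>kap x\<bar> \<le> kmax" and lam_abs: "x \<in> \<Omega> \<Longrightarrow> \<bar>lam x\<bar> \<le> lmax"
  using kap_bd[of x] lam_bd[of x] kmin lmin by auto

lemma L2v_kap: "L2v \<Omega> v \<Longrightarrow> L2v \<Omega> (\<lambda>x. kap x *\<^sub>R v x)"
  by (rule L2v_bounded_scale[OF kap_measurable kap_abs])

lemma L2v_lam: "L2v \<Omega> v \<Longrightarrow> L2v \<Omega> (\<lambda>x. lam x *\<^sub>R v x)"
  by (rule L2v_bounded_scale[OF lam_measurable lam_abs])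

text \<open>The energy (\<kappa> \<nabla>\<phi>, \<nabla>\<phi>)/2 - (f, \<phi>) is minimized over
  smooth functions of mean zero. The Poincare inequality bounds the load and makes the minimizing
  sequence Cauchy in L2; the lower bound on \<kappa> makes its gradients Cauchy. Function and
  gradient limits are kept as a pair p, G, so that identities between L2 pairings pass to
  it.\<close>

lemma neumann_problem:
  obtains p G where "inP \<Omega> p" "L2v \<Omega> G" "has_weak_grad \<Omega> p G"
    "\<And>\<phi>. smooth_fun \<phi> \<Longrightarrow> oint \<Omega> (\<lambda>x. kap x *\<^sub>R G x \<bullet> grad \<phi> x) = oint \<Omega> (\<lambda>x. f x * \<phi> x)"
    "\<And>v. inU \<Omega> lam v \<Longrightarrow> oint \<Omega> (\<lambda>x. v x \<bullet> G x) + oint \<Omega> (\<lambda>x. wdiv \<Omega> v x * p x) = 0"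
proof -
  let ?D = "\<lambda>\<phi>. oint \<Omega> (\<lambda>x. grad \<phi> x \<bullet> grad \<phi> x)"
  obtain C where C: "C \<ge> 0" "\<And>\<phi>. smooth_fun \<phi> \<Longrightarrow> oint \<Omega> \<phi> = 0 \<Longrightarrow> oint \<Omega> (\<lambda>x. (\<phi> x)\<^sup>2) \<le> C * ?D \<phi>"
    using poincare_mean_zero[OF poincare_on_domain[OF conn lip]] by blast
  define S where "S = {\<phi>. smooth_fun \<phi> \<and> oint \<Omega> \<phi> = 0}"
  define a where "a \<phi> \<psi> = oint \<Omega> (\<lambda>x. kap x *\<^sub>R grad \<phi> x \<bullet> grad \<psi> x)" for \<phi> \<psi>
  define l where "l \<phi> = oint \<Omega> (\<lambda>x. f x * \<phi> x)" for \<phi>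
  define comb :: "real \<Rightarrow> (real^'n \<Rightarrow> real) \<Rightarrow> (real^'n \<Rightarrow> real) \<Rightarrow> real^'n \<Rightarrow> real"
    where "comb t \<phi> \<psi> = (\<lambda>x. \<phi> x + t * \<psi> x)" for t \<phi> \<psi>
  note Lg = L2v_grad[OF bdd op]
  have smooth_comb: "smooth_fun (comb t \<phi> \<psi>)" if "smooth_fun \<phi>" "smooth_fun \<psi>" for t \<phi> \<psi>
    unfolding comb_def by (rule smooth_fun_add[OF that(1) smooth_fun_cmult[OF that(2)]])
  have grad_comb: "grad (comb t \<phi> \<psi>) x = grad \<phi> x + t *\<^sub>R grad \<psi> x" if "smooth_fun \<phi>" "smooth_fun \<psi>" for t \<phi> \<psi> x
    unfolding comb_def by (simp add: grad_add[OF that(1) smooth_fun_cmult[OF that(2)]] grad_cmult[OF that(2)])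
  have D_le_a: "kmin * ?D \<phi> \<le> a \<phi> \<phi>" if "smooth_fun \<phi>" for \<phi>
  proof -
    have "kmin * ?D \<phi> = oint \<Omega> (\<lambda>x. kmin * (grad \<phi> x \<bullet> grad \<phi> x))" by (simp add: oint_def)
    also have "\<dots> \<le> a \<phi> \<phi>"
      unfolding a_def
    proof (rule oint_mono)
      show "integrable (lebesgue_on \<Omega>) (\<lambda>x. kmin * (grad \<phi> x \<bullet> grad \<phi> x))"
        by (intro integrable_mult_right L2v_inner_integrable Lg that)
      show "integrable (lebesgue_on \<Omega>) (\<lambda>x. kap x *\<^sub>R grad \<phi> x \<bullet> grad \<phi> x)"
        by (intro L2v_inner_integrable L2v_kap Lg that)
    qed (use kap_bd in \<open>auto intro: mult_right_mono\<close>)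
    finally show ?thesis .
  qed
  have a_nonneg: "0 \<le> a \<phi> \<phi>" for \<phi>
  proof -
    \<comment> \<open>Nonnegativity is required for arbitrary \<phi>. The absolute value agrees with
      \<open>kap\<close> on \<Omega> and makes the integrand nonnegative everywhere.\<close>
    have "a \<phi> \<phi> = oint \<Omega> (\<lambda>x. \<bar>kap x\<bar> * (grad \<phi> x \<bullet> grad \<phi> x))"
      unfolding a_def by (rule oint_cong) (use kap_bd kmin in force)
    then show ?thesis by (simp add: oint_def)
  qed
  define F where "F = oint \<Omega> (\<lambda>x. (f x)\<^sup>2)"
  have F: "F \<ge> 0" by (simp add: F_def oint_def)
  have sq_le_a: "oint \<Omega> (\<lambda>x. (\<phi> x)\<^sup>2) \<le> C / kmin * a \<phi> \<phi>" if "\<phi> \<in> S" for \<phi>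
  proof -
    have "oint \<Omega> (\<lambda>x. (\<phi> x)\<^sup>2) \<le> C * ?D \<phi>" using that C(2) by (simp add: S_def)
    also have "\<dots> \<le> C * (a \<phi> \<phi> / kmin)"
      using that D_le_a[of \<phi>] kmin C(1) by (intro mult_left_mono) (auto simp: S_def field_simps)
    finally show ?thesis by simp
  qed
  have l_bound: "(l \<phi>)\<^sup>2 \<le> (F * (C / kmin)) * a \<phi> \<phi>" if "\<phi> \<in> S" for \<phi>
  proof -
    have "(l \<phi>)\<^sup>2 \<le> F * oint \<Omega> (\<lambda>x. (\<phi> x)\<^sup>2)"
      unfolding l_def F_def using that by (intro L2_Cauchy_Schwarz f_L2 L2_smooth bdd op) (simp add: S_def)
    also have "\<dots> \<le> F * (C / kmin * a \<phi> \<phi>)" by (intro mult_left_mono sq_le_a that F)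
    finally show ?thesis by (simp add: mult.assoc)
  qed
  have S_comb: "comb t \<phi> \<psi> \<in> S" if "\<phi> \<in> S" "\<psi> \<in> S" for t \<phi> \<psi>
  proof -
    have "integrable (lebesgue_on \<Omega>) \<phi>" "integrable (lebesgue_on \<Omega>) \<psi>"
      using that smooth_integrable by (auto simp: S_def)
    then have "oint \<Omega> (comb t \<phi> \<psi>) = oint \<Omega> \<phi> + t * oint \<Omega> \<psi>"
      unfolding comb_def by (simp add: oint_def)
    then show ?thesis using that smooth_comb by (simp add: S_def)
  qed
  have a_comb: "a (comb t \<phi> \<psi>) \<eta> = a \<phi> \<eta> + t * a \<psi> \<eta>" if "\<phi> \<in> S" "\<psi> \<in> S" "\<eta> \<in> S" for t \<phi> \<psi> \<eta>
  proof -
    have sm: "smooth_fun \<phi>" "smooth_fun \<psi>" "smooth_fun \<eta>" using that by (auto simp: S_def)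
    have i: "integrable (lebesgue_on \<Omega>) (\<lambda>x. kap x *\<^sub>R grad \<phi> x \<bullet> grad \<eta> x)"
      "integrable (lebesgue_on \<Omega>) (\<lambda>x. kap x *\<^sub>R grad \<psi> x \<bullet> grad \<eta> x)"
      by (rule L2v_inner_integrable[OF L2v_kap[OF Lg[OF sm(1)]] Lg[OF sm(3)]],
          rule L2v_inner_integrable[OF L2v_kap[OF Lg[OF sm(2)]] Lg[OF sm(3)]])
    have "a (comb t \<phi> \<psi>) \<eta> = oint \<Omega> (\<lambda>x. kap x *\<^sub>R grad \<phi> x \<bullet> grad \<eta> x + t * (kap x *\<^sub>R grad \<psi> x \<bullet> grad \<eta> x))"
      unfolding a_def by (simp add: grad_comb[OF sm(1,2)] inner_add_left algebra_simps)
    also have "\<dots> = a \<phi> \<eta> + t * a \<psi> \<eta>"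
      using i unfolding a_def oint_def
      by (subst Bochner_Integration.integral_add) (auto simp del: inner_scaleR_left)
    finally show ?thesis .
  qed
  have l_comb: "l (comb t \<phi> \<psi>) = l \<phi> + t * l \<psi>" if "\<phi> \<in> S" "\<psi> \<in> S" for t \<phi> \<psi>
  proof -
    have "integrable (lebesgue_on \<Omega>) (\<lambda>x. f x * \<phi> x)" "integrable (lebesgue_on \<Omega>) (\<lambda>x. f x * \<psi> x)"
      using that by (auto intro!: L2_mult_integrable f_L2 L2_smooth bdd op simp: S_def)
    then show ?thesis unfolding l_def comb_def by (simp add: oint_def distrib_left mult.left_commute)
  qed
  have zero_S: "(\<lambda>x. 0) \<in> S" by (simp add: S_def smooth_fun_const oint_def)
  have a_sym: "a \<phi> \<psi> = a \<psi> \<phi>" for \<phi> \<psi> by (simp add: a_def inner_commute)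
  have "F * (C / kmin) \<ge> 0" using F C(1) kmin by simp
  from minimizing_sequence[of "\<lambda>x. 0" S comb a l, OF zero_S S_comb a_comb a_sym a_nonneg l_comb l_bound this]
  obtain s where s: "\<And>n. s n \<in> S"
    and cau: "\<And>e. e > 0 \<Longrightarrow> \<exists>N. \<forall>i\<ge>N. \<forall>j\<ge>N. a (comb (- 1) (s i) (s j)) (comb (- 1) (s i) (s j)) < e"
    and lim: "\<And>x. x \<in> S \<Longrightarrow> (\<lambda>n. a (s n) x) \<longlonglongrightarrow> l x"
    by blast
  have sm: "smooth_fun (s n)" and mean: "oint \<Omega> (s n) = 0" for n using s[of n] by (auto simp: S_def)
  have sL2: "L2 \<Omega> (s n)" for n by (rule L2_smooth[OF bdd op sm])
  have pdL2: "L2 \<Omega> (pd i (s n))" for i n by (rule L2_smooth[OF bdd op smooth_fun_pd[OF sm]])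
  have "\<exists>p. L2 \<Omega> p \<and> (\<lambda>n. oint \<Omega> (\<lambda>x. (s n x - p x)\<^sup>2)) \<longlonglongrightarrow> 0"
  proof -
    have "\<exists>N. \<forall>i\<ge>N. \<forall>j\<ge>N. oint \<Omega> (\<lambda>x. (s i x - s j x)\<^sup>2) < e" if e: "e > 0" for e
    proof -
      \<comment> \<open>Adding 1 keeps the divisor positive even when C = 0.\<close>
      obtain N where N: "\<forall>i\<ge>N. \<forall>j\<ge>N. a (comb (- 1) (s i) (s j)) (comb (- 1) (s i) (s j)) < e / (C / kmin + 1)"
        using cau[of "e / (C / kmin + 1)"] e C(1) kmin by (auto simp: add_nonneg_pos)
      have "oint \<Omega> (\<lambda>x. (s i x - s j x)\<^sup>2) < e" if ij: "i \<ge> N" "j \<ge> N" for i j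
      proof -
        let ?c = "comb (- 1) (s i) (s j)"
        have "oint \<Omega> (\<lambda>x. (?c x)\<^sup>2) \<le> C / kmin * a ?c ?c" by (rule sq_le_a[OF S_comb[OF s s]])
        also have "\<dots> \<le> (C / kmin + 1) * a ?c ?c" using a_nonneg[of ?c] by (intro mult_right_mono) auto
        also have "\<dots> < (C / kmin + 1) * (e / (C / kmin + 1))"
          using N ij C(1) kmin by (intro mult_strict_left_mono) (auto simp: add_nonneg_pos)
        also have "\<dots> = e"
        proof -
          have "C / kmin + 1 > 0" using C(1) kmin by (simp add: add_nonneg_pos)
          then show ?thesis by simp
        qed
        finally show ?thesis by (simp add: comb_def)
      qed
      then show ?thesis by blast
    qed
    from L2_complete[OF bdd op sL2 this] show ?thesis by blast
  qed
  then obtain p where p: "L2 \<Omega> p" "(\<lambda>n. oint \<Omega> (\<lambda>x. (s n x - p x)\<^sup>2)) \<longlonglongrightarrow> 0" by blast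
  have "\<exists>g. L2 \<Omega> g \<and> (\<lambda>n. oint \<Omega> (\<lambda>x. (pd i (s n) x - g x)\<^sup>2)) \<longlonglongrightarrow> 0" for i
  proof -
    have "\<exists>N. \<forall>m\<ge>N. \<forall>n\<ge>N. oint \<Omega> (\<lambda>x. (pd i (s m) x - pd i (s n) x)\<^sup>2) < e" if e: "e > 0" for e
    proof -
      obtain N where N: "\<forall>i\<ge>N. \<forall>j\<ge>N. a (comb (- 1) (s i) (s j)) (comb (- 1) (s i) (s j)) < kmin * e"
        using cau[of "kmin * e"] e kmin by auto
      have "oint \<Omega> (\<lambda>x. (pd i (s m) x - pd i (s n) x)\<^sup>2) < e" if mn: "m \<ge> N" "n \<ge> N" for m n
      proof -
        let ?c = "comb (- 1) (s m) (s n)"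
        have c: "smooth_fun ?c" by (rule smooth_comb[OF sm sm])
        have "grad ?c x $ i = pd i (s m) x - pd i (s n) x" for x
          unfolding grad_comb[OF sm sm] by (simp add: grad_def)
        then have "oint \<Omega> (\<lambda>x. (pd i (s m) x - pd i (s n) x)\<^sup>2) = oint \<Omega> (\<lambda>x. (grad ?c x $ i)\<^sup>2)" by simp
        also have "\<dots> \<le> ?D ?c"
        proof (rule oint_mono)
          show "integrable (lebesgue_on \<Omega>) (\<lambda>x. (grad ?c x $ i)\<^sup>2)"
            by (rule L2_square_integrable[OF L2v_component[OF Lg[OF c]]])
          show "integrable (lebesgue_on \<Omega>) (\<lambda>x. grad ?c x \<bullet> grad ?c x)" by (intro L2v_inner_integrable Lg c)
          show "(grad ?c x $ i)\<^sup>2 \<le> grad ?c x \<bullet> grad ?c x" for x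
            using power_mono[OF component_le_norm_cart[of "grad ?c x" i], of 2] by (simp add: power2_norm_eq_inner)
        qed
        finally have "kmin * oint \<Omega> (\<lambda>x. (pd i (s m) x - pd i (s n) x)\<^sup>2) \<le> kmin * ?D ?c"
          using kmin by simp
        also have "\<dots> \<le> a ?c ?c" by (rule D_le_a[OF c])
        also have "\<dots> < kmin * e" using N mn by blast
        finally show ?thesis using kmin by simp
      qed
      then show ?thesis by blast
    qed
    from L2_complete[OF bdd op pdL2 this] show ?thesis by blast
  qed
  then have "\<forall>i. \<exists>g. L2 \<Omega> g \<and> (\<lambda>n. oint \<Omega> (\<lambda>x. (pd i (s n) x - g x)\<^sup>2)) \<longlonglongrightarrow> 0" by blast
  then obtain g where "\<forall>i. L2 \<Omega> (g i) \<and> (\<lambda>n. oint \<Omega> (\<lambda>x. (pd i (s n) x - g i x)\<^sup>2)) \<longlonglongrightarrow> 0"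
    by (rule choice[THEN exE])
  then have g: "\<And>i. L2 \<Omega> (g i)" "\<And>i. (\<lambda>n. oint \<Omega> (\<lambda>x. (pd i (s n) x - g i x)\<^sup>2)) \<longlonglongrightarrow> 0" by auto
  define G where "G x = (\<chi> i. g i x)" for x
  have G: "L2v \<Omega> G" using g(1) by (simp add: L2v_def G_def)
  have lim_p: "(\<lambda>n. oint \<Omega> (\<lambda>x. s n x * h x)) \<longlonglongrightarrow> oint \<Omega> (\<lambda>x. p x * h x)" if "L2 \<Omega> h" for h
    by (rule L2_tendsto_oint_mult[OF sL2 p(1) that p(2)])
  have lim_g: "(\<lambda>n. oint \<Omega> (\<lambda>x. pd i (s n) x * h x)) \<longlonglongrightarrow> oint \<Omega> (\<lambda>x. g i x * h x)" if "L2 \<Omega> h" for h i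
    by (rule L2_tendsto_oint_mult[OF pdL2 g(1) that g(2)])
  have lim_G: "(\<lambda>n. oint \<Omega> (\<lambda>x. grad (s n) x \<bullet> w x)) \<longlonglongrightarrow> oint \<Omega> (\<lambda>x. G x \<bullet> w x)" if w: "L2v \<Omega> w" for w
  proof -
    have "(\<lambda>n. \<Sum>i\<in>UNIV. oint \<Omega> (\<lambda>x. pd i (s n) x * w x $ i)) \<longlonglongrightarrow> (\<Sum>i\<in>UNIV. oint \<Omega> (\<lambda>x. g i x * w x $ i))"
      by (intro tendsto_sum lim_g L2v_component w)
    then show ?thesis
      by (simp add: oint_inner_sum[OF Lg[OF sm] w] oint_inner_sum[OF G w]) (simp add: grad_def G_def)
  qed
  have wg: "has_weak_grad \<Omega> p G"
    unfolding has_weak_grad_def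
  proof (intro allI impI)
    fix \<phi> i assume \<phi>: "test_fun \<Omega> \<phi>"
    have L: "L2 \<Omega> \<phi>" "L2 \<Omega> (pd i \<phi>)"
      by (rule L2_smooth[OF bdd op test_fun_smooth[OF \<phi>]], rule L2_smooth[OF bdd op smooth_fun_pd[OF test_fun_smooth[OF \<phi>]]])
    have "oint \<Omega> (\<lambda>x. s n x * pd i \<phi> x) = - oint \<Omega> (\<lambda>x. pd i (s n) x * \<phi> x)" for n
      using has_weak_grad_smooth[OF bdd op sm[of n]] \<phi> by (simp add: has_weak_grad_def grad_def)
    then have "(\<lambda>n. oint \<Omega> (\<lambda>x. s n x * pd i \<phi> x)) \<longlonglongrightarrow> - oint \<Omega> (\<lambda>x. g i x * \<phi> x)"
      using tendsto_minus[OF lim_g[OF L(1), of i]] by simp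
    with lim_p[OF L(2)] show "oint \<Omega> (\<lambda>x. p x * pd i \<phi> x) = - oint \<Omega> (\<lambda>x. G x $ i * \<phi> x)"
      by (simp add: G_def LIMSEQ_unique)
  qed
  have "oint \<Omega> p = 0"
    using lim_p[OF L2_const[OF bdd op, of 1]] by (simp add: mean LIMSEQ_const_iff)
  then have "inP \<Omega> p" using p(1) G wg by (auto simp: inP_def)
  moreover have "oint \<Omega> (\<lambda>x. kap x *\<^sub>R G x \<bullet> grad \<phi> x) = oint \<Omega> (\<lambda>x. f x * \<phi> x)" if \<phi>: "smooth_fun \<phi>" for \<phi>
  proof -
    \<comment> \<open>The limit equation is available for mean-zero functions only. Subtracting the
      mean of \<phi> leaves its gradient unchanged, and also (f, \<phi>), because f has mean
      zero.\<close>
    define c where "c = oint \<Omega> \<phi> / oint \<Omega> (\<lambda>x. 1)"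
    define \<psi> where "\<psi> = (\<lambda>x. \<phi> x + - c)"
    have \<psi>: "smooth_fun \<psi>" unfolding \<psi>_def by (rule smooth_fun_add[OF \<phi> smooth_fun_const])
    have gr: "grad \<psi> x = grad \<phi> x" for x
      unfolding \<psi>_def by (simp only: grad_add[OF \<phi> smooth_fun_const] grad_const add_0_right)
    have i: "integrable (lebesgue_on \<Omega>) \<phi>" "integrable (lebesgue_on \<Omega>) (\<lambda>x. c)" for c :: real
      by (rule smooth_integrable[OF \<phi>], rule smooth_integrable[OF smooth_fun_const])
    \<comment> \<open>If the measure is 0, the quotient defining c is 0 by convention; \<Omega> is
      then empty and the integral of \<phi> is 0 anyway.\<close>
    have "oint \<Omega> \<phi> = 0" if "oint \<Omega> (\<lambda>x. 1) = 0"
    proof -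
      have "\<Omega> = {}"
      proof (rule ccontr)
        assume "\<Omega> \<noteq> {}"
        then have "0 < oint \<Omega> (indicator \<Omega>)" by (intro oint_indicator_pos op) auto
        also have "oint \<Omega> (indicator \<Omega>) = oint \<Omega> (\<lambda>x. 1)" by (rule oint_cong) simp
        finally show False using that by simp
      qed
      then show ?thesis by (simp add: oint_def)
    qed
    moreover have "oint \<Omega> \<psi> = oint \<Omega> \<phi> - c * oint \<Omega> (\<lambda>x. 1)"
      using i by (simp add: \<psi>_def oint_def)
    ultimately have "oint \<Omega> \<psi> = 0" by (cases "oint \<Omega> (\<lambda>x. 1) = 0") (simp_all add: c_def)
    with \<psi> have "\<psi> \<in> S" by (simp add: S_def)
    then have "(\<lambda>n. a (s n) \<psi>) \<longlonglongrightarrow> l \<psi>" by (rule lim)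
    moreover have "(\<lambda>n. a (s n) \<psi>) \<longlonglongrightarrow> oint \<Omega> (\<lambda>x. kap x *\<^sub>R G x \<bullet> grad \<phi> x)"
      using lim_G[OF L2v_kap[OF Lg[OF \<phi>]]] by (simp add: a_def gr)
    ultimately have "oint \<Omega> (\<lambda>x. kap x *\<^sub>R G x \<bullet> grad \<phi> x) = l \<psi>" by (simp add: LIMSEQ_unique)
    also have "l \<psi> = oint \<Omega> (\<lambda>x. f x * \<phi> x) - c * oint \<Omega> f"
    proof -
      have "integrable (lebesgue_on \<Omega>) (\<lambda>x. f x * \<phi> x)" "integrable (lebesgue_on \<Omega>) f"
        by (intro L2_mult_integrable f_L2 L2_smooth[OF bdd op \<phi>] L2_integrable[OF bdd op])+
      then show ?thesis by (simp add: l_def \<psi>_def oint_def right_diff_distrib)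
    qed
    finally show ?thesis by (simp add: f_mean)
  qed
  moreover have "oint \<Omega> (\<lambda>x. v x \<bullet> G x) + oint \<Omega> (\<lambda>x. wdiv \<Omega> v x * p x) = 0" if v: "inU \<Omega> lam v" for v
  proof -
    have L: "L2v \<Omega> v" "L2 \<Omega> (wdiv \<Omega> v)" using v inU_wdiv by (auto simp: inU_def)
    \<comment> \<open>For the smooth \<open>s n\<close> this is the definition of zero normal trace,
      and both summands are L2 pairings that pass to the limit.\<close>
    have "oint \<Omega> (\<lambda>x. grad (s n) x \<bullet> v x) + oint \<Omega> (\<lambda>x. s n x * wdiv \<Omega> v x) = 0" for n
      using v sm[of n] by (simp add: inU_def zero_normal_trace_def inner_commute mult.commute)
    moreover have "(\<lambda>n. oint \<Omega> (\<lambda>x. grad (s n) x \<bullet> v x) + oint \<Omega> (\<lambda>x. s n x * wdiv \<Omega> v x))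
        \<longlonglongrightarrow> oint \<Omega> (\<lambda>x. G x \<bullet> v x) + oint \<Omega> (\<lambda>x. p x * wdiv \<Omega> v x)"
      by (intro tendsto_add lim_G lim_p L)
    ultimately show ?thesis by (simp add: LIMSEQ_const_iff inner_commute mult.commute)
  qed
  ultimately show ?thesis by (intro that[OF _ G wg])
qed

text \<open>The added least-squares terms are consistent: at the Darcy flow the residual \<lambda>u
  + \<nabla>p and the curl vanish, and div u = f turns the divergence term into the data
  term.\<close>

lemma existence:
  obtains u p where "inU \<Omega> lam u" "inP \<Omega> p"
    "\<And>v q. inU \<Omega> lam v \<Longrightarrow> inP \<Omega> q \<Longrightarrow> B_CGLS \<Omega> kap lam u p v q = F_CGLS \<Omega> lam f v q"
proof -
  obtain p G where p: "inP \<Omega> p" and G: "L2v \<Omega> G" "has_weak_grad \<Omega> p G"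
    and neumann: "\<And>\<phi>. smooth_fun \<phi> \<Longrightarrow> oint \<Omega> (\<lambda>x. kap x *\<^sub>R G x \<bullet> grad \<phi> x) = oint \<Omega> (\<lambda>x. f x * \<phi> x)"
    and green: "\<And>v. inU \<Omega> lam v \<Longrightarrow> oint \<Omega> (\<lambda>x. v x \<bullet> G x) + oint \<Omega> (\<lambda>x. wdiv \<Omega> v x * p x) = 0"
    using neumann_problem by blast
  define u where "u x = - (kap x *\<^sub>R G x)" for x
  have uL: "L2v \<Omega> u" unfolding u_def[abs_def] by (intro L2v_uminus L2v_kap G)
  \<comment> \<open>Valid for all smooth \<phi> and not just for test functions, so it encodes both
    div u = f and the zero normal trace.\<close>
  have flux: "oint \<Omega> (\<lambda>x. u x \<bullet> grad \<phi> x) = - oint \<Omega> (\<lambda>x. f x * \<phi> x)" if "smooth_fun \<phi>" for \<phi>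
    using neumann[OF that] by (simp add: u_def oint_def)
  have div: "has_weak_div \<Omega> u f" by (auto simp: has_weak_div_def flux test_fun_smooth)
  note wd = wdiv[OF f_L2 div]
  have lam_u: "lam x *\<^sub>R u x = - G x" if "x \<in> \<Omega>" for x by (simp add: u_def kap_lam[OF that])
  \<comment> \<open>Since \<lambda>u = -G, moving the derivatives back to p leaves the commutator of
    second derivatives of \<phi>. The weak gradient may be tested with \<open>pd i \<phi>\<close>
    and \<open>pd j \<phi>\<close>, which are test functions.\<close>
  have curl: "has_weak_curl \<Omega> (\<lambda>x. lam x *\<^sub>R u x) (\<lambda>x i j. 0)"
    unfolding has_weak_curl_def
  proof (intro allI impI)
    fix \<phi> i j assume \<phi>: "test_fun \<Omega> \<phi>"
    note t = test_fun_pd[OF \<phi>, of i] test_fun_pd[OF \<phi>, of j]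
    have L: "L2 \<Omega> (pd i \<phi>)" "L2 \<Omega> (pd j \<phi>)" using L2_smooth[OF bdd op test_fun_smooth] t by blast+
    have "oint \<Omega> (\<lambda>x. (lam x *\<^sub>R u x) $ j * pd i \<phi> x - (lam x *\<^sub>R u x) $ i * pd j \<phi> x)
        = oint \<Omega> (\<lambda>x. G x $ i * pd j \<phi> x - G x $ j * pd i \<phi> x)"
    proof (rule oint_cong)
      fix x assume "x \<in> \<Omega>"
      then show "(lam x *\<^sub>R u x) $ j * pd i \<phi> x - (lam x *\<^sub>R u x) $ i * pd j \<phi> x = G x $ i * pd j \<phi> x - G x $ j * pd i \<phi> x"
        unfolding lam_u[OF \<open>x \<in> \<Omega>\<close>] by simp
    qed
    also have "\<dots> = oint \<Omega> (\<lambda>x. G x $ i * pd j \<phi> x) - oint \<Omega> (\<lambda>x. G x $ j * pd i \<phi> x)"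
      by (simp add: oint_def L2_mult_integrable L2v_component G L)
    also have "\<dots> = oint \<Omega> (\<lambda>x. p x * pd j (pd i \<phi>) x) - oint \<Omega> (\<lambda>x. p x * pd i (pd j \<phi>) x)"
      using G(2) t unfolding has_weak_grad_def by simp
    also have "\<dots> = 0" by (simp add: pd_commute[OF test_fun_smooth[OF \<phi>], of i j])
    finally show "oint \<Omega> (\<lambda>x. 0 * \<phi> x) = - oint \<Omega> (\<lambda>x. (lam x *\<^sub>R u x) $ j * pd i \<phi> x - (lam x *\<^sub>R u x) $ i * pd j \<phi> x)"
      by (simp add: oint_def)
  qed
  have trace: "zero_normal_trace \<Omega> u"
    unfolding zero_normal_trace_def
  proof (intro allI impI)
    fix \<phi> :: "real^'n \<Rightarrow> real" assume \<phi>: "smooth_fun \<phi>"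
    have "oint \<Omega> (\<lambda>x. wdiv \<Omega> u x * \<phi> x) = oint \<Omega> (\<lambda>x. f x * \<phi> x)"
    proof (rule oint_cong_AE)
      show "AE x in lebesgue_on \<Omega>. wdiv \<Omega> u x * \<phi> x = f x * \<phi> x" using wd(3) by eventually_elim simp
    qed (use L2_smooth[OF bdd op \<phi>] wd(1) f_L2 in \<open>auto intro!: borel_measurable_times simp: L2_measurable\<close>)
    then show "oint \<Omega> (\<lambda>x. u x \<bullet> grad \<phi> x) + oint \<Omega> (\<lambda>x. wdiv \<Omega> u x * \<phi> x) = 0"
      using flux[OF \<phi>] by simp
  qed
  have uU: "inU \<Omega> lam u"
    unfolding inU_def
  proof (intro conjI exI)
    show "\<forall>i j. L2 \<Omega> (\<lambda>x. 0)" by (simp add: L2_zero)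
    show "has_weak_curl \<Omega> (\<lambda>x. lam x *\<^sub>R u x) (\<lambda>x i j. 0)" by (rule curl)
  qed (use uL f_L2 div trace in auto)
  have "B_CGLS \<Omega> kap lam u p v q = F_CGLS \<Omega> lam f v q" if v: "inU \<Omega> lam v" and q: "inP \<Omega> q" for v q
  proof -
    have vL: "L2v \<Omega> v" "L2 \<Omega> (wdiv \<Omega> v)" using v inU_wdiv by (auto simp: inU_def)
    have qL: "L2 \<Omega> q" using q by (simp add: inP_def)
    \<comment> \<open>\<lambda>u = -G turns the first term into minus the pairing of v with G, and
      Green's formula trades it for the pairing of div v with p.\<close>
    have T1: "oint \<Omega> (\<lambda>x. lam x * (u x \<bullet> v x)) - oint \<Omega> (\<lambda>x. wdiv \<Omega> v x * p x) = 0"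
    proof -
      have "oint \<Omega> (\<lambda>x. lam x * (u x \<bullet> v x)) = oint \<Omega> (\<lambda>x. - (v x \<bullet> G x))"
        by (rule oint_cong) (simp flip: inner_scaleR_left add: lam_u inner_commute)
      then show ?thesis using green[OF v] by (simp add: oint_def)
    qed
    have T3: "oint \<Omega> (\<lambda>x. wdiv \<Omega> u x * q x) = oint \<Omega> (\<lambda>x. f x * q x)"
    proof (rule oint_cong_AE)
      show "AE x in lebesgue_on \<Omega>. wdiv \<Omega> u x * q x = f x * q x" using wd(3) by eventually_elim simp
    qed (use qL wd(1) f_L2 in \<open>auto intro!: borel_measurable_times simp: L2_measurable\<close>)
    have T4: "oint \<Omega> (\<lambda>x. kap x * ((lam x *\<^sub>R u x + wgrad \<Omega> p x) \<bullet> (lam x *\<^sub>R v x + wgrad \<Omega> q x))) = 0"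
    proof -
      have "AE x in lebesgue_on \<Omega>. x \<in> \<Omega>" by (rule AE_I2) (simp add: space_restrict_space)
      then have "AE x in lebesgue_on \<Omega>. kap x * ((lam x *\<^sub>R u x + wgrad \<Omega> p x) \<bullet> (lam x *\<^sub>R v x + wgrad \<Omega> q x)) = 0"
        using wgrad(3)[OF G] by eventually_elim (simp add: lam_u)
      then show ?thesis unfolding oint_def by (rule integral_eq_zero_AE)
    qed
    have T5: "oint \<Omega> (\<lambda>x. lam x * wdiv \<Omega> u x * wdiv \<Omega> v x) = oint \<Omega> (\<lambda>x. lam x * f x * wdiv \<Omega> v x)"
    proof (rule oint_cong_AE)
      show "AE x in lebesgue_on \<Omega>. lam x * wdiv \<Omega> u x * wdiv \<Omega> v x = lam x * f x * wdiv \<Omega> v x"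
        using wd(3) by eventually_elim simp
    qed (use vL wd(1) f_L2 in \<open>auto intro!: borel_measurable_times simp: L2_measurable\<close>)
    have T6: "curl_ip \<Omega> kap (\<lambda>x. lam x *\<^sub>R u x) (\<lambda>x. lam x *\<^sub>R v x) = 0"
    proof -
      have "oint \<Omega> (\<lambda>x. kap x * wcurl \<Omega> (\<lambda>x. lam x *\<^sub>R u x) x i j * wcurl \<Omega> (\<lambda>x. lam x *\<^sub>R v x) x i j) = 0" for i j
      proof -
        have "AE x in lebesgue_on \<Omega>. wcurl \<Omega> (\<lambda>x. lam x *\<^sub>R u x) x i j = 0"
          by (rule wcurl(3)[OF L2_zero curl])
        then have "AE x in lebesgue_on \<Omega>. kap x * wcurl \<Omega> (\<lambda>x. lam x *\<^sub>R u x) x i j * wcurl \<Omega> (\<lambda>x. lam x *\<^sub>R v x) x i j = 0"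
          by eventually_elim simp
        then show ?thesis unfolding oint_def by (rule integral_eq_zero_AE)
      qed
      then show ?thesis by (simp add: curl_ip_def)
    qed
    \<comment> \<open>\<open>T1\<close>, \<open>T4\<close> and \<open>T6\<close> remove their terms;
      \<open>T3\<close> and \<open>T5\<close> leave exactly -(f, q) and half of (\<lambda> f, div
      v).\<close>
    show ?thesis
      unfolding B_CGLS_def F_CGLS_def using T1 T3 T4 T5 T6 by simp
  qed
  with uU p show ?thesis by (rule that)
qed

section \<open>Uniqueness\<close>

text \<open>A nonnegative integrable function with integral 0 vanishes almost everywhere, and
  positivity of k passes this on to w. The bound C secures integrability.\<close>

lemma AE_eq_0_if_weighted_norm_0:
  assumes w: "L2v \<Omega> w" and k: "k \<in> borel_measurable (lebesgue_on \<Omega>)"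
    "\<And>x. x \<in> \<Omega> \<Longrightarrow> 0 < k x" "\<And>x. x \<in> \<Omega> \<Longrightarrow> \<bar>k x\<bar> \<le> C"
    and zero: "oint \<Omega> (\<lambda>x. k x * (w x \<bullet> w x)) = 0"
  shows "AE x in lebesgue_on \<Omega>. w x = 0"
proof -
  have "integrable (lebesgue_on \<Omega>) (\<lambda>x. k x *\<^sub>R w x \<bullet> w x)"
    by (rule L2v_inner_integrable[OF L2v_bounded_scale[OF k(1,3) w] w])
  then have int: "integrable (lebesgue_on \<Omega>) (\<lambda>x. k x * (w x \<bullet> w x))" by simp
  have "AE x in lebesgue_on \<Omega>. 0 \<le> k x * (w x \<bullet> w x)"
    by (rule AE_I2) (use k(2) in \<open>auto simp: space_restrict_space less_imp_le\<close>)
  then have "AE x in lebesgue_on \<Omega>. k x * (w x \<bullet> w x) = 0"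
    using integral_nonneg_eq_0_iff_AE[OF int] zero by (simp add: oint_def)
  moreover have "AE x in lebesgue_on \<Omega>. x \<in> \<Omega>" by (rule AE_I2) (simp add: space_restrict_space)
  ultimately show ?thesis by eventually_elim (use k(2) in force)
qed

text \<open>The difference of two solutions, up to a sign in the pressure, is an admissible test
  pair. Since \<open>wdiv\<close>, \<open>wcurl\<close> and \<open>wgrad\<close> are choices, their
  values at a difference equal the differences only almost everywhere, so the terms of the form are
  compared one by one.\<close>

lemma uniqueness:
  assumes u: "inU \<Omega> lam u" and p: "inP \<Omega> p" and u': "inU \<Omega> lam u'" and p': "inP \<Omega> p'"
    and eq: "\<And>v q. inU \<Omega> lam v \<Longrightarrow> inP \<Omega> q \<Longrightarrow> B_CGLS \<Omega> kap lam u' p' v q = B_CGLS \<Omega> kap lam u p v q"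
  shows "AE x in lebesgue_on \<Omega>. u' x = u x \<and> p' x = p x"
proof -
  define w where "w x = u' x - u x" for x
  \<comment> \<open>The sign is opposite to that of w, which makes the mixed divergence terms
    cancel.\<close>
  define q where "q x = p x - p' x" for x
  have uL: "L2v \<Omega> u" "L2v \<Omega> u'" and pL: "L2 \<Omega> p" "L2 \<Omega> p'" using u u' p p' by (auto simp: inU_def inP_def)
  have wL: "L2v \<Omega> w" unfolding w_def[abs_def] by (rule L2v_diff[OF uL(2,1)])
  have qL: "L2 \<Omega> q" unfolding q_def[abs_def] by (rule L2_diff[OF pL])
  note du = inU_wdiv[OF u] and du' = inU_wdiv[OF u'] and Gp = inP_wgrad[OF p] and Gp' = inP_wgrad[OF p']
  let ?W = "\<lambda>u. wcurl \<Omega> (\<lambda>x. lam x *\<^sub>R u x)"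
  note Wu = inU_wcurl[OF u] and Wu' = inU_wcurl[OF u']
  have div_w: "has_weak_div \<Omega> w (\<lambda>x. wdiv \<Omega> u' x - wdiv \<Omega> u x)"
    unfolding w_def[abs_def] by (rule has_weak_div_diff[OF bdd op uL(2,1) du'(1) du(1) du'(2) du(2)])
  note dw = wdiv[OF L2_diff[OF du'(1) du(1)] div_w]
  have "has_weak_curl \<Omega> (\<lambda>x. lam x *\<^sub>R u' x - lam x *\<^sub>R u x) (\<lambda>x i j. ?W u' x i j - ?W u x i j)"
    by (rule has_weak_curl_diff[OF bdd op L2v_lam[OF uL(2)] L2v_lam[OF uL(1)] Wu'(1) Wu(1) Wu'(2) Wu(2)])
  then have curl_w: "has_weak_curl \<Omega> (\<lambda>x. lam x *\<^sub>R w x) (\<lambda>x i j. ?W u' x i j - ?W u x i j)"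
    by (simp add: w_def scaleR_diff_right)
  note Ww = wcurl[OF L2_diff[OF Wu'(1) Wu(1)] curl_w]
  have "has_weak_grad \<Omega> q (\<lambda>x. wgrad \<Omega> p x - wgrad \<Omega> p' x)"
    unfolding q_def[abs_def] by (rule has_weak_grad_diff[OF bdd op pL Gp(1) Gp'(1) Gp(2) Gp'(2)])
  note Gq = wgrad[OF L2v_diff[OF Gp(1) Gp'(1)] this]
  have "oint \<Omega> q = 0"
    using p p' L2_integrable[OF bdd op] by (simp add: inP_def q_def[abs_def] oint_def)
  with qL Gq have qP: "inP \<Omega> q" unfolding inP_def by blast
  have trace: "zero_normal_trace \<Omega> w"
    unfolding zero_normal_trace_def
  proof (intro allI impI)
    fix \<phi> :: "real^'n \<Rightarrow> real" assume \<phi>: "smooth_fun \<phi>"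
    note L = L2_smooth[OF bdd op \<phi>] L2v_grad[OF bdd op \<phi>]
    have t: "oint \<Omega> (\<lambda>x. u x \<bullet> grad \<phi> x) + oint \<Omega> (\<lambda>x. wdiv \<Omega> u x * \<phi> x) = 0"
      "oint \<Omega> (\<lambda>x. u' x \<bullet> grad \<phi> x) + oint \<Omega> (\<lambda>x. wdiv \<Omega> u' x * \<phi> x) = 0"
      using u u' \<phi> by (auto simp: inU_def zero_normal_trace_def)
    have "oint \<Omega> (\<lambda>x. wdiv \<Omega> w x * \<phi> x) = oint \<Omega> (\<lambda>x. (wdiv \<Omega> u' x - wdiv \<Omega> u x) * \<phi> x)"
    proof (rule oint_cong_AE)
      show "AE x in lebesgue_on \<Omega>. wdiv \<Omega> w x * \<phi> x = (wdiv \<Omega> u' x - wdiv \<Omega> u x) * \<phi> x"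
        using dw(3) by eventually_elim simp
    qed (use L du(1) du'(1) dw(1) in \<open>auto intro!: borel_measurable_times borel_measurable_diff simp: L2_measurable\<close>)
    also have "\<dots> = oint \<Omega> (\<lambda>x. wdiv \<Omega> u' x * \<phi> x) - oint \<Omega> (\<lambda>x. wdiv \<Omega> u x * \<phi> x)"
      by (simp add: oint_def left_diff_distrib L2_mult_integrable L du(1) du'(1))
    moreover have "oint \<Omega> (\<lambda>x. w x \<bullet> grad \<phi> x) = oint \<Omega> (\<lambda>x. u' x \<bullet> grad \<phi> x) - oint \<Omega> (\<lambda>x. u x \<bullet> grad \<phi> x)"
      by (simp add: w_def oint_def inner_diff_left L2v_inner_integrable L uL)
    ultimately show "oint \<Omega> (\<lambda>x. w x \<bullet> grad \<phi> x) + oint \<Omega> (\<lambda>x. wdiv \<Omega> w x * \<phi> x) = 0"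
      using t by simp
  qed
  have wU: "inU \<Omega> lam w"
    unfolding inU_def using wL dw(1,2) Ww(1,2) trace by blast
  have E1: "oint \<Omega> (\<lambda>x. lam x * (u' x \<bullet> w x)) - oint \<Omega> (\<lambda>x. lam x * (u x \<bullet> w x)) = oint \<Omega> (\<lambda>x. lam x * (w x \<bullet> w x))"
  proof -
    have "integrable (lebesgue_on \<Omega>) (\<lambda>x. lam x *\<^sub>R u' x \<bullet> w x)" "integrable (lebesgue_on \<Omega>) (\<lambda>x. lam x *\<^sub>R u x \<bullet> w x)"
      by (intro L2v_inner_integrable L2v_lam uL wL)+
    then have "oint \<Omega> (\<lambda>x. lam x * (u' x \<bullet> w x)) - oint \<Omega> (\<lambda>x. lam x * (u x \<bullet> w x))
        = oint \<Omega> (\<lambda>x. lam x * (u' x \<bullet> w x) - lam x * (u x \<bullet> w x))"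
      by (simp add: oint_def)
    also have "\<dots> = oint \<Omega> (\<lambda>x. lam x * (w x \<bullet> w x))"
      by (rule oint_cong) (simp add: w_def inner_diff_left right_diff_distrib)
    finally show ?thesis .
  qed
  \<comment> \<open>The right sides of \<open>E2\<close> and \<open>E3\<close> are opposite, and
    both terms enter the form with a minus sign, so they cancel.\<close>
  have E2: "oint \<Omega> (\<lambda>x. wdiv \<Omega> w x * p' x) - oint \<Omega> (\<lambda>x. wdiv \<Omega> w x * p x) = - oint \<Omega> (\<lambda>x. wdiv \<Omega> w x * q x)"
    by (simp add: oint_def q_def right_diff_distrib L2_mult_integrable dw(1) pL)
  have E3: "oint \<Omega> (\<lambda>x. wdiv \<Omega> u' x * q x) - oint \<Omega> (\<lambda>x. wdiv \<Omega> u x * q x) = oint \<Omega> (\<lambda>x. wdiv \<Omega> w x * q x)"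
  proof -
    have "oint \<Omega> (\<lambda>x. wdiv \<Omega> w x * q x) = oint \<Omega> (\<lambda>x. (wdiv \<Omega> u' x - wdiv \<Omega> u x) * q x)"
    proof (rule oint_cong_AE)
      show "AE x in lebesgue_on \<Omega>. wdiv \<Omega> w x * q x = (wdiv \<Omega> u' x - wdiv \<Omega> u x) * q x"
        using dw(3) by eventually_elim simp
    qed (use qL du(1) du'(1) dw(1) in \<open>auto intro!: borel_measurable_times borel_measurable_diff simp: L2_measurable\<close>)
    then show ?thesis by (simp add: oint_def left_diff_distrib L2_mult_integrable qL du(1) du'(1))
  qed
  \<comment> \<open>The residual \<lambda>u + \<nabla>p changes by \<lambda>w - \<nabla>q. Paired
    with \<lambda>w + \<nabla>q its cross terms cancel, and \<kappa>\<lambda> = 1 simplifies the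
    rest.\<close>
  have E4: "oint \<Omega> (\<lambda>x. kap x * ((lam x *\<^sub>R u' x + wgrad \<Omega> p' x) \<bullet> (lam x *\<^sub>R w x + wgrad \<Omega> q x)))
      - oint \<Omega> (\<lambda>x. kap x * ((lam x *\<^sub>R u x + wgrad \<Omega> p x) \<bullet> (lam x *\<^sub>R w x + wgrad \<Omega> q x)))
      = oint \<Omega> (\<lambda>x. lam x * (w x \<bullet> w x)) - oint \<Omega> (\<lambda>x. kap x * (wgrad \<Omega> q x \<bullet> wgrad \<Omega> q x))" (is "oint \<Omega> ?a - oint \<Omega> ?b = _")
  proof -
    have L: "L2v \<Omega> (\<lambda>x. lam x *\<^sub>R w x + wgrad \<Omega> q x)" by (intro L2v_add L2v_lam wL Gq(1))
    have "integrable (lebesgue_on \<Omega>) (\<lambda>x. kap x *\<^sub>R (lam x *\<^sub>R u' x + wgrad \<Omega> p' x) \<bullet> (lam x *\<^sub>R w x + wgrad \<Omega> q x))"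
      by (intro L2v_inner_integrable L2v_kap L L2v_add L2v_lam uL Gp'(1))
    then have ia: "integrable (lebesgue_on \<Omega>) ?a" by simp
    have "integrable (lebesgue_on \<Omega>) (\<lambda>x. kap x *\<^sub>R (lam x *\<^sub>R u x + wgrad \<Omega> p x) \<bullet> (lam x *\<^sub>R w x + wgrad \<Omega> q x))"
      by (intro L2v_inner_integrable L2v_kap L L2v_add L2v_lam uL Gp(1))
    then have ib: "integrable (lebesgue_on \<Omega>) ?b" by simp
    have "integrable (lebesgue_on \<Omega>) (\<lambda>x. lam x *\<^sub>R w x \<bullet> w x)" by (intro L2v_inner_integrable L2v_lam wL)
    then have ic: "integrable (lebesgue_on \<Omega>) (\<lambda>x. lam x * (w x \<bullet> w x))" by simp
    have "integrable (lebesgue_on \<Omega>) (\<lambda>x. kap x *\<^sub>R wgrad \<Omega> q x \<bullet> wgrad \<Omega> q x)" by (intro L2v_inner_integrable L2v_kap Gq(1))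
    then have id: "integrable (lebesgue_on \<Omega>) (\<lambda>x. kap x * (wgrad \<Omega> q x \<bullet> wgrad \<Omega> q x))" by simp
    have "oint \<Omega> ?a - oint \<Omega> ?b = oint \<Omega> (\<lambda>x. ?a x - ?b x)" using ia ib by (simp add: oint_def)
    also have "\<dots> = oint \<Omega> (\<lambda>x. lam x * (w x \<bullet> w x) - kap x * (wgrad \<Omega> q x \<bullet> wgrad \<Omega> q x))"
    proof (rule oint_cong_AE)
      have "AE x in lebesgue_on \<Omega>. x \<in> \<Omega>" by (rule AE_I2) (simp add: space_restrict_space)
      then show "AE x in lebesgue_on \<Omega>. ?a x - ?b x = lam x * (w x \<bullet> w x) - kap x * (wgrad \<Omega> q x \<bullet> wgrad \<Omega> q x)"
        using Gq(3)
      proof eventually_elim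
        case (elim x)
        have "?a x - ?b x = kap x * (((lam x *\<^sub>R u' x + wgrad \<Omega> p' x) - (lam x *\<^sub>R u x + wgrad \<Omega> p x)) \<bullet> (lam x *\<^sub>R w x + wgrad \<Omega> q x))"
          by (simp add: inner_diff_left right_diff_distrib)
        also have "(lam x *\<^sub>R u' x + wgrad \<Omega> p' x) - (lam x *\<^sub>R u x + wgrad \<Omega> p x) = lam x *\<^sub>R w x - wgrad \<Omega> q x"
          by (simp add: elim(2) w_def algebra_simps)
        also have "kap x * ((lam x *\<^sub>R w x - wgrad \<Omega> q x) \<bullet> (lam x *\<^sub>R w x + wgrad \<Omega> q x))
            = (kap x * lam x) * lam x * (w x \<bullet> w x) - kap x * (wgrad \<Omega> q x \<bullet> wgrad \<Omega> q x)"
          by (simp add: inner_diff_left inner_add_right inner_commute algebra_simps)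
        finally show ?case by (simp add: kap_lam[OF elim(1)])
      qed
    qed (use ia ib ic id in \<open>auto intro!: borel_measurable_diff borel_measurable_integrable\<close>)
    also have "\<dots> = oint \<Omega> (\<lambda>x. lam x * (w x \<bullet> w x)) - oint \<Omega> (\<lambda>x. kap x * (wgrad \<Omega> q x \<bullet> wgrad \<Omega> q x))"
      using ic id by (simp add: oint_def)
    finally show ?thesis .
  qed
  \<comment> \<open>Shared by the divergence and curl terms: with c = a - b almost everywhere, the
    difference is the integral of k c^2.\<close>
  have diff_square: "oint \<Omega> (\<lambda>x. k x * a x * c x) - oint \<Omega> (\<lambda>x. k x * b x * c x) \<ge> 0"
    if k: "k \<in> borel_measurable (lebesgue_on \<Omega>)" "\<And>x. x \<in> \<Omega> \<Longrightarrow> \<bar>k x\<bar> \<le> C" "\<And>x. x \<in> \<Omega> \<Longrightarrow> 0 \<le> k x"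
      and L: "L2 \<Omega> a" "L2 \<Omega> b" "L2 \<Omega> c" and c: "AE x in lebesgue_on \<Omega>. c x = a x - b x"
    for k a b c :: "real^'n \<Rightarrow> real" and C
  proof -
    have kL: "L2 \<Omega> (\<lambda>x. k x * h x)" if "L2 \<Omega> h" for h
      by (rule L2_bounded_mult[OF k(1) _ that]) (rule k(2))
    have i: "integrable (lebesgue_on \<Omega>) (\<lambda>x. k x * a x * c x)" "integrable (lebesgue_on \<Omega>) (\<lambda>x. k x * b x * c x)"
      by (rule L2_mult_integrable[OF kL[OF L(1)] L(3)], rule L2_mult_integrable[OF kL[OF L(2)] L(3)])
    then have "oint \<Omega> (\<lambda>x. k x * a x * c x) - oint \<Omega> (\<lambda>x. k x * b x * c x) = oint \<Omega> (\<lambda>x. k x * a x * c x - k x * b x * c x)"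
      by (simp add: oint_def)
    moreover have "AE x in lebesgue_on \<Omega>. x \<in> \<Omega>" by (rule AE_I2) (simp add: space_restrict_space)
    then have "AE x in lebesgue_on \<Omega>. 0 \<le> k x * a x * c x - k x * b x * c x"
      using c
    proof eventually_elim
      case (elim x)
      have "k x * a x * c x - k x * b x * c x = k x * (c x)\<^sup>2" by (simp add: elim(2) power2_eq_square algebra_simps)
      then show ?case using k(3)[OF elim(1)] by simp
    qed
    then have "0 \<le> oint \<Omega> (\<lambda>x. k x * a x * c x - k x * b x * c x)"
      unfolding oint_def by (rule integral_nonneg_AE)
    ultimately show ?thesis by simp
  qed
  have E5: "oint \<Omega> (\<lambda>x. lam x * wdiv \<Omega> u' x * wdiv \<Omega> w x) - oint \<Omega> (\<lambda>x. lam x * wdiv \<Omega> u x * wdiv \<Omega> w x) \<ge> 0"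
    by (rule diff_square[OF lam_measurable lam_abs _ du'(1) du(1) dw(1,3)]) (use lam_bd lmin in force)+
  have E6: "curl_ip \<Omega> kap (\<lambda>x. lam x *\<^sub>R u' x) (\<lambda>x. lam x *\<^sub>R w x) - curl_ip \<Omega> kap (\<lambda>x. lam x *\<^sub>R u x) (\<lambda>x. lam x *\<^sub>R w x) \<ge> 0"
  proof -
    have "oint \<Omega> (\<lambda>x. kap x * ?W u' x i j * ?W w x i j) - oint \<Omega> (\<lambda>x. kap x * ?W u x i j * ?W w x i j) \<ge> 0" for i j
      by (rule diff_square[OF kap_measurable kap_abs _ Wu'(1) Wu(1) Ww(1,3)]) (use kap_bd kmin in force)+
    then have "oint \<Omega> (\<lambda>x. kap x * ?W u x i j * ?W w x i j) \<le> oint \<Omega> (\<lambda>x. kap x * ?W u' x i j * ?W w x i j)" for i j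
      by simp
    then show ?thesis unfolding curl_ip_def by (simp add: sum_mono)
  qed
  have nn: "oint \<Omega> (\<lambda>x. lam x * (w x \<bullet> w x)) \<ge> 0" "oint \<Omega> (\<lambda>x. kap x * (wgrad \<Omega> q x \<bullet> wgrad \<Omega> q x)) \<ge> 0"
    unfolding oint_def using lam_bd lmin kap_bd kmin
    by (auto intro!: integral_nonneg_AE AE_I2 mult_nonneg_nonneg simp: space_restrict_space intro: order_trans[OF less_imp_le])
  have "B_CGLS \<Omega> kap lam u' p' w q - B_CGLS \<Omega> kap lam u p w q = 0" using eq[OF wU qP] by simp
  \<comment> \<open>The terms add up to 1/2 (\<lambda>w, w) + 1/2 (\<kappa> \<nabla>q, \<nabla>q)
    plus nonnegative quantities, so both of these integrals vanish.\<close>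
  then have zero: "oint \<Omega> (\<lambda>x. lam x * (w x \<bullet> w x)) = 0" "oint \<Omega> (\<lambda>x. kap x * (wgrad \<Omega> q x \<bullet> wgrad \<Omega> q x)) = 0"
    unfolding B_CGLS_def using E1 E2 E3 E4 E5 E6 nn by linarith+
  have w0: "AE x in lebesgue_on \<Omega>. w x = 0"
    by (rule AE_eq_0_if_weighted_norm_0[OF wL lam_measurable _ lam_abs zero(1)]) (use lam_bd lmin in force)+
  have G0: "AE x in lebesgue_on \<Omega>. wgrad \<Omega> q x = 0"
    by (rule AE_eq_0_if_weighted_norm_0[OF Gq(1) kap_measurable _ kap_abs zero(2)]) (use kap_bd kmin in force)+
  have "oint \<Omega> (\<lambda>x. q x * pd i \<phi> x) = 0" if \<phi>: "test_fun \<Omega> \<phi>" for \<phi> i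
  proof -
    have "AE x in lebesgue_on \<Omega>. wgrad \<Omega> q x $ i * \<phi> x = 0" using G0 by eventually_elim simp
    then have "oint \<Omega> (\<lambda>x. wgrad \<Omega> q x $ i * \<phi> x) = 0" unfolding oint_def by (rule integral_eq_zero_AE)
    then show ?thesis using Gq(2) \<phi> by (simp add: has_weak_grad_def)
  qed
  then obtain c where c: "AE x in lebesgue_on \<Omega>. q x = c"
    using weak_grad_0_AE_const[OF bdd op conn L2_integrable[OF bdd op qL]] by blast
  have q0: "AE x in lebesgue_on \<Omega>. q x = 0"
  proof (cases "\<Omega> = {}")
    case True
    then show ?thesis by (auto intro!: AE_I2 simp: space_restrict_space)
  next
    case False
    then have pos: "0 < oint \<Omega> (indicator \<Omega>)" by (intro oint_indicator_pos op) auto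
    have "oint \<Omega> q = oint \<Omega> (\<lambda>x. c)"
      by (rule oint_cong_AE[OF L2_measurable[OF qL] _ c]) simp
    also have "\<dots> = oint \<Omega> (\<lambda>x. c * indicator \<Omega> x)" by (rule oint_cong) simp
    also have "\<dots> = c * oint \<Omega> (indicator \<Omega>)" by (simp add: oint_def)
    finally have "c = 0" using \<open>oint \<Omega> q = 0\<close> pos by simp
    with c show ?thesis by simp
  qed
  show ?thesis using w0 q0 by eventually_elim (simp add: w_def q_def)
qed

end

lemma C1_on_imp_continuous_on: "open \<Omega> \<Longrightarrow> C1_on \<Omega> f \<Longrightarrow> continuous_on \<Omega> f"
  unfolding C1_on_def by (meson continuous_at_imp_continuous_on has_derivative_continuous)

theorem theorem3p2:
  fixes \<Omega> :: "(real^'n) set"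
    and kap lam f :: "real^'n \<Rightarrow> real"
    and kmin kmax lmin lmax :: real
  assumes dim: "CARD('n) = 2 \<or> CARD('n) = 3"
    and dom: "bounded \<Omega>" "open \<Omega>" "connected \<Omega>" "lipschitz_boundary \<Omega>"
    and lam_inv: "\<forall>x\<in>\<Omega>. lam x = 1 / kap x"
    and lam_C1: "C1_on \<Omega> lam"
    and bounds: "0 < kmin" "kmin \<le> kmax" "0 < lmin" "lmin \<le> lmax"
    and kap_bd: "\<forall>x\<in>\<Omega>. kmin \<le> kap x \<and> kap x \<le> kmax"
    and lam_bd: "\<forall>x\<in>\<Omega>. lmin \<le> lam x \<and> lam x \<le> lmax"
    and f_L2: "L2 \<Omega> f"
    and f_mean: "oint \<Omega> f = 0"
  shows "\<exists>u p. inU \<Omega> lam u \<and> inP \<Omega> p \<and>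
            (\<forall>v q. inU \<Omega> lam v \<and> inP \<Omega> q \<longrightarrow> B_CGLS \<Omega> kap lam u p v q = F_CGLS \<Omega> lam f v q) \<and>
            (\<forall>u' p'. inU \<Omega> lam u' \<and> inP \<Omega> p' \<and>
               (\<forall>v q. inU \<Omega> lam v \<and> inP \<Omega> q \<longrightarrow> B_CGLS \<Omega> kap lam u' p' v q = F_CGLS \<Omega> lam f v q)
               \<longrightarrow> (AE x in lebesgue_on \<Omega>. u' x = u x \<and> p' x = p x))"
proof -
  interpret darcy \<Omega> kap lam f kmin kmax lmin lmax
    by unfold_locales
       ((rule dom bounds f_L2 f_mean C1_on_imp_continuous_on[OF dom(2) lam_C1] | use lam_inv kap_bd lam_bd in blast)+)
  obtain u p where up: "inU \<Omega> lam u" "inP \<Omega> p"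
    "\<And>v q. inU \<Omega> lam v \<Longrightarrow> inP \<Omega> q \<Longrightarrow> B_CGLS \<Omega> kap lam u p v q = F_CGLS \<Omega> lam f v q"
    using existence by blast
  have "AE x in lebesgue_on \<Omega>. u' x = u x \<and> p' x = p x"
    if "inU \<Omega> lam u'" "inP \<Omega> p'"
      "\<forall>v q. inU \<Omega> lam v \<and> inP \<Omega> q \<longrightarrow> B_CGLS \<Omega> kap lam u' p' v q = F_CGLS \<Omega> lam f v q" for u' p'
    by (rule uniqueness[OF up(1,2) that(1,2)]) (use up(3) that(3) in simp)
  with up show ?thesis by blast
qed

end
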